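(* Group isomorphism is $n^{(1/2)\log_p n + O(1)}$ time deterministic Turing reducible to composition-series isomorphism, where $p$ is the smallest prime dividing the order $n$ of the groups. That is, there is a deterministic algorithm with oracle access to the composition-series isomorphism problem which, given two finite groups $G$ and $H$ of order $n$ by their multiplication tables, decides whether $G\cong H$ in time $n^{(1/2)\log_p n + O(1)}$ (each oracle call counting as a single step).
   Context: All groups are finite and given by multiplication tables. A composition series of $G$ is a maximal subnormal series $1 = G_0 \triangleleft G_1 \triangleleft \cdots \triangleleft G_m = G$ (equivalently, every factor $G_{i+1}/G_i$ is simple). Two composition series $G_0 = 1 \triangleleft \cdots \triangleleft G_m = G$ of $G$ and $H_0 = 1 \triangleleft \cdots \triangleleft H_m = H$ of $H$ (of the same length) are isomorphic if there is a group isomorphism $\phi: G \to H$ with $\phi(G_i) = H_i$ for all $i$. In the composition-series isomorphism problem one is given two groups by their multiplication tables together with composition series of each (each subgroup given as the corresponding subset of the group) and must decide whether the two composition series are isomorphic. *)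

theory Defs
  imports Complex_Main "HOL-Algebra.Coset" "HOL-Computational_Algebra.Primes"
begin

section \<open>Composition series\<close>

definition subnormal_series :: "('a, 'b) monoid_scheme \<Rightarrow> 'a set list \<Rightarrow> bool" where
  "subnormal_series G S \<longleftrightarrow>
     S \<noteq> [] \<and> hd S = {\<one>\<^bsub>G\<^esub>} \<and> last S = carrier G \<and>
     (\<forall>i. Suc i < length S \<longrightarrow>
        S ! i \<noteq> S ! Suc i \<and> S ! i \<lhd> (G\<lparr>carrier := S ! Suc i\<rparr>))"

definition composition_series :: "('a, 'b) monoid_scheme \<Rightarrow> 'a set list \<Rightarrow> bool" where
  "composition_series G S \<longleftrightarrow>
     subnormal_series G S \<and>
     (\<forall>T. subnormal_series G T \<and> set S \<subseteq> set T \<longrightarrow> T = S)"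

definition series_isomorphic ::
  "('a, 'c) monoid_scheme \<Rightarrow> 'a set list \<Rightarrow> ('b, 'd) monoid_scheme \<Rightarrow> 'b set list \<Rightarrow> bool" where
  "series_isomorphic G S H T \<longleftrightarrow>
     length S = length T \<and>
     (\<exists>\<phi> \<in> iso G H. \<forall>i < length S. \<phi> ` (S ! i) = T ! i)"


section \<open>Groups given by multiplication tables\<close>

text \<open>
  The elements of a group of order \<open>n\<close> are named \<open>0, \<dots>, n - 1\<close>, in any order; in particular
  the identity need not be \<open>0\<close>. It is recovered from the table.
\<close>

type_synonym table = "nat list list"

definition table_group :: "table \<Rightarrow> nat monoid" where
  "table_group A =
     \<lparr>carrier = {..<length A},
      monoid.mult = (\<lambda>i j. A ! i ! j),
      one = (THE e. e < length A \<and> (\<forall>i < length A. A ! e ! i = i \<and> A ! i ! e = i))\<rparr>"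

definition group_table :: "table \<Rightarrow> bool" where
  "group_table A \<longleftrightarrow> (\<forall>row \<in> set A. length row = length A) \<and> group (table_group A)"


section \<open>Deterministic oracle programs and their running time\<close>

text \<open>
  A structured random access machine. Memory consists of named arrays of natural numbers, each
  indexed by tuples of natural numbers; a scalar variable is the cell with the empty index tuple.
  The only arithmetic operations are successor and predecessor. Hence in \<open>t\<close> steps a fixed program
  can only produce numbers that exceed its input by \<open>O(t)\<close>, and charging one step for every
  assignment, test and oracle call is realistic.
\<close>

type_synonym vname = string
type_synonym state = "vname \<Rightarrow> nat list \<Rightarrow> nat"

datatype aexp = Const nat | Cell vname "aexp list" | Succ aexp | Pred aexp

primrec aval :: "state \<Rightarrow> aexp \<Rightarrow> nat" where
  "aval s (Const k) = k"
| "aval s (Cell a es) = s a (map (aval s) es)"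
| "aval s (Succ e) = aval s e + 1"
| "aval s (Pred e) = aval s e - 1"

datatype bexp = Equal aexp aexp | Less aexp aexp | Neg bexp | Conj bexp bexp

primrec bval :: "state \<Rightarrow> bexp \<Rightarrow> bool" where
  "bval s (Equal e f) = (aval s e = aval s f)"
| "bval s (Less e f) = (aval s e < aval s f)"
| "bval s (Neg b) = (\<not> bval s b)"
| "bval s (Conj b c) = (bval s b \<and> bval s c)"

text \<open>
  One half of an oracle query is a group with a list of subsets. It is described by the order of
  the group, the array holding its multiplication table, the number of subsets, and the array
  holding their characteristic functions: the \<open>k\<close>-th subset contains \<open>i\<close> iff the cell with index
  \<open>[k, i]\<close> is nonzero.
\<close>

datatype query_arg = Query_Arg aexp vname aexp vname

datatype com =
    Skip
  | Assign vname "aexp list" aexp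
  | Seq com com
  | Cond bexp com com
  | While bexp com
  | Query vname query_arg query_arg

type_synonym instance_half = "table \<times> nat set list"
type_synonym oracle_fun = "instance_half \<Rightarrow> instance_half \<Rightarrow> bool"

definition read_table :: "state \<Rightarrow> vname \<Rightarrow> nat \<Rightarrow> table" where
  "read_table s a n = map (\<lambda>i. map (\<lambda>j. s a [i, j]) [0..<n]) [0..<n]"

definition read_subsets :: "state \<Rightarrow> vname \<Rightarrow> nat \<Rightarrow> nat \<Rightarrow> nat set list" where
  "read_subsets s a n l = map (\<lambda>k. {i. i < n \<and> s a [k, i] \<noteq> 0}) [0..<l]"

fun read_arg :: "state \<Rightarrow> query_arg \<Rightarrow> instance_half" where
  "read_arg s (Query_Arg e a f b) =
     (read_table s a (aval s e), read_subsets s b (aval s e) (aval s f))"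

definition store :: "state \<Rightarrow> vname \<Rightarrow> nat list \<Rightarrow> nat \<Rightarrow> state" where
  "store s a is v = s(a := (s a)(is := v))"

text \<open>
  \<open>exec orc c s t s'\<close>: with oracle \<open>orc\<close>, the program \<open>c\<close> started in state \<open>s\<close> halts in state \<open>s'\<close>
  after exactly \<open>t\<close> steps.
\<close>

inductive exec :: "oracle_fun \<Rightarrow> com \<Rightarrow> state \<Rightarrow> nat \<Rightarrow> state \<Rightarrow> bool" for orc :: oracle_fun where
  Skip: "exec orc Skip s 1 s"
| Assign: "exec orc (Assign a es e) s 1 (store s a (map (aval s) es) (aval s e))"
| Seq: "exec orc c s t s' \<Longrightarrow> exec orc d s' u s'' \<Longrightarrow> exec orc (Seq c d) s (t + u) s''"
| CondTrue: "bval s b \<Longrightarrow> exec orc c s t s' \<Longrightarrow> exec orc (Cond b c d) s (1 + t) s'"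
| CondFalse: "\<not> bval s b \<Longrightarrow> exec orc d s t s' \<Longrightarrow> exec orc (Cond b c d) s (1 + t) s'"
| WhileFalse: "\<not> bval s b \<Longrightarrow> exec orc (While b c) s 1 s"
| WhileTrue: "bval s b \<Longrightarrow> exec orc c s t s' \<Longrightarrow> exec orc (While b c) s' u s'' \<Longrightarrow>
    exec orc (While b c) s (1 + t + u) s''"
| Query: "exec orc (Query x q r) s 1
    (store s x [] (if orc (read_arg s q) (read_arg s r) then 1 else 0))"

inductive_cases exec_SkipE: "exec orc Skip s t s'"
inductive_cases exec_AssignE: "exec orc (Assign a es e) s t s'"
inductive_cases exec_SeqE: "exec orc (Seq c d) s t s'"
inductive_cases exec_CondE: "exec orc (Cond b c d) s t s'"
inductive_cases exec_WhileE: "exec orc (While b c) s t s'"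
inductive_cases exec_QueryE: "exec orc (Query x q r) s t s'"

lemma exec_deterministic:
  "exec orc c s t s' \<Longrightarrow> exec orc c s u s'' \<Longrightarrow> u = t \<and> s'' = s'"
proof (induction arbitrary: u s'' rule: exec.induct)
  case (Skip s)
  then show ?case by (elim exec_SkipE) simp
next
  case (Assign a es e s)
  then show ?case by (elim exec_AssignE) simp
next
  case (Seq c s t s' d v r)
  from Seq.prems obtain x y z where "exec orc c s x z" "exec orc d z y s''" "u = x + y"
    by (elim exec_SeqE) simp
  with Seq.IH show ?case by metis
next
  case (CondTrue s b c t s' d)
  from CondTrue.prems CondTrue.hyps obtain x where "exec orc c s x s''" "u = 1 + x"
    by (elim exec_CondE) simp_all
  with CondTrue.IH show ?case by metis
next
  case (CondFalse s b d t s' c)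
  from CondFalse.prems CondFalse.hyps obtain x where "exec orc d s x s''" "u = 1 + x"
    by (elim exec_CondE) simp_all
  with CondFalse.IH show ?case by metis
next
  case (WhileFalse s b c)
  from WhileFalse.prems WhileFalse.hyps show ?case by (cases rule: exec.cases) simp_all
next
  case (WhileTrue s b c t s' v r)
  from WhileTrue.prems WhileTrue.hyps obtain x y z
    where "exec orc c s x z" "exec orc (While b c) z y s''" "u = 1 + x + y"
    by (cases rule: exec.cases) simp_all
  with WhileTrue.IH show ?case by metis
next
  case (Query x q r s)
  then show ?case by (elim exec_QueryE) simp
qed


section \<open>The two problems\<close>

text \<open>
  An oracle for composition-series isomorphism is only required to answer correctly on genuine
  instances; its answers to malformed queries are arbitrary.
\<close>

definition solves_composition_series_iso :: "oracle_fun \<Rightarrow> bool" where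
  "solves_composition_series_iso orc \<longleftrightarrow>
     (\<forall>A S B T.
        group_table A \<and> composition_series (table_group A) S \<and>
        group_table B \<and> composition_series (table_group B) T \<longrightarrow>
        (orc (A, S) (B, T) \<longleftrightarrow> series_isomorphic (table_group A) S (table_group B) T))"

fun table_cell :: "table \<Rightarrow> nat list \<Rightarrow> nat" where
  "table_cell A [i, j] = (if i < length A \<and> j < length (A ! i) then A ! i ! j else 0)"
| "table_cell A _ = 0"

definition input_state :: "table \<Rightarrow> table \<Rightarrow> state" where
  "input_state A B =
     (\<lambda>_ _. 0)(''n'' := (\<lambda>_. 0)([] := length A), ''G'' := table_cell A, ''H'' := table_cell B)"

definition output_of :: "state \<Rightarrow> nat" where
  "output_of s = s ''out'' []"

definition smallest_prime_divisor :: "nat \<Rightarrow> nat" where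
  "smallest_prime_divisor n = (LEAST p. prime p \<and> p dvd n)"

end

theory Submission
  imports Defs "HOL-Algebra.Generated_Groups"
begin

text \<open>
  Enumerate the generator sequences \<open>g\<^sub>1, g\<^sub>2, \<dots>\<close> in which every \<open>g\<^sub>d\<close> lies outside
  \<open>K = \<langle>g\<^sub>1, \<dots>, g\<^bsub>d-1\<^esub>\<rangle>\<close> and is the least element of its coset \<open>g\<^sub>d K\<close>. There are at most \<open>n / |K|\<close>
  choices for \<open>g\<^sub>d\<close>, and every step multiplies \<open>|K|\<close> by at least \<open>p\<close>. Hence the search tree has
  at most \<open>n \<cdot> (n/p) \<cdot> (n/p\<^sup>2) \<cdots> = n\<^bsup>(1/2) log\<^sub>p n + O(1)\<^esup>\<close> nodes.

  A sequence generating the whole group yields a chain of subgroups, and the members of the chain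
  that can be joined to the top by normal steps within the chain form a subnormal series. Every
  subnormal series is contained in one obtained in this way, so the longest series found are
  composition series, and an isomorphism maps the longest series of \<open>G\<close> to longest series of \<open>H\<close>.
  It therefore suffices to keep one longest series of \<open>G\<close> and to compare it, by the oracle, with all
  longest series of \<open>H\<close>. No appeal to the Jordan-Hoelder theorem or to a simplicity test is needed.

  The search recomputes the chain from the current stack of generators in every iteration. This
  costs a polynomial factor, but makes the stack the only state that the loop invariant has to
  describe.
\<close>

section \<open>Loop programs\<close>

text \<open>The machine has no arithmetic beyond successor and predecessor, and times must be proved
  for concrete programs. Everything done within one round of the search is therefore written with
  loops of exactly n rounds. Such programs have a total semantics and a polynomial time bound that
  is read off their syntax. The only unbounded loop is the search itself, whose rounds are counted
  separately by a potential on the nodes of the tree. The least coset representatives depend on how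
  the elements are named, so an isomorphism need not map the enumerated series of one group to
  enumerated series of the other. The image of a series is only known to be contained in an
  enumerated one. Maximal length closes this gap: a longest series contained in another one is equal
  to it. The same argument turns maximal length into maximality under refinement. During the search
  it is not yet known which series are longest. Queries on shorter ones may be malformed and may be
  answered arbitrarily, so their answers have to be thrown away as soon as a longer series turns
  up.\<close>

datatype prog =
    PSkip
  | PAssign vname "aexp list" aexp
  | PQuery vname query_arg query_arg
  | PSeq prog prog
  | PIf bexp prog prog
  | PFor vname prog

primrec compile :: "prog \<Rightarrow> com" where
  "compile PSkip = Skip"
| "compile (PAssign a es e) = Assign a es e"
| "compile (PQuery x q r) = Query x q r"
| "compile (PSeq p q) = Seq (compile p) (compile q)"
| "compile (PIf b p q) = Cond b (compile p) (compile q)"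
| "compile (PFor v p) = Seq (Assign v [] (Const 0))
     (While (Less (Cell v []) (Cell ''n'' [])) (Seq (compile p) (Assign v [] (Succ (Cell v [])))))"

primrec sem :: "oracle_fun \<Rightarrow> prog \<Rightarrow> state \<Rightarrow> state" where
  "sem orc PSkip = (\<lambda>s. s)"
| "sem orc (PAssign a es e) = (\<lambda>s. store s a (map (aval s) es) (aval s e))"
| "sem orc (PQuery x q r) =
     (\<lambda>s. store s x [] (if orc (read_arg s q) (read_arg s r) then 1 else 0))"
| "sem orc (PSeq p q) = (\<lambda>s. sem orc q (sem orc p s))"
| "sem orc (PIf b p q) = (\<lambda>s. if bval s b then sem orc p s else sem orc q s)"
| "sem orc (PFor v p) =
     (\<lambda>s. store (fold (\<lambda>i s. sem orc p (store s v [] i)) [0..<s ''n'' []] s) v [] (s ''n'' []))"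

primrec writes :: "prog \<Rightarrow> vname set" where
  "writes PSkip = {}"
| "writes (PAssign a es e) = {a}"
| "writes (PQuery x q r) = {x}"
| "writes (PSeq p q) = writes p \<union> writes q"
| "writes (PIf b p q) = writes p \<union> writes q"
| "writes (PFor v p) = insert v (writes p)"

text \<open>The semantics sets the loop variable afresh before each round, whereas the compiled loop
  increments it. The two agree if the body leaves the variable alone.\<close>

primrec loops_ok :: "prog \<Rightarrow> bool" where
  "loops_ok PSkip = True"
| "loops_ok (PAssign a es e) = True"
| "loops_ok (PQuery x q r) = True"
| "loops_ok (PSeq p q) = (loops_ok p \<and> loops_ok q)"
| "loops_ok (PIf b p q) = (loops_ok p \<and> loops_ok q)"
| "loops_ok (PFor v p) = (loops_ok p \<and> v \<notin> writes p)"

text \<open>The exponent of \<open>n + 2\<close> in the running time. The base is at least 2, also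
  for \<open>n = 0\<close>, so that x + y <= x * y for the times involved and sequencing becomes
  addition of exponents. The 3 added for a loop pays for n rounds including test and
  increment.\<close>

primrec cost :: "prog \<Rightarrow> nat" where
  "cost PSkip = 1"
| "cost (PAssign a es e) = 1"
| "cost (PQuery x q r) = 1"
| "cost (PSeq p q) = cost p + cost q"
| "cost (PIf b p q) = cost p + cost q"
| "cost (PFor v p) = cost p + 3"

lemma store_apply: "store s a is v b js = (if b = a \<and> js = is then v else s b js)"
  by (simp add: store_def)

lemma store_other: "b \<noteq> a \<Longrightarrow> store s a is v b = s b"
  by (simp add: store_def)

lemma sem_frame: "a \<notin> writes p \<Longrightarrow> sem orc p s a = s a"
proof (induction p arbitrary: s)
  case (PFor v p)
  have "fold (\<lambda>i s. sem orc p (store s v [] i)) is s a = s a" for "is" s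
    using PFor by (induction "is" arbitrary: s) (simp_all add: store_other)
  with PFor.prems show ?case by (simp add: store_other)
qed (simp_all add: store_other)

lemma cost_pos: "cost p \<ge> 1"
  by (induction p) auto

lemma two_le_power_cost: "2 \<le> N \<Longrightarrow> 2 \<le> (N::nat) ^ cost p"
  using cost_pos[of p] self_le_power[of N "cost p"] by simp

lemma compile_exec:
  assumes "loops_ok p" "''n'' \<notin> writes p" "s ''n'' [] + 2 = N"
  shows "\<exists>t \<le> N ^ cost p. exec orc (compile p) s t (sem orc p s)"
  using assms
proof (induction p arbitrary: s)
  case PSkip
  then show ?case by (auto intro!: exI[of _ 1] exec.Skip)
next
  case (PAssign a es e)
  then show ?case by (auto intro!: exI[of _ 1] exec.Assign)
next
  case (PQuery x q r)
  then show ?case using exec.Query by (force intro!: exI[of _ 1])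
next
  case (PSeq p q)
  have N: "N \<ge> 2" using PSeq.prems by simp
  obtain t where t: "t \<le> N ^ cost p" "exec orc (compile p) s t (sem orc p s)"
    using PSeq.IH(1)[of s] PSeq.prems by auto
  have "sem orc p s ''n'' = s ''n''" using PSeq.prems by (simp add: sem_frame)
  then obtain u where u: "u \<le> N ^ cost q" "exec orc (compile q) (sem orc p s) u (sem orc q (sem orc p s))"
    using PSeq.IH(2)[of "sem orc p s"] PSeq.prems by auto
  have "2 \<le> N ^ cost p" "2 \<le> N ^ cost q"
    using N by (simp_all add: two_le_power_cost)
  then have "N ^ cost p + N ^ cost q \<le> N ^ cost p * N ^ cost q"
    using mult_le_mono2[of 2 "N ^ cost q" "N ^ cost p"] mult_le_mono1[of 2 "N ^ cost p" "N ^ cost q"]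
    by linarith
  with t u show ?case by (auto simp: power_add intro!: exI[of _ "t + u"] exec.Seq)
next
  case (PIf b p q)
  have N: "N \<ge> 2" using PIf.prems by simp
  have big: "2 \<le> N ^ cost p" "2 \<le> N ^ cost q"
    using N by (simp_all add: two_le_power_cost)
  then have *: "1 + N ^ cost p \<le> N ^ cost p * N ^ cost q" "1 + N ^ cost q \<le> N ^ cost p * N ^ cost q"
    using mult_le_mono2[of 2 "N ^ cost q" "N ^ cost p"] mult_le_mono1[of 2 "N ^ cost p" "N ^ cost q"]
    by linarith+
  show ?case
  proof (cases "bval s b")
    case True
    obtain t where t: "t \<le> N ^ cost p" "exec orc (compile p) s t (sem orc p s)"
      using PIf.IH(1)[of s] PIf.prems by auto
    with True * show ?thesis
      by (auto simp: power_add intro!: exI[of _ "1 + t"] exec.CondTrue[of s b, simplified])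
  next
    case False
    obtain t where t: "t \<le> N ^ cost q" "exec orc (compile q) s t (sem orc q s)"
      using PIf.IH(2)[of s] PIf.prems by auto
    with False * show ?thesis
      by (auto simp: power_add intro!: exI[of _ "1 + t"] exec.CondFalse[of s b, simplified])
  qed
next
  case (PFor v p)
  define n where "n = s ''n'' []"
  define F where "F i = fold (\<lambda>i s. sem orc p (store s v [] i)) [0..<i] s" for i
  have F_Suc: "F (Suc i) = sem orc p (store (F i) v [] i)" for i by (simp add: F_def)
  have vn: "v \<noteq> ''n''" "v \<notin> writes p" "''n'' \<notin> writes p" "loops_ok p" using PFor.prems by auto
  have Fn: "F i ''n'' = s ''n''" for i
    by (induction i) (use vn in \<open>auto simp: F_Suc sem_frame store_other F_def\<close>)
  let ?W = "While (Less (Cell v []) (Cell ''n'' [])) (Seq (compile p) (Assign v [] (Succ (Cell v []))))"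
  \<comment> \<open>\<open>F i\<close> is the state after i rounds, with the counter stored on top
    of it; the induction is on the number of remaining rounds.\<close>
  have W: "\<exists>t \<le> (n - i) * (N ^ cost p + 2) + 1. exec orc ?W (store (F i) v [] i) t (store (F n) v [] n)"
    if "i \<le> n" for i using that
  proof (induction "n - i" arbitrary: i)
    case 0
    then show ?case using vn Fn
      by (auto intro!: exI[of _ 1] exec.WhileFalse simp: store_apply n_def)
  next
    case (Suc m)
    let ?s = "store (F i) v [] i"
    have "?s ''n'' [] + 2 = N" using vn Fn PFor.prems by (simp add: store_apply)
    then obtain t where t: "t \<le> N ^ cost p" "exec orc (compile p) ?s t (F (Suc i))"
      using PFor.IH vn by (auto simp: F_Suc)
    have "F (Suc i) v [] = i" using vn by (simp add: F_Suc sem_frame store_apply)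
    then have a: "exec orc (Assign v [] (Succ (Cell v []))) (F (Suc i)) 1 (store (F (Suc i)) v [] (Suc i))"
      using exec.Assign[of orc v "[]" "Succ (Cell v [])" "F (Suc i)"] by simp
    from Suc have "m = n - Suc i" "Suc i \<le> n" by auto
    from Suc.hyps(1)[OF this] obtain u where u: "u \<le> (n - Suc i) * (N ^ cost p + 2) + 1"
      "exec orc ?W (store (F (Suc i)) v [] (Suc i)) u (store (F n) v [] n)" by auto
    have b: "bval ?s (Less (Cell v []) (Cell ''n'' []))"
      using vn Fn Suc by (simp add: store_apply n_def)
    have "exec orc ?W ?s (1 + (t + 1) + u) (store (F n) v [] n)"
      by (rule exec.WhileTrue[OF b exec.Seq[OF t(2) a] u(2)])
    moreover have "n - i = Suc (n - Suc i)" using Suc by simp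
    then have "1 + (t + 1) + u \<le> (n - i) * (N ^ cost p + 2) + 1" using t(1) u(1) by simp
    ultimately show ?case by blast
  qed
  obtain t where t: "t \<le> n * (N ^ cost p + 2) + 1" "exec orc ?W (store s v [] 0) t (store (F n) v [] n)"
    using W[of 0] by (auto simp: F_def)
  have "exec orc (compile (PFor v p)) s (1 + t) (sem orc (PFor v p) s)"
    using exec.Seq[OF exec.Assign[of orc v "[]" "Const 0" s], of ?W] t(2) by (simp add: F_def n_def)
  moreover have "1 + t \<le> N ^ cost (PFor v p)"
  proof -
    have N: "N = n + 2" using PFor.prems by (simp add: n_def)
    have "1 \<le> N ^ cost p" using N by simp
    then obtain c where c: "N ^ cost p = c + 1" by (metis add.commute le_Suc_ex)
    have "1 + t \<le> n * (c + 3) + 2" using t(1) c by (simp add: algebra_simps)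
    also have "\<dots> \<le> (c + 1) * (4 * N)" by (simp add: N algebra_simps)
    \<comment> \<open>Two of the three extra factors absorb the 4, since N = n + 2 is at least
      2.\<close>
    also have "\<dots> \<le> (c + 1) * (N * N * N)"
      using mult_le_mono[of 2 N 2 N] by (intro mult_le_mono) (simp_all add: N)
    also have "\<dots> = N ^ cost (PFor v p)" using c by (simp add: power_add power3_eq_cube)
    finally show ?thesis .
  qed
  ultimately show ?case by blast
qed

text \<open>Invariant rule for counted loops: \<open>P i\<close> describes the state after i rounds,
  before the counter is overwritten with i. Later proofs reason about loops through this rule and
  \<open>sem_frame\<close>, so the defining equation leaves the simplifier.\<close>

lemma sem_For_induct:
  assumes "P 0 s" "''n'' \<notin> writes p" "v \<noteq> ''n''"
    and step: "\<And>i s'. i < s ''n'' [] \<Longrightarrow> s' ''n'' = s ''n'' \<Longrightarrow> P i s' \<Longrightarrow> P (Suc i) (sem orc p (store s' v [] i))"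
    and fin: "\<And>s'. P (s ''n'' []) s' \<Longrightarrow> Q (store s' v [] (s ''n'' []))"
  shows "Q (sem orc (PFor v p) s)"
proof -
  let ?F = "\<lambda>i. fold (\<lambda>i s. sem orc p (store s v [] i)) [0..<i] s"
  have "i \<le> s ''n'' [] \<Longrightarrow> P i (?F i) \<and> ?F i ''n'' = s ''n''" for i
  proof (induction i)
    case (Suc i)
    then show ?case using step[of i "?F i"] assms by (auto simp: sem_frame store_other)
  qed (use assms in auto)
  then show ?thesis by (auto intro: fin)
qed

declare sem.simps(6) [simp del]

section \<open>Bounded formulas\<close>

text \<open>First-order conditions with quantifiers over the n element names. The arrays of
  generated subgroups and of marks are updated by such conditions, so that the nested loops
  evaluating them are verified once and for all in \<open>sem_test\<close>.\<close>

datatype fm = FAtom bexp | FNot fm | FAnd fm fm | FAll vname fm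

primrec fval :: "fm \<Rightarrow> state \<Rightarrow> bool" where
  "fval (FAtom b) = (\<lambda>s. bval s b)"
| "fval (FNot \<phi>) = (\<lambda>s. \<not> fval \<phi> s)"
| "fval (FAnd \<phi> \<psi>) = (\<lambda>s. fval \<phi> s \<and> fval \<psi> s)"
| "fval (FAll v \<phi>) = (\<lambda>s. \<forall>i < s ''n'' []. fval \<phi> (store s v [] i))"

abbreviation "FEx v \<phi> \<equiv> FNot (FAll v (FNot \<phi>))"
abbreviation "FOr \<phi> \<psi> \<equiv> FNot (FAnd (FNot \<phi>) (FNot \<psi>))"

primrec anames :: "aexp \<Rightarrow> vname set" where
  "anames (Const k) = {}"
| "anames (Cell a es) = insert a (\<Union>(set (map anames es)))"
| "anames (Succ e) = anames e"
| "anames (Pred e) = anames e"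

primrec bnames :: "bexp \<Rightarrow> vname set" where
  "bnames (Equal e f) = anames e \<union> anames f"
| "bnames (Less e f) = anames e \<union> anames f"
| "bnames (Neg b) = bnames b"
| "bnames (Conj b c) = bnames b \<union> bnames c"

primrec free_names :: "fm \<Rightarrow> vname set" where
  "free_names (FAtom b) = bnames b"
| "free_names (FNot \<phi>) = free_names \<phi>"
| "free_names (FAnd \<phi> \<psi>) = free_names \<phi> \<union> free_names \<psi>"
| "free_names (FAll v \<phi>) = free_names \<phi> - {v}"

primrec bound_names :: "fm \<Rightarrow> vname set" where
  "bound_names (FAtom b) = {}"
| "bound_names (FNot \<phi>) = bound_names \<phi>"
| "bound_names (FAnd \<phi> \<psi>) = bound_names \<phi> \<union> bound_names \<psi>"
| "bound_names (FAll v \<phi>) = insert v (bound_names \<phi>)"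

definition junk :: "vname set" where "junk = {''r'', ''T''}"

text \<open>Evaluating a formula overwrites the scalars of its bound variables. They must not be
  read by what is evaluated afterwards: the second conjunct, or the body of a quantifier in its next
  round.\<close>

primrec fm_ok :: "fm \<Rightarrow> bool" where
  "fm_ok (FAtom b) = (bnames b \<inter> junk = {})"
| "fm_ok (FNot \<phi>) = fm_ok \<phi>"
| "fm_ok (FAnd \<phi> \<psi>) = (fm_ok \<phi> \<and> fm_ok \<psi> \<and> bound_names \<phi> \<inter> free_names \<psi> = {})"
| "fm_ok (FAll v \<phi>) = (fm_ok \<phi> \<and> v \<noteq> ''n'' \<and> v \<notin> junk \<and> v \<notin> bound_names \<phi> \<and>
     bound_names \<phi> \<inter> free_names \<phi> = {})"

text \<open>
  Evaluation of a formula leaves junk behind in the array \<open>''r''\<close> of intermediate results and in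
  the scalars used as bound variables. \<open>agree Z\<close> is equality up to that junk.
\<close>

definition agree :: "vname set \<Rightarrow> state \<Rightarrow> state \<Rightarrow> bool" where
  "agree Z s s' \<longleftrightarrow> (\<forall>a is. a \<notin> junk \<longrightarrow> (is = [] \<and> a \<in> Z) \<or> s a is = s' a is)"

lemma agreeD: "agree Z s s' \<Longrightarrow> a \<notin> Z \<Longrightarrow> a \<notin> junk \<Longrightarrow> s a = s' a"
  by (rule ext) (auto simp: agree_def)

lemma agree_refl: "agree Z s s" by (simp add: agree_def)

lemma agree_sym: "agree Z s s' \<Longrightarrow> agree Z s' s" by (simp add: agree_def) metis

lemma agree_trans: "agree Z s s' \<Longrightarrow> agree Z s' s'' \<Longrightarrow> agree Z s s''"
  unfolding agree_def by metis

lemma agree_mono: "agree Z s s' \<Longrightarrow> Z \<subseteq> Z' \<Longrightarrow> agree Z' s s'"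
  unfolding agree_def by blast

lemma agree_store: "agree (insert v Z) s s' \<Longrightarrow> agree Z (store s v [] i) (store s' v [] i)"
  unfolding agree_def by (auto simp: store_apply)

lemma agree_store_junk: "agree Z s s' \<Longrightarrow> a \<in> junk \<Longrightarrow> agree Z s (store s' a is i)"
  unfolding agree_def by (auto simp: store_apply)

lemma agree_store_r: "agree Z s s' \<Longrightarrow> agree Z s (store s' ''r'' is i)"
  by (rule agree_store_junk) (simp_all add: junk_def)

lemma aval_agree: "agree Z s s' \<Longrightarrow> anames e \<inter> Z = {} \<Longrightarrow> anames e \<inter> junk = {} \<Longrightarrow> aval s e = aval s' e"
proof (induction e)
  case (Cell a es)
  then have "map (aval s) es = map (aval s') es" by fastforce
  moreover have "a \<notin> Z" "a \<notin> junk" using Cell.prems by auto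
  ultimately show ?case using agreeD[OF Cell.prems(1), of a] by (simp only: aval.simps simp_thms)
qed auto

lemma bval_agree: "agree Z s s' \<Longrightarrow> bnames b \<inter> Z = {} \<Longrightarrow> bnames b \<inter> junk = {} \<Longrightarrow> bval s b = bval s' b"
proof (induction b)
  case (Equal e f)
  have "aval s e = aval s' e" "aval s f = aval s' f"
    by (rule aval_agree[OF Equal.prems(1)]; use Equal.prems in auto)+
  then show ?case by simp
next
  case (Less e f)
  have "aval s e = aval s' e" "aval s f = aval s' f"
    by (rule aval_agree[OF Less.prems(1)]; use Less.prems in auto)+
  then show ?case by simp
qed auto

lemma fval_agree:
  "agree Z s s' \<Longrightarrow> free_names \<phi> \<inter> Z = {} \<Longrightarrow> fm_ok \<phi> \<Longrightarrow> ''n'' \<notin> Z \<Longrightarrow> fval \<phi> s = fval \<phi> s'"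
proof (induction \<phi> arbitrary: s s' Z)
  case (FAtom b)
  then show ?case using bval_agree by auto
next
  case (FNot \<phi>)
  then show ?case using FNot.IH[OF FNot.prems(1)] by simp
next
  case (FAnd \<phi> \<psi>)
  have "fval \<phi> s = fval \<phi> s'" "fval \<psi> s = fval \<psi> s'"
    by (rule FAnd.IH(1)[OF FAnd.prems(1)] FAnd.IH(2)[OF FAnd.prems(1)]; use FAnd.prems in auto)+
  then show ?case by simp
next
  case (FAll v \<phi>)
  \<comment> \<open>Both sides set v to the same value, so v may be free in the body although the
    states disagreed on it.\<close>
  have "agree (Z - {v}) (store s v [] i) (store s' v [] i)" for i
    by (rule agree_store) (rule agree_mono[OF FAll.prems(1)], auto)
  then have "fval \<phi> (store s v [] i) = fval \<phi> (store s' v [] i)" for i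
    by (rule FAll.IH) (use FAll.prems in auto)
  moreover have "s ''n'' [] = s' ''n'' []" using agreeD[OF FAll.prems(1), of "''n''"] FAll.prems(4) by (simp add: junk_def)
  ultimately show ?case by simp
qed

abbreviation result :: "nat \<Rightarrow> aexp" where "result k \<equiv> Cell ''r'' [Const k]"

text \<open>The index k is the quantifier depth: a quantifier accumulates its answer in cell k while
  its body works in cell k + 1. A conjunction can reuse the same cell, because a true first conjunct
  need not be remembered.\<close>

primrec test :: "fm \<Rightarrow> nat \<Rightarrow> prog" where
  "test (FAtom b) = (\<lambda>k. PIf b (PAssign ''r'' [Const k] (Const 1)) (PAssign ''r'' [Const k] (Const 0)))"
| "test (FNot \<phi>) = (\<lambda>k. PSeq (test \<phi> k) (PIf (Equal (result k) (Const 0))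
     (PAssign ''r'' [Const k] (Const 1)) (PAssign ''r'' [Const k] (Const 0))))"
| "test (FAnd \<phi> \<psi>) = (\<lambda>k. PSeq (test \<phi> k) (PIf (Equal (result k) (Const 0)) PSkip (test \<psi> k)))"
| "test (FAll v \<phi>) = (\<lambda>k. PSeq (PAssign ''r'' [Const k] (Const 1))
     (PFor v (PSeq (test \<phi> (Suc k))
        (PIf (Equal (result (Suc k)) (Const 0)) (PAssign ''r'' [Const k] (Const 0)) PSkip))))"

lemma writes_test: "writes (test \<phi> k) = insert ''r'' (bound_names \<phi>)"
  by (induction \<phi> arbitrary: k) auto

lemma loops_ok_test: "fm_ok \<phi> \<Longrightarrow> loops_ok (test \<phi> k)"
  by (induction \<phi> arbitrary: k) (auto simp: writes_test junk_def)

lemma n_not_bound: "fm_ok \<phi> \<Longrightarrow> ''n'' \<notin> bound_names \<phi>"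
  by (induction \<phi>) auto

text \<open>The two additional conclusions strengthen the induction. Preservation of the lower
  result cells keeps the accumulated answer of an enclosing quantifier, and agreement up to junk
  lets the remaining parts be evaluated as in the initial state.\<close>

lemma sem_test:
  assumes "fm_ok \<phi>"
  shows "sem orc (test \<phi> k) s ''r'' [k] = of_bool (fval \<phi> s) \<and>
    (\<forall>j<k. sem orc (test \<phi> k) s ''r'' [j] = s ''r'' [j]) \<and>
    agree (bound_names \<phi>) s (sem orc (test \<phi> k) s)"
  using assms
proof (induction \<phi> arbitrary: k s)
  case (FAtom b)
  then show ?case by (auto simp: store_apply agree_store_r agree_refl)
next
  case (FNot \<phi>)
  then have "fm_ok \<phi>" by simp
  with FNot.IH[of k s] show ?case by (auto simp: store_apply intro!: agree_store_r)
next
  case (FAnd \<phi> \<psi>)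
  let ?s = "sem orc (test \<phi> k) s"
  have ok: "fm_ok \<phi>" "fm_ok \<psi>" "bound_names \<phi> \<inter> free_names \<psi> = {}" using FAnd.prems by auto
  note 1 = FAnd.IH(1)[OF ok(1), of k s] and 2 = FAnd.IH(2)[OF ok(2), of k ?s]
  have "fval \<psi> ?s = fval \<psi> s"
    by (rule fval_agree[OF agree_sym[of "bound_names \<phi>"]]) (use 1 ok n_not_bound in auto)
  moreover have "agree (bound_names \<phi> \<union> bound_names \<psi>) s ?s"
    "agree (bound_names \<phi> \<union> bound_names \<psi>) ?s (sem orc (test \<psi> k) ?s)"
    using 1 2 by (auto intro: agree_mono)
  ultimately show ?case using 1 2 by (auto intro: agree_trans)
next
  case (FAll v \<phi>)
  have ok: "fm_ok \<phi>" "v \<noteq> ''n''" "v \<noteq> ''r''" "v \<notin> bound_names \<phi>" "bound_names \<phi> \<inter> free_names \<phi> = {}"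
    using FAll.prems by (auto simp: junk_def)
  let ?s = "store s ''r'' [k] 1"
  let ?B = "insert v (bound_names \<phi>)"
  define P where "P i s' \<longleftrightarrow> s' ''r'' [k] = of_bool (\<forall>j<i. fval \<phi> (store s v [] j)) \<and>
    (\<forall>j<k. s' ''r'' [j] = s ''r'' [j]) \<and> agree ?B s s'" for i s'
  define Q where "Q s' \<longleftrightarrow> P (s ''n'' []) s'" for s'
  let ?p = "PSeq (test \<phi> (Suc k))
        (PIf (Equal (result (Suc k)) (Const 0)) (PAssign ''r'' [Const k] (Const 0)) PSkip)"
  have "Q (sem orc (PFor v ?p) ?s)"
  proof (rule sem_For_induct[where P = P])
    show "P 0 ?s" by (simp add: P_def store_apply agree_store_r agree_refl)
    show "''n'' \<notin> writes ?p" using n_not_bound[OF ok(1)] by (simp add: writes_test)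
    show "v \<noteq> ''n''" by fact
    show "Q (store s' v [] (?s ''n'' []))" if "P (?s ''n'' []) s'" for s'
      using that ok unfolding Q_def P_def by (auto simp: store_apply agree_def)
    fix i s' assume i: "i < ?s ''n'' []" "P i s'"
    let ?u = "store s' v [] i"
    let ?w = "sem orc (test \<phi> (Suc k)) ?u"
    note IH = FAll.IH[OF ok(1), of "Suc k" ?u]
    have ag: "agree ?B s s'" using i P_def by simp
    have "agree (bound_names \<phi>) ?u (store s v [] i)"
      by (rule agree_store) (rule agree_sym[OF ag])
    then have fv: "fval \<phi> ?u = fval \<phi> (store s v [] i)"
      by (rule fval_agree) (use ok n_not_bound in auto)
    have "agree ?B s ?u" using ag by (auto simp: agree_def store_apply)
    then have w3: "agree ?B s ?w"
      using IH agree_mono[of "bound_names \<phi>" _ _ ?B] agree_trans by blast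
    have w1: "?w ''r'' [Suc k] = of_bool (fval \<phi> (store s v [] i))" using IH fv by simp
    have w2: "?w ''r'' [j] = s' ''r'' [j]" if "j \<le> k" for j
      using IH ok(3) that by (simp add: store_other)
    show "P (Suc i) (sem orc ?p ?u)"
    proof (cases "fval \<phi> (store s v [] i)")
      case True
      then have "sem orc ?p ?u = ?w" using w1 by simp
      then show ?thesis using True i(2) w2 w3 unfolding P_def by (simp add: less_Suc_eq all_conj_distrib)
    next
      case False
      then have "sem orc ?p ?u = store ?w ''r'' [k] 0" using w1 by simp
      then show ?thesis using False i(2) w2 w3 unfolding P_def
        by (auto simp add: store_apply intro: agree_store_r)
    qed
  qed
  then show ?case by (simp add: Q_def P_def)
qed

abbreviation "dvar \<equiv> Cell ''d'' []"
abbreviation "ivar \<equiv> Cell ''i'' []"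

text \<open>Each round changes the array in the single cell it is responsible for, so the values
  written earlier survive. \<open>J\<close> carries whatever else the rounds need; it has to be
  stable under setting the two counters.\<close>

lemma sem_For_For:
  assumes p: "''n'' \<notin> writes p" "''d'' \<notin> writes p" "''i'' \<notin> writes p" and a: "a \<noteq> ''d''" "a \<noteq> ''i''"
    and J: "J s" "\<And>s' x v. J s' \<Longrightarrow> x \<in> {''d'', ''i''} \<Longrightarrow> J (store s' x [] v)"
    and step: "\<And>s' d i. J s' \<Longrightarrow> d < s ''n'' [] \<Longrightarrow> i < s ''n'' [] \<Longrightarrow> s' ''d'' [] = d \<Longrightarrow> s' ''i'' [] = i \<Longrightarrow>
      J (sem orc p s') \<and> sem orc p s' a [d, i] = g d i \<and>
      (\<forall>js. js \<noteq> [d, i] \<longrightarrow> sem orc p s' a js = s' a js)"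
    and less: "d < s ''n'' []" "i < s ''n'' []"
  shows "sem orc (PFor ''d'' (PFor ''i'' p)) s a [d, i] = g d i"
proof -
  define n where "n = s ''n'' []"
  define P where "P k s' \<longleftrightarrow> J s' \<and> (\<forall>d<k. \<forall>i<n. s' a [d, i] = g d i)" for k s'
  define Q where "Q s' \<longleftrightarrow> (\<forall>d<n. \<forall>i<n. s' a [d, i] = g d i)" for s'
  have "Q (sem orc (PFor ''d'' (PFor ''i'' p)) s)"
  proof (rule sem_For_induct[where P = P])
    show "P 0 s" using J by (simp add: P_def)
    show "''n'' \<notin> writes (PFor ''i'' p)" "''d'' \<noteq> ''n''" using p by auto
    show "Q (store s' ''d'' [] (s ''n'' []))" if "P (s ''n'' []) s'" for s'
      using that a by (simp add: P_def Q_def store_other n_def)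
    fix k s' assume k: "k < s ''n'' []" "s' ''n'' = s ''n''" "P k s'"
    define s1 where "s1 = store s' ''d'' [] k"
    define P1 where "P1 j s2 \<longleftrightarrow> P k s2 \<and> s2 ''d'' [] = k \<and> (\<forall>i<j. s2 a [k, i] = g k i)" for j s2
    have s1: "s1 ''n'' [] = n" "s1 ''d'' [] = k" "P k s1"
      using k J a by (auto simp: s1_def store_other n_def P_def) (simp add: store_def)
    show "P (Suc k) (sem orc (PFor ''i'' p) (store s' ''d'' [] k))"
      unfolding s1_def[symmetric]
    proof (rule sem_For_induct[where P = P1])
      show "P1 0 s1" using s1 by (simp add: P1_def)
      show "''n'' \<notin> writes p" "''i'' \<noteq> ''n''" using p by auto
      show "P (Suc k) (store s2 ''i'' [] (s1 ''n'' []))" if "P1 (s1 ''n'' []) s2" for s2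
        using that a J s1 by (auto simp: P1_def P_def store_other less_Suc_eq)
      fix j s2 assume j: "j < s1 ''n'' []" "P1 j s2"
      let ?s = "store s2 ''i'' [] j"
      have "J ?s" using j J by (simp add: P1_def P_def)
      moreover have d: "?s ''d'' [] = k" "?s ''i'' [] = j" using j by (simp_all add: store_def P1_def)
      ultimately have *: "J (sem orc p ?s)" "sem orc p ?s a [k, j] = g k j"
        "\<And>js. js \<noteq> [k, j] \<Longrightarrow> sem orc p ?s a js = s2 a js"
        using step[of ?s k j] k j s1 a by (simp_all add: n_def store_other)
      have "sem orc p ?s ''d'' [] = k" using d p by (simp add: sem_frame)
      with * j show "P1 (Suc j) (sem orc p ?s)"
        by (auto simp: P1_def P_def less_Suc_eq)
    qed
  qed
  then show ?thesis using less by (simp add: Q_def n_def)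
qed

definition copy :: "vname \<Rightarrow> vname \<Rightarrow> prog" where
  "copy a b = PFor ''d'' (PFor ''i'' (PAssign a [dvar, ivar] (Cell b [dvar, ivar])))"

definition fill :: "fm \<Rightarrow> prog" where
  "fill \<phi> = PFor ''d'' (PFor ''i'' (PSeq (test \<phi> 0) (PAssign ''T'' [dvar, ivar] (result 0))))"

text \<open>The array \<open>''T''\<close> buffers the values, so that \<open>\<phi>\<close> may refer to the array being assigned.\<close>

definition compr :: "vname \<Rightarrow> fm \<Rightarrow> prog" where
  "compr a \<phi> = PSeq (fill \<phi>) (copy a ''T'')"

definition compr_ok :: "fm \<Rightarrow> bool" where
  "compr_ok \<phi> \<longleftrightarrow> fm_ok \<phi> \<and> ''d'' \<notin> bound_names \<phi> \<and> ''i'' \<notin> bound_names \<phi> \<and> ''T'' \<notin> bound_names \<phi> \<and>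
     bound_names \<phi> \<inter> free_names \<phi> = {}"

lemma sem_copy:
  assumes "a \<noteq> b" "a \<notin> {''n'', ''d'', ''i''}" "b \<notin> {''d'', ''i''}" "d < s ''n'' []" "i < s ''n'' []"
  shows "sem orc (copy a b) s a [d, i] = s b [d, i]"
  unfolding copy_def
  by (rule sem_For_For[where J = "\<lambda>s'. s' b = s b"]) (use assms in \<open>auto simp: store_def\<close>)

lemma sem_fill:
  assumes ok: "compr_ok \<phi>" and less: "d < s ''n'' []" "i < s ''n'' []"
  shows "sem orc (fill \<phi>) s ''T'' [d, i] = of_bool (fval \<phi> (store (store s ''d'' [] d) ''i'' [] i))"
proof -
  let ?B = "bound_names \<phi> \<union> {''d'', ''i''}"
  have n: "''n'' \<notin> bound_names \<phi>" using ok n_not_bound by (simp add: compr_ok_def)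
  show ?thesis
    unfolding fill_def
  \<comment> \<open>The buffer \<open>''T''\<close> counts as junk, so every round still sees the
    initial state up to junk, counters and bound variables.\<close>
  proof (rule sem_For_For[where J = "agree ?B s"], goal_cases)
    case (7 s' x v)
    then show ?case by (auto simp: agree_def store_apply)
  next
    case (8 s' d i)
    let ?t = "sem orc (test \<phi> 0) s'"
    have t: "?t ''r'' [0] = of_bool (fval \<phi> s')" "agree (bound_names \<phi>) s' ?t"
      using sem_test[of \<phi> orc 0 s'] ok by (auto simp: compr_ok_def)
    have w: "?t ''d'' = s' ''d''" "?t ''i'' = s' ''i''" "?t ''T'' = s' ''T''"
      using ok by (auto simp: writes_test compr_ok_def intro!: sem_frame)
    have "agree (bound_names \<phi>) (store (store s' ''d'' [] d) ''i'' [] i) (store (store s ''d'' [] d) ''i'' [] i)"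
      by (intro agree_store agree_mono[OF agree_sym[OF 8(1)]]) auto
    moreover have "store (store s' ''d'' [] d) ''i'' [] i = s'"
      using 8(4,5) by (intro ext) (auto simp: store_def)
    ultimately have "agree (bound_names \<phi>) s' (store (store s ''d'' [] d) ''i'' [] i)" by simp
    then have f: "fval \<phi> s' = fval \<phi> (store (store s ''d'' [] d) ''i'' [] i)"
      by (rule fval_agree) (use ok n in \<open>auto simp: compr_ok_def\<close>)
    have ag: "agree ?B s ?t"
      by (rule agree_trans[OF 8(1) agree_mono[OF t(2)]]) auto
    have e: "sem orc (PSeq (test \<phi> 0) (PAssign ''T'' [dvar, ivar] (result 0))) s' =
        store ?t ''T'' [d, i] (of_bool (fval \<phi> (store (store s ''d'' [] d) ''i'' [] i)))"
      using t(1) w 8(4,5) unfolding f by simp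
    have "agree ?B s (store ?t ''T'' [d, i] v)" for v
      by (rule agree_store_junk[OF ag]) (simp add: junk_def)
    moreover have "store ?t ''T'' [d, i] v ''T'' [d, i] = v" for v
      by (simp add: store_def)
    moreover have "store ?t ''T'' [d, i] v ''T'' js = s' ''T'' js" if "js \<noteq> [d, i]" for v js
      using w that by (simp add: store_def)
    ultimately show ?case unfolding e by blast
  qed (use ok n less in \<open>auto simp: writes_test compr_ok_def agree_refl\<close>)
qed

lemma writes_compr: "writes (compr a \<phi>) = {a, ''d'', ''i'', ''T'', ''r''} \<union> bound_names \<phi>"
  by (auto simp: compr_def fill_def copy_def writes_test)

lemma loops_ok_compr: "compr_ok \<phi> \<Longrightarrow> a \<notin> {''d'', ''i''} \<Longrightarrow> loops_ok (compr a \<phi>)"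
  by (auto simp: compr_def fill_def copy_def writes_test compr_ok_def loops_ok_test)

lemma sem_compr:
  assumes ok: "compr_ok \<phi>" and a: "a \<notin> {''n'', ''d'', ''i'', ''T''}" and less: "d < s ''n'' []" "i < s ''n'' []"
  shows "sem orc (compr a \<phi>) s a [d, i] = of_bool (fval \<phi> (store (store s ''d'' [] d) ''i'' [] i))"
proof -
  have n: "''n'' \<notin> bound_names \<phi>" using ok n_not_bound by (simp add: compr_ok_def)
  have "sem orc (fill \<phi>) s ''n'' = s ''n''"
    using n by (intro sem_frame) (simp add: fill_def writes_test)
  then show ?thesis using assms by (simp add: compr_def sem_copy sem_fill)
qed

section \<open>Subnormal series inside chains of subgroups\<close>

text \<open>Normality without inverses: the conjugate z of b by a is described by z a = a b, which
  can be tested by table lookups alone.\<close>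

definition closed_under_conj :: "('a, 'b) monoid_scheme \<Rightarrow> 'a set \<Rightarrow> 'a set \<Rightarrow> bool" where
  "closed_under_conj G N H \<longleftrightarrow> (\<forall>a\<in>H. \<forall>b\<in>N. \<exists>z\<in>N. z \<otimes>\<^bsub>G\<^esub> a = a \<otimes>\<^bsub>G\<^esub> b)"

text \<open>The head of a strict chain is the least member of its underlying set, so the set
  determines the list.\<close>

lemma sorted_wrt_psubset_unique:
  "sorted_wrt (\<subset>) S \<Longrightarrow> sorted_wrt (\<subset>) T \<Longrightarrow> set S = set T \<Longrightarrow> S = T"
proof (induction S arbitrary: T)
  case (Cons x S)
  then obtain y T' where T: "T = y # T'" by (cases T) auto
  have S: "\<forall>z\<in>set S. x \<subset> z" "sorted_wrt (\<subset>) S" and T': "\<forall>z\<in>set T'. y \<subset> z" "sorted_wrt (\<subset>) T'"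
    using Cons.prems T by simp_all
  have eq: "insert x (set S) = insert y (set T')" using Cons.prems(3) T by simp
  have xy: "x = y"
  proof (rule ccontr)
    assume "x \<noteq> y"
    then have "x \<in> set T'" "y \<in> set S" using eq by blast+
    then show False using S(1) T'(1) by blast
  qed
  have "x \<notin> set S" "x \<notin> set T'" using S(1) T'(1) xy by blast+
  then have "set S = set T'" using eq insert_ident[of x "set S" "set T'"] unfolding xy by simp
  then show ?case using Cons.IH[OF S(2) T'(2)] T xy by simp
qed auto

context group begin

lemma normal_in_subgroup_iff:
  assumes "subgroup N G" "subgroup H G" "N \<subseteq> H"
  shows "N \<lhd> G\<lparr>carrier := H\<rparr> \<longleftrightarrow> closed_under_conj G N H"
proof -
  interpret H: group "G\<lparr>carrier := H\<rparr>" using assms subgroup_imp_group by blast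
  have conj: "(\<exists>z\<in>N. z \<otimes> a = a \<otimes> b) \<longleftrightarrow> a \<otimes> b \<otimes> inv a \<in> N" if "a \<in> H" "b \<in> N" for a b
  proof -
    have c: "a \<in> carrier G" "b \<in> carrier G" "\<And>z. z \<in> N \<Longrightarrow> z \<in> carrier G"
      using that assms subgroup.mem_carrier by metis+
    show ?thesis
    proof
      assume "\<exists>z\<in>N. z \<otimes> a = a \<otimes> b"
      then obtain z where "z \<in> N" "z \<otimes> a = a \<otimes> b" by auto
      then show "a \<otimes> b \<otimes> inv a \<in> N" using c by (metis inv_solve_right m_closed)
    next
      assume "a \<otimes> b \<otimes> inv a \<in> N"
      moreover have "a \<otimes> b \<otimes> inv a \<otimes> a = a \<otimes> b" using c by (simp add: m_assoc)
      ultimately show "\<exists>z\<in>N. z \<otimes> a = a \<otimes> b" by blast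
    qed
  qed
  have "subgroup N (G\<lparr>carrier := H\<rparr>)" using assms subgroup_incl by blast
  then show ?thesis
    unfolding H.normal_inv_iff closed_under_conj_def using assms conj by simp
qed

lemma closed_under_conj_mono: "closed_under_conj G N H \<Longrightarrow> H' \<subseteq> H \<Longrightarrow> closed_under_conj G N H'"
  unfolding closed_under_conj_def by blast

lemma trivial_closed_under_conj: "H \<subseteq> carrier G \<Longrightarrow> closed_under_conj G {\<one>} H"
  unfolding closed_under_conj_def by auto

text \<open>Left translation by a member is an injective self-map of the finite set, hence onto; a
  preimage of the identity is the inverse.\<close>

lemma finite_closed_imp_subgroup:
  assumes "C \<subseteq> carrier G" "finite C" "\<one> \<in> C" "\<And>x y. x \<in> C \<Longrightarrow> y \<in> C \<Longrightarrow> x \<otimes> y \<in> C"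
  shows "subgroup C G"
proof (rule subgroupI)
  fix x assume x: "x \<in> C"
  have "inj_on ((\<otimes>) x) C"
    using assms(1) x by (intro inj_onI) (metis Units_eq Units_l_cancel subsetD)
  moreover have "(\<otimes>) x ` C \<subseteq> C" using assms x by auto
  ultimately have "(\<otimes>) x ` C = C" using assms(2) by (simp add: endo_inj_surj)
  then obtain y where "y \<in> C" "x \<otimes> y = \<one>" using assms(3) by (metis imageE)
  then show "inv x \<in> C" using assms(1) x by (metis inv_equality inv_inv subsetD)
qed (use assms in auto)

lemma subnormal_seriesD:
  assumes "subnormal_series G S" "i < length S"
  shows "subgroup (S ! i) G"
    and "Suc i < length S \<Longrightarrow> S ! i \<subset> S ! Suc i \<and> closed_under_conj G (S ! i) (S ! Suc i)"
proof -
  have step: "subgroup (S ! i) G \<and> S ! i \<subset> S ! Suc i \<and> closed_under_conj G (S ! i) (S ! Suc i)"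
    if "subgroup (S ! Suc i) G" "Suc i < length S" for i
  proof -
    have N: "S ! i \<lhd> G\<lparr>carrier := S ! Suc i\<rparr>" "S ! i \<noteq> S ! Suc i"
      using assms that unfolding subnormal_series_def by auto
    then have sub: "subgroup (S ! i) (G\<lparr>carrier := S ! Suc i\<rparr>)" by (simp add: normal_imp_subgroup)
    then have "subgroup (S ! i) G" "S ! i \<subseteq> S ! Suc i"
      using incl_subgroup that subgroup.subset by fastforce+
    then show ?thesis using N that normal_in_subgroup_iff by blast
  qed
  \<comment> \<open>Normality relates a member only to the next one, so being a subgroup of the
    whole group has to descend from the top.\<close>
  have all: "subgroup (S ! (length S - 1 - k)) G" if "k < length S" for k
    using that
  proof (induction k)
    case 0
    then show ?case using assms by (simp add: subnormal_series_def last_conv_nth subgroup_self)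
  next
    case (Suc k)
    then have "length S - 1 - k = Suc (length S - 1 - Suc k)" by simp
    then show ?case using Suc step[of "length S - 1 - Suc k"] by simp
  qed
  have sub: "subgroup (S ! i) G" if "i < length S" for i
    using all[of "length S - 1 - i"] that by simp
  show "subgroup (S ! i) G" using sub assms by simp
  show "S ! i \<subset> S ! Suc i \<and> closed_under_conj G (S ! i) (S ! Suc i)" if "Suc i < length S"
    using step[OF sub] that by auto
qed

lemma subnormal_series_strict:
  assumes "subnormal_series G S" "i < j" "j < length S"
  shows "S ! i \<subset> S ! j"
  using assms(2,3)
proof (induction rule: strict_inc_induct)
  case (base i)
  then show ?case using subnormal_seriesD[OF assms(1)] by auto
next
  case (step i)
  then show ?case using subnormal_seriesD(2)[OF assms(1), of i] by auto
qed

lemma subnormal_series_distinct: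
  assumes "subnormal_series G S" shows "distinct S"
  unfolding distinct_conv_nth
  using subnormal_series_strict[OF assms] by (metis nat_neq_iff psubset_eq)

text \<open>Maximality of a composition series asks for equality of lists, whereas refinement
  compares sets of members; this lemma bridges the two.\<close>

lemma subnormal_series_eqI:
  assumes "subnormal_series G S" "subnormal_series G T" "set S = set T"
  shows "S = T"
  using subnormal_series_strict[OF assms(1)] subnormal_series_strict[OF assms(2)] assms(3)
  by (intro sorted_wrt_psubset_unique) (simp_all add: sorted_wrt_iff_nth_less)

end

section \<open>Fixpoints reached within n rounds\<close>

lemma funpow_stable:
  assumes "finite U" "card U \<le> n" "X \<subseteq> U" "\<And>Y. Y \<subseteq> U \<Longrightarrow> Y \<subseteq> F Y \<and> F Y \<subseteq> U"
  shows "(F ^^ n) X \<subseteq> U" "F ((F ^^ n) X) = (F ^^ n) X"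
proof -
  have sub: "(F ^^ k) X \<subseteq> U" for k
    by (induction k) (use assms in auto)
  \<comment> \<open>Every round before stabilisation adds an element. In the first case with k = n
    the iterate has at least \<open>card U\<close> elements, hence is all of U and stable as
    well.\<close>
  have "k \<le> card ((F ^^ k) X) \<or> F ((F ^^ k) X) = (F ^^ k) X" for k
  proof (induction k)
    case (Suc k)
    show ?case
    proof (cases "F ((F ^^ k) X) = (F ^^ k) X")
      case False
      then have "(F ^^ k) X \<subset> F ((F ^^ k) X)" using assms(4) sub by blast
      then have "card ((F ^^ k) X) < card (F ((F ^^ k) X))"
        using sub[of "Suc k"] assms(1) by (intro psubset_card_mono) (auto intro: finite_subset)
      then show ?thesis using Suc False by auto
    qed auto
  qed auto
  from this[of n] show "F ((F ^^ n) X) = (F ^^ n) X"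
  proof
    assume "n \<le> card ((F ^^ n) X)"
    then have "(F ^^ n) X = U" using assms sub by (meson card_seteq order_trans)
    then show ?thesis using assms(4)[of U] by auto
  qed
  show "(F ^^ n) X \<subseteq> U" by (rule sub)
qed

definition products :: "('a, 'b) monoid_scheme \<Rightarrow> 'a set \<Rightarrow> 'a set" where
  "products G X = {z. \<exists>x\<in>X. \<exists>y\<in>X. z = x \<otimes>\<^bsub>G\<^esub> y}"

lemma productsI: "x \<in> X \<Longrightarrow> y \<in> X \<Longrightarrow> x \<otimes>\<^bsub>G\<^esub> y \<in> products G X"
  by (auto simp: products_def)

lemma products_subsetI: "(\<And>x y. x \<in> X \<Longrightarrow> y \<in> X \<Longrightarrow> x \<otimes>\<^bsub>G\<^esub> y \<in> Z) \<Longrightarrow> products G X \<subseteq> Z"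
  by (auto simp: products_def)

lemma (in group) subset_products: "Y \<subseteq> carrier G \<Longrightarrow> \<one> \<in> Y \<Longrightarrow> Y \<subseteq> products G Y"
  using productsI[of _ Y \<one> G] by force

text \<open>The limit contains the identity and is closed under products, and in a finite group this
  already makes it a subgroup.\<close>

lemma (in group) funpow_products_eq_generate:
  assumes "finite (carrier G)" "card (carrier G) \<le> n" "X \<subseteq> carrier G"
  shows "(products G ^^ n) (insert \<one> X) = generate G X"
proof
  \<comment> \<open>\<open>funpow_stable\<close> wants an operator that is increasing on all
    subsets, while \<open>products\<close> is so only in the presence of the identity. From
    \<open>insert \<one> X\<close> on, both have the same iterates.\<close>
  let ?F = "\<lambda>Y. Y \<union> products G Y"
  have eq: "(products G ^^ k) (insert \<one> X) = (?F ^^ k) (insert \<one> X) \<and> (?F ^^ k) (insert \<one> X) \<subseteq> generate G X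
     \<and> \<one> \<in> (?F ^^ k) (insert \<one> X)" for k
  proof (induction k)
    case 0
    then show ?case by (auto intro: generate.intros)
  next
    case (Suc k)
    let ?Y = "(?F ^^ k) (insert \<one> X)"
    have "?Y \<subseteq> carrier G" using Suc generate_incl[OF assms(3)] by blast
    then have "?Y \<subseteq> products G ?Y" using Suc by (intro subset_products) auto
    moreover have "products G ?Y \<subseteq> generate G X" 
      using Suc by (intro products_subsetI generate.eng) auto
    ultimately show ?case using Suc by auto
  qed
  show "(products G ^^ n) (insert \<one> X) \<subseteq> generate G X" using eq by simp
  define C where "C = (?F ^^ n) (insert \<one> X)"
  have "Y \<subseteq> ?F Y \<and> ?F Y \<subseteq> carrier G" if "Y \<subseteq> carrier G" for Y
    using that products_subsetI[of Y G "carrier G"] by auto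
  then have C: "C \<subseteq> carrier G" "?F C = C"
    using funpow_stable[of "carrier G" n "insert \<one> X" ?F] assms unfolding C_def by simp_all
  have "x \<otimes> y \<in> C" if "x \<in> C" "y \<in> C" for x y
    using C(2) productsI[OF that, of G] by blast
  moreover have "\<one> \<in> C" "finite C"
    using eq[of n] C(1) assms(1) finite_subset unfolding C_def by blast+
  ultimately have "subgroup C G" using C(1) by (intro finite_closed_imp_subgroup)
  moreover have "insert \<one> X \<subseteq> (?F ^^ k) (insert \<one> X)" for k
    by (induction k) auto
  then have "X \<subseteq> C" unfolding C_def by blast
  ultimately show "generate G X \<subseteq> (products G ^^ n) (insert \<one> X)"
    using generate_subgroup_incl eq[of n] unfolding C_def by metis
qed

section \<open>Generator sequences with least coset representatives\<close>

locale nat_group = group G for G :: "nat monoid" (structure) +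
  fixes n :: nat
  assumes carrier_eq: "carrier G = {..<n}"
begin

lemma finite_carrier: "finite (carrier G)" by (simp add: carrier_eq)

definition gen :: "nat list \<Rightarrow> nat set" where
  "gen xs = generate G (set xs)"

definition valid :: "nat list \<Rightarrow> nat \<Rightarrow> bool" where
  "valid xs x \<longleftrightarrow> x < n \<and> x \<notin> gen xs \<and> (\<forall>k\<in>gen xs. x \<le> x \<otimes> k)"

inductive path :: "nat list \<Rightarrow> bool" where
  Nil: "path []"
| snoc: "path xs \<Longrightarrow> valid xs x \<Longrightarrow> path (xs @ [x])"

lemma path_snoc_iff: "path (xs @ [x]) \<longleftrightarrow> path xs \<and> valid xs x"
  using path.cases[of "xs @ [x]"] path.snoc by auto

lemma path_append: "path (xs @ ys) \<Longrightarrow> path xs"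
  by (induction ys rule: rev_induct) (auto simp flip: append_assoc simp: path_snoc_iff)

lemma path_take: "path xs \<Longrightarrow> path (take d xs)"
  by (metis append_take_drop_id path_append)

lemma path_set: "path xs \<Longrightarrow> set xs \<subseteq> carrier G"
  by (induction rule: path.induct) (auto simp: valid_def carrier_eq)

lemma subgroup_gen: "path xs \<Longrightarrow> subgroup (gen xs) G"
  unfolding gen_def by (rule generate_is_subgroup) (rule path_set)

lemma gen_carrier: "path xs \<Longrightarrow> gen xs \<subseteq> carrier G"
  using subgroup_gen subgroup.subset by blast

lemma finite_gen: "path xs \<Longrightarrow> finite (gen xs)"
  using gen_carrier finite_carrier finite_subset by blast

lemma gen_Nil: "gen [] = {\<one>}"
  by (simp add: gen_def generate_empty)

lemma gen_snoc_strict: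
  assumes "path (xs @ [x])" shows "gen xs \<subset> gen (xs @ [x])"
proof -
  have "gen xs \<subseteq> gen (xs @ [x])" unfolding gen_def by (rule mono_generate) auto
  moreover have "x \<in> gen (xs @ [x])" unfolding gen_def by (rule generate.incl) auto
  moreover have "x \<notin> gen xs" using assms by (simp add: path_snoc_iff valid_def)
  ultimately show ?thesis by auto
qed

lemma gen_take_strict:
  assumes "path xs" "d < c" "c \<le> length xs"
  shows "gen (take d xs) \<subset> gen (take c xs)"
  using assms(2,3)
proof (induction rule: strict_inc_induct)
  case (base d)
  then have "take c xs = take d xs @ [xs ! d]" by (simp add: take_Suc_conv_app_nth)
  then show ?case using gen_snoc_strict path_take[OF assms(1)] by metis
next
  case (step d)
  then have "take (Suc d) xs = take d xs @ [xs ! d]" by (simp add: take_Suc_conv_app_nth)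
  then have "gen (take d xs) \<subset> gen (take (Suc d) xs)"
    using gen_snoc_strict path_take[OF assms(1)] by metis
  then show ?case using step by auto
qed

text \<open>Two valid elements of the same left coset are each bounded by the other, hence equal. So
  multiplication is injective on pairs of a valid element and a member of the subgroup.\<close>

lemma card_valid: assumes "path xs" shows "card {x. valid xs x} * card (gen xs) \<le> n"
proof -
  let ?V = "{x. valid xs x}"
  interpret K: subgroup "gen xs" G using subgroup_gen assms .
  have "inj_on (\<lambda>(x, k). x \<otimes> k) (?V \<times> gen xs)"
  proof (rule inj_onI, clarsimp)
    fix x k y l assume *: "valid xs x" "k \<in> gen xs" "valid xs y" "l \<in> gen xs" "x \<otimes> k = y \<otimes> l"
    then have c: "x \<in> carrier G" "y \<in> carrier G" by (auto simp: valid_def carrier_eq)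
    have "y = x \<otimes> (k \<otimes> inv l)" "x = y \<otimes> (l \<otimes> inv k)"
      using * c by (metis K.mem_carrier inv_solve_right m_assoc m_closed inv_closed)+
    moreover have "k \<otimes> inv l \<in> gen xs" "l \<otimes> inv k \<in> gen xs" using * by auto
    ultimately have "x \<le> y" "y \<le> x" using * unfolding valid_def by metis+
    then show "x = y \<and> k = l" using * c by (metis K.mem_carrier Units_eq Units_l_cancel antisym)
  qed
  moreover have "(\<lambda>(x, k). x \<otimes> k) ` (?V \<times> gen xs) \<subseteq> carrier G"
    by (auto simp: valid_def carrier_eq[symmetric] simp flip: lessThan_iff)
  ultimately have "card (?V \<times> gen xs) \<le> card (carrier G)"
    using card_inj_on_le finite_carrier by blast
  then show ?thesis by (simp add: card_cartesian_product carrier_eq)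
qed

text \<open>m is the index of one subgroup in the next. By Lagrange it divides n, which is how the
  smallest prime divisor enters the time analysis.\<close>

lemma card_gen_dvd:
  assumes "path (xs @ [x])"
  obtains m where "card (gen (xs @ [x])) = card (gen xs) * m" "1 < m" "m dvd n"
proof -
  let ?K = "gen xs" and ?L = "gen (xs @ [x])"
  have path: "path xs" using assms by (simp add: path_snoc_iff)
  have KL: "?K \<subset> ?L" using gen_snoc_strict assms .
  interpret L: group "G\<lparr>carrier := ?L\<rparr>" using subgroup_imp_group subgroup_gen assms by blast
  have fin: "finite ?L" "finite ?K" using finite_gen assms path by auto
  have "subgroup ?K (G\<lparr>carrier := ?L\<rparr>)" using KL subgroup_incl subgroup_gen assms path by blast
  then have "card (rcosets\<^bsub>G\<lparr>carrier := ?L\<rparr>\<^esub> ?K) * card ?K = card ?L"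
    using L.lagrange by (simp add: order_def)
  then obtain m where m: "card ?L = card ?K * m" by (metis mult.commute)
  moreover have "card ?K < card ?L" using KL fin psubset_card_mono by blast
  then have "1 < m" using m by (cases m; cases "m - 1") auto
  moreover have "card ?L dvd n" using lagrange[OF subgroup_gen[OF assms]]
    by (simp add: order_def carrier_eq) (metis dvd_triv_right)
  then have "m dvd n" using m by (metis dvd_mult_right)
  ultimately show ?thesis using that by blast
qed

text \<open>The subgroup orders strictly increase from 1. The bound guarantees that every position
  of the chain is below n and is thus reached by the counted loops.\<close>

lemma length_path: assumes "path xs" shows "length xs < n"
proof -
  have "d \<le> length xs \<Longrightarrow> d < card (gen (take d xs))" for d
  proof (induction d)
    case 0
    then show ?case by (simp add: gen_Nil)
  next
    case (Suc d)
    have "card (gen (take d xs)) < card (gen (take (Suc d) xs))"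
      using Suc assms by (intro psubset_card_mono finite_gen path_take gen_take_strict) auto
    then show ?case using Suc by auto
  qed
  from this[of "length xs"] have "length xs < card (gen xs)" by simp
  also have "\<dots> \<le> card (carrier G)" using assms by (intro card_mono finite_carrier gen_carrier)
  finally show ?thesis by (simp add: carrier_eq)
qed

section \<open>Positions joined to the top by normal steps\<close>

definition normal_step :: "nat list \<Rightarrow> nat \<Rightarrow> nat \<Rightarrow> bool" where
  "normal_step xs d c \<longleftrightarrow> d < c \<and> closed_under_conj G (gen (take d xs)) (gen (take c xs))"

definition mark_step :: "nat list \<Rightarrow> nat set \<Rightarrow> nat set" where
  "mark_step xs M = {d. d \<in> M \<or> (\<exists>c\<in>M. normal_step xs d c)}"

definition marks :: "nat list \<Rightarrow> nat set" where
  "marks xs = (mark_step xs ^^ n) {length xs}"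

definition series :: "nat list \<Rightarrow> nat set list" where
  "series xs = map (\<lambda>d. gen (take d xs)) (filter (\<lambda>d. d \<in> marks xs) [0..<Suc (length xs)])"

definition full :: "nat list \<Rightarrow> bool" where
  "full xs \<longleftrightarrow> path xs \<and> gen xs = carrier G"

lemma mem_mark_step: "d \<in> mark_step xs M \<longleftrightarrow> d \<in> M \<or> (\<exists>c\<in>M. normal_step xs d c)"
  by (simp add: mark_step_def)

text \<open>Closure under normal steps is stability after n rounds: a path has fewer than n
  generators, so there are at most n positions. The last fact holds at every stage of the iteration,
  because a position is added only on account of a marked one.\<close>

lemma marks_props:
  assumes "path xs"
  shows "marks xs \<subseteq> {..length xs}" "length xs \<in> marks xs"
    and "c \<in> marks xs \<Longrightarrow> normal_step xs d c \<Longrightarrow> d \<in> marks xs"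
    and "d \<in> marks xs \<Longrightarrow> d \<noteq> length xs \<Longrightarrow> \<exists>c\<in>marks xs. normal_step xs d c"
proof -
  have *: "Y \<subseteq> mark_step xs Y \<and> mark_step xs Y \<subseteq> {..length xs}" if "Y \<subseteq> {..length xs}" for Y
    using that by (fastforce simp: mark_step_def normal_step_def)
  show "marks xs \<subseteq> {..length xs}"
    using funpow_stable(1)[of "{..length xs}" n "{length xs}"] * length_path[OF assms]
    unfolding marks_def by auto
  have st: "mark_step xs (marks xs) = marks xs"
    using funpow_stable(2)[of "{..length xs}" n "{length xs}"] * length_path[OF assms]
    unfolding marks_def by auto
  show "d \<in> marks xs" if "c \<in> marks xs" "normal_step xs d c"
    using that st unfolding mark_step_def by blast
  have mono: "(mark_step xs ^^ k) {length xs} \<subseteq> (mark_step xs ^^ Suc k) {length xs}" for k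
    by (auto simp: mem_mark_step)
  have "length xs \<in> (mark_step xs ^^ k) {length xs}" for k
    by (induction k) (auto simp: mem_mark_step)
  then show "length xs \<in> marks xs" unfolding marks_def .
  have "d \<in> (mark_step xs ^^ k) {length xs} \<Longrightarrow> d \<noteq> length xs \<Longrightarrow>
      \<exists>c\<in>(mark_step xs ^^ k) {length xs}. normal_step xs d c" for k
  proof (induction k)
    case (Suc k)
    show ?case
    proof (cases "d \<in> (mark_step xs ^^ k) {length xs}")
      case True
      then show ?thesis using Suc mono by blast
    next
      case False
      then have "\<exists>c\<in>(mark_step xs ^^ k) {length xs}. normal_step xs d c"
        using Suc.prems(1) mem_mark_step by auto
      then show ?thesis using mono by blast
    qed
  qed simp
  then show "d \<in> marks xs \<Longrightarrow> d \<noteq> length xs \<Longrightarrow> \<exists>c\<in>marks xs. normal_step xs d c"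
    unfolding marks_def by blast
qed

end

section \<open>From marked chains to composition series\<close>

context nat_group begin

lemma set_filter_marks: "path xs \<Longrightarrow> set (filter (\<lambda>d. d \<in> marks xs) [0..<Suc (length xs)]) = marks xs"
  using marks_props(1)[of xs] by (auto simp del: upt_Suc simp: less_Suc_eq_le)

lemma set_series: "path xs \<Longrightarrow> set (series xs) = (\<lambda>d. gen (take d xs)) ` marks xs"
  unfolding series_def set_map by (simp only: set_filter_marks)

text \<open>The trivial group is normal in the top group, so a single step suffices. This makes
  every extracted series start at the identity.\<close>

lemma zero_in_marks:
  assumes "path xs" shows "0 \<in> marks xs"
proof (cases "xs = []")
  case True
  then show ?thesis using marks_props(2)[OF assms] by simp
next
  case False
  then have "normal_step xs 0 (length xs)"
    using gen_carrier[OF assms] by (simp add: normal_step_def gen_Nil trivial_closed_under_conj)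
  then show ?thesis using marks_props(2,3)[OF assms] by blast
qed

text \<open>A mark d only promises a normal step to some mark c, not to the next mark e. But e <= c,
  and normality in \<open>gen (take c xs)\<close> restricts to the smaller group
  \<open>gen (take e xs)\<close>.\<close>

lemma series_subnormal:
  assumes "full xs" shows "subnormal_series G (series xs)"
proof -
  have path: "path xs" and gen: "gen xs = carrier G" using assms by (auto simp: full_def)
  define ds where "ds = filter (\<lambda>d. d \<in> marks xs) [0..<Suc (length xs)]"
  have S: "series xs = map (\<lambda>d. gen (take d xs)) ds" by (simp add: series_def ds_def)
  have hd: "ds \<noteq> []" "hd ds = 0"
    using zero_in_marks[OF path] unfolding ds_def by (simp_all add: upt_conv_Cons del: upt_Suc)
  have last: "last ds = length xs" using marks_props(2)[OF path] unfolding ds_def by simp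
  have sorted: "sorted_wrt (<) ds" unfolding ds_def
    by (intro sorted_wrt_filter sorted_wrt_upt)
  have set: "set ds = marks xs" unfolding ds_def by (rule set_filter_marks[OF path])
  show ?thesis
    unfolding subnormal_series_def
  proof (intro conjI allI impI)
    show "series xs \<noteq> []" "hd (series xs) = {\<one>}"
      using hd by (simp_all add: S hd_map gen_Nil)
    show "last (series xs) = carrier G" using hd last gen by (simp add: S last_map)
    fix i assume "Suc i < length (series xs)"
    then have i: "Suc i < length ds" by (simp add: S)
    define d e where "d = ds ! i" and "e = ds ! Suc i"
    have de: "d < e" using sorted i by (simp add: d_def e_def sorted_wrt_iff_nth_less)
    have mem: "d \<in> marks xs" "e \<in> marks xs" using i nth_mem[of _ ds] by (simp_all add: d_def e_def flip: set)
    then have "e \<le> length xs" using marks_props(1)[OF path] by auto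
    then have strict: "gen (take d xs) \<subset> gen (take e xs)" using gen_take_strict path de by blast
    obtain c where c: "c \<in> marks xs" "normal_step xs d c"
      using marks_props(4)[OF path mem(1)] de \<open>e \<le> length xs\<close> by auto
    then obtain j where j: "j < length ds" "ds ! j = c" by (metis set in_set_conv_nth)
    have "d < c" using c by (simp add: normal_step_def)
    have "\<not> j \<le> i"
    proof
      assume "j \<le> i"
      then have "c \<le> d" using sorted i j unfolding d_def
        by (metis Suc_lessD le_neq_implies_less less_imp_le order_refl sorted_wrt_iff_nth_less)
      then show False using \<open>d < c\<close> by simp
    qed
    then have "e \<le> c" using sorted j unfolding e_def
      by (metis Suc_leI le_neq_implies_less less_imp_le not_le_imp_less order_refl sorted_wrt_iff_nth_less)
    moreover have "c \<le> length xs" using c marks_props(1)[OF path] by auto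
    ultimately have "gen (take e xs) \<subseteq> gen (take c xs)"
      using gen_take_strict[OF path, of e c] by (cases "e = c") auto
    then have "closed_under_conj G (gen (take d xs)) (gen (take e xs))"
      using c closed_under_conj_mono by (auto simp: normal_step_def)
    then have "gen (take d xs) \<lhd> G\<lparr>carrier := gen (take e xs)\<rparr>"
      using strict path subgroup_gen path_take by (subst normal_in_subgroup_iff) auto
    then show "series xs ! i \<noteq> series xs ! Suc i" "series xs ! i \<lhd> G\<lparr>carrier := series xs ! Suc i\<rparr>"
      using strict i by (auto simp: S d_def e_def)
  qed
qed

text \<open>As long as the subgroup H is not reached, a valid generator inside H exists; the gap
  between the two orders shrinks each time.\<close>

lemma path_extend:
  assumes "path xs" "gen xs \<subseteq> H" "subgroup H G"
  shows "\<exists>ys. path (xs @ ys) \<and> gen (xs @ ys) = H"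
  using assms(1,2)
proof (induction "card H - card (gen xs)" arbitrary: xs rule: less_induct)
  case less
  have finH: "finite H" using assms(3) finite_carrier finite_subset subgroup.subset by blast
  show ?case
  proof (cases "gen xs = H")
    case True
    then show ?thesis using less by (intro exI[of _ "[]"]) auto
  next
    case False
    interpret K: subgroup "gen xs" G using subgroup_gen less by blast
    interpret H: subgroup H G by fact
    obtain y where y: "y \<in> H" "y \<notin> gen xs" using False less by blast
    \<comment> \<open>Any element outside the subgroup can be replaced by the least element of its
      left coset, which stays in H and is valid.\<close>
    define x where "x = Min ((\<lambda>k. y \<otimes> k) ` gen xs)"
    have fin: "finite ((\<lambda>k. y \<otimes> k) ` gen xs)" using finite_gen less by blast
    have "(\<lambda>k. y \<otimes> k) ` gen xs \<noteq> {}" using K.one_closed by blast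
    from Min_in[OF fin this] obtain k where k: "k \<in> gen xs" "x = y \<otimes> k" unfolding x_def by blast
    have c: "y \<in> carrier G" "k \<in> carrier G" using y k by auto
    have xH: "x \<in> H" using k y less by auto
    have "x \<notin> gen xs"
    proof
      assume "x \<in> gen xs"
      then have "x \<otimes> inv k \<in> gen xs" using k by auto
      then show False using y c k by (simp add: m_assoc)
    qed
    moreover have "x \<le> x \<otimes> l" if "l \<in> gen xs" for l
    proof -
      have "x \<otimes> l = y \<otimes> (k \<otimes> l)" using k c that by (simp add: m_assoc)
      moreover have "k \<otimes> l \<in> gen xs" using k that by auto
      ultimately show ?thesis unfolding x_def using fin by (metis Min_le imageI)
    qed
    moreover have "x < n" using xH H.mem_carrier carrier_eq by auto
    ultimately have path: "path (xs @ [x])" using less by (simp add: path_snoc_iff valid_def)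
    have "set xs \<subseteq> gen xs" unfolding gen_def using generate.incl by fast
    then have "set (xs @ [x]) \<subseteq> H" using less.prems(2) xH by auto
    then have "gen (xs @ [x]) \<subseteq> H" unfolding gen_def
      using assms(3) by (rule generate_subgroup_incl)
    moreover have "gen xs \<subset> gen (xs @ [x])" using path gen_snoc_strict by blast
    moreover from this have "card (gen xs) < card (gen (xs @ [x]))"
      using finite_gen path psubset_card_mono by blast
    moreover have "card (gen (xs @ [x])) \<le> card H"
      using calculation finH card_mono by blast
    ultimately obtain ys where "path ((xs @ [x]) @ ys)" "gen ((xs @ [x]) @ ys) = H"
      using less.hyps[OF _ path] by (metis diff_less_mono2 order_less_le_trans)
    then show ?thesis by (metis append_assoc)
  qed
qed

text \<open>The path is extended to reach one member of T after the other. Extensions keep the old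
  path as a prefix, so the members met earlier stay in the chain.\<close>

lemma subnormal_refined_by_path:
  assumes "subnormal_series G T"
  shows "\<exists>xs. full xs \<and> (\<forall>i < length T. \<exists>d \<le> length xs. gen (take d xs) = T ! i)"
proof -
  have ne: "T \<noteq> []" using assms by (simp add: subnormal_series_def)
  have "i < length T \<Longrightarrow> \<exists>xs. path xs \<and> gen xs = T ! i \<and> (\<forall>j\<le>i. \<exists>d \<le> length xs. gen (take d xs) = T ! j)" for i
  proof (induction i)
    case 0
    have "T ! 0 = {\<one>}" using assms ne by (simp add: subnormal_series_def hd_conv_nth)
    then show ?case by (intro exI[of _ "[]"]) (auto simp: gen_Nil path.Nil)
  next
    case (Suc i)
    then obtain xs where xs: "path xs" "gen xs = T ! i" "\<And>j. j \<le> i \<Longrightarrow> \<exists>d \<le> length xs. gen (take d xs) = T ! j"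
      by auto
    have "subgroup (T ! Suc i) G" "T ! i \<subseteq> T ! Suc i"
      using subnormal_seriesD[OF assms] Suc.prems by (auto dest: Suc_lessD)
    then obtain ys where ys: "path (xs @ ys)" "gen (xs @ ys) = T ! Suc i"
      using path_extend xs by metis
    have "\<exists>d \<le> length (xs @ ys). gen (take d (xs @ ys)) = T ! j" if le: "j \<le> Suc i" for j
    proof (cases "j = Suc i")
      case True
      then show ?thesis using ys by (intro exI[of _ "length (xs @ ys)"]) auto
    next
      case False
      then obtain d where d: "d \<le> length xs" "gen (take d xs) = T ! j"
        using xs(3)[of j] le by (metis le_SucE)
      then have "take d (xs @ ys) = take d xs" by simp
      then have "d \<le> length (xs @ ys) \<and> gen (take d (xs @ ys)) = T ! j" using d by (simp only: length_append trans_le_add1)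
      then show ?thesis ..
    qed
    then show ?case using ys by blast
  qed
  from this[of "length T - 1"] ne obtain xs where xs: "path xs" "gen xs = T ! (length T - 1)"
    "\<And>j. j \<le> length T - 1 \<Longrightarrow> \<exists>d \<le> length xs. gen (take d xs) = T ! j" by auto
  have "T ! (length T - 1) = carrier G"
    using assms ne by (simp add: subnormal_series_def last_conv_nth)
  then show ?thesis using xs by (intro exI[of _ xs]) (simp add: full_def)
qed

text \<open>All members of T occur in the chain of a suitable path. Descending from the top, each is
  normal in the next member of T, which is already marked, and so becomes marked itself.\<close>

lemma subnormal_refined_by_series:
  assumes "subnormal_series G T"
  shows "\<exists>xs. full xs \<and> set T \<subseteq> set (series xs)"
proof -
  obtain xs where full: "full xs" and d: "\<And>i. i < length T \<Longrightarrow> \<exists>d \<le> length xs. gen (take d xs) = T ! i"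
    using subnormal_refined_by_path[OF assms] by blast
  have path: "path xs" using full by (simp add: full_def)
  have ne: "T \<noteq> []" using assms by (simp add: subnormal_series_def)
  \<comment> \<open>A normal step also demands increasing positions; in a strict chain these follow
    from the inclusion of the subgroups.\<close>
  have less: "d < c" if "gen (take d xs) \<subset> gen (take c xs)" "d \<le> length xs" for d c
    using gen_take_strict[OF path, of c d] that by (cases c d rule: linorder_cases) auto
  have "k < length T \<Longrightarrow> \<exists>d \<in> marks xs. gen (take d xs) = T ! (length T - 1 - k)" for k
  proof (induction k)
    case 0
    have "T ! (length T - 1) = gen xs"
      using assms ne full by (simp add: subnormal_series_def last_conv_nth full_def)
    then show ?case using marks_props(2)[OF path] by (intro bexI[of _ "length xs"]) auto
  next
    case (Suc k)
    define i where "i = length T - 1 - Suc k"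
    have i: "Suc i < length T" "length T - 1 - k = Suc i" using Suc.prems by (auto simp: i_def)
    obtain c where c: "c \<in> marks xs" "gen (take c xs) = T ! Suc i" using Suc i by auto
    obtain d where d: "d \<le> length xs" "gen (take d xs) = T ! i" using d[of i] i by auto
    have "T ! i \<subset> T ! Suc i \<and> closed_under_conj G (T ! i) (T ! Suc i)"
      using subnormal_seriesD(2)[OF assms] i by simp
    then have "normal_step xs d c" using less[of d c] c d by (simp add: normal_step_def)
    then show ?case using c d marks_props(3)[OF path] i_def by blast
  qed
  then have mk: "\<exists>d \<in> marks xs. gen (take d xs) = T ! i" if "i < length T" for i
    using that by (metis Suc_pred' diff_diff_cancel diff_less_Suc length_greater_0_conv less_Suc_eq_le ne diff_le_self le_imp_less_Suc)
  have "set T \<subseteq> set (series xs)"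
    unfolding set_series[OF path]
  proof (intro subsetI)
    fix N assume "N \<in> set T"
    then obtain i where "i < length T" "N = T ! i" by (auto simp: in_set_conv_nth)
    then obtain d where "d \<in> marks xs" "N = gen (take d xs)" using mk[of i] by blast
    then show "N \<in> (\<lambda>d. gen (take d xs)) ` marks xs" by (intro image_eqI)
  qed
  then show ?thesis using full by blast
qed

lemma length_le_series:
  assumes "subnormal_series G T"
  obtains xs where "full xs" "set T \<subseteq> set (series xs)" "length T \<le> length (series xs)"
proof -
  obtain xs where xs: "full xs" "set T \<subseteq> set (series xs)" using subnormal_refined_by_series assms by blast
  have "card (set T) \<le> card (set (series xs))" using xs by (intro card_mono) auto
  then have "length T \<le> length (series xs)"
    using subnormal_series_distinct[OF assms] subnormal_series_distinct[OF series_subnormal[OF xs(1)]]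
    by (simp add: distinct_card)
  with xs show ?thesis using that by blast
qed

lemma subnormal_subset_eq:
  assumes "subnormal_series G S" "subnormal_series G T" "set S \<subseteq> set T" "length T \<le> length S"
  shows "T = S"
proof -
  have "card (set T) \<le> card (set S)"
    using assms subnormal_series_distinct by (metis distinct_card)
  then have "set S = set T" using assms(3) by (simp add: card_seteq)
  then show ?thesis using subnormal_series_eqI assms by metis
qed

definition longest :: "nat list \<Rightarrow> bool" where
  "longest xs \<longleftrightarrow> full xs \<and> (\<forall>ys. full ys \<longrightarrow> length (series ys) \<le> length (series xs))"

text \<open>A refinement T is itself contained in an enumerated series, so it is not longer than the
  longest one. A refinement of the same length adds no member.\<close>

lemma longest_composition_series:
  assumes "longest xs" shows "composition_series G (series xs)"
  unfolding composition_series_def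
proof (intro conjI allI impI)
  show S: "subnormal_series G (series xs)" using series_subnormal assms by (simp add: longest_def)
  fix T assume T: "subnormal_series G T \<and> set (series xs) \<subseteq> set T"
  obtain ys where "full ys" "length T \<le> length (series ys)" using length_le_series T by blast
  then have "length T \<le> length (series xs)" using assms unfolding longest_def by (meson order_trans)
  then show "T = series xs" using subnormal_subset_eq S T by blast
qed

lemma ex_full: "\<exists>xs. full xs"
proof -
  have "subgroup (carrier G) G" by (rule subgroup_self)
  then show ?thesis using path_extend[of "[]" "carrier G"] by (auto simp: full_def gen_Nil path.Nil)
qed

end

section \<open>Transport along group isomorphisms\<close>

lemma subnormal_series_iso:
  assumes "group G" "group H" "\<phi> \<in> iso G H" "subnormal_series G S"
  shows "subnormal_series H (map ((`) \<phi>) S)"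
proof -
  interpret G: group G by fact
  interpret H: group H by fact
  interpret group_hom G H \<phi> using assms by (intro group_hom.intro group_hom_axioms.intro) (auto simp: iso_def)
  have ne: "S \<noteq> []" using assms by (simp add: subnormal_series_def)
  have bij: "\<phi> ` carrier G = carrier H" "inj_on \<phi> (carrier G)"
    using assms(3) by (auto simp: iso_def bij_betw_def)
  show ?thesis
    unfolding subnormal_series_def
  proof (intro conjI allI impI)
    show "map ((`) \<phi>) S \<noteq> []" using ne by simp
    show "hd (map ((`) \<phi>) S) = {\<one>\<^bsub>H\<^esub>}"
      using assms(4) ne by (simp add: hd_map subnormal_series_def)
    show "last (map ((`) \<phi>) S) = carrier H"
      using assms(4) ne bij by (simp add: last_map subnormal_series_def)
    fix i assume "Suc i < length (map ((`) \<phi>) S)"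
    then have i: "Suc i < length S" "i < length S" by auto
    note D = G.subnormal_seriesD[OF assms(4)]
    have sub: "subgroup (S ! i) G" "subgroup (S ! Suc i) G" using D(1) i by auto
    have psub: "S ! i \<subset> S ! Suc i" and conj: "closed_under_conj G (S ! i) (S ! Suc i)" using D(2) i by auto
    have carr: "S ! i \<subseteq> carrier G" "S ! Suc i \<subseteq> carrier G" using sub subgroup.subset by auto
    have "\<phi> ` (S ! i) \<noteq> \<phi> ` (S ! Suc i)"
      using psub carr bij(2) by (simp add: inj_on_image_eq_iff)
    moreover have "closed_under_conj H (\<phi> ` (S ! i)) (\<phi> ` (S ! Suc i))"
      unfolding closed_under_conj_def
    proof (clarify)
      fix a b assume ab: "a \<in> S ! Suc i" "b \<in> S ! i"
      then obtain z where z: "z \<in> S ! i" "z \<otimes>\<^bsub>G\<^esub> a = a \<otimes>\<^bsub>G\<^esub> b" using conj by (auto simp: closed_under_conj_def)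
      have "a \<in> carrier G" "b \<in> carrier G" "z \<in> carrier G" using ab z carr by blast+
      then have "\<phi> (z \<otimes>\<^bsub>G\<^esub> a) = \<phi> z \<otimes>\<^bsub>H\<^esub> \<phi> a" "\<phi> (a \<otimes>\<^bsub>G\<^esub> b) = \<phi> a \<otimes>\<^bsub>H\<^esub> \<phi> b"
        by simp_all
      then show "\<exists>z\<in>\<phi> ` (S ! i). z \<otimes>\<^bsub>H\<^esub> \<phi> a = \<phi> a \<otimes>\<^bsub>H\<^esub> \<phi> b"
        using z by (intro bexI[of _ "\<phi> z"]) simp_all
    qed
    ultimately have "\<phi> ` (S ! i) \<lhd> H\<lparr>carrier := \<phi> ` (S ! Suc i)\<rparr>"
      using sub psub H.normal_in_subgroup_iff[of "\<phi> ` (S ! i)" "\<phi> ` (S ! Suc i)"]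
      by (simp add: subgroup_img_is_subgroup image_mono)
    with \<open>\<phi> ` (S ! i) \<noteq> \<phi> ` (S ! Suc i)\<close>
    show "map ((`) \<phi>) S ! i \<noteq> map ((`) \<phi>) S ! Suc i"
      "map ((`) \<phi>) S ! i \<lhd> H\<lparr>carrier := map ((`) \<phi>) S ! Suc i\<rparr>"
      using i by simp_all
  qed
qed

text \<open>The image of the series is subnormal in H, hence contained in some enumerated series of
  H. Pulling series of H back by the inverse shows that none is longer than the image, so the
  containing series coincides with it.\<close>

lemma longest_series_iso:
  assumes "nat_group G m" "nat_group H n" "\<phi> \<in> iso G H" "nat_group.longest G m xs"
  shows "\<exists>ys. nat_group.longest H n ys \<and> nat_group.series H n ys = map ((`) \<phi>) (nat_group.series G m xs)"
proof -
  interpret G: nat_group G m by fact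
  interpret H: nat_group H n by fact
  let ?T = "map ((`) \<phi>) (G.series xs)"
  have xs: "G.full xs" "\<And>ys. G.full ys \<Longrightarrow> length (G.series ys) \<le> length (G.series xs)"
    using assms(4) by (auto simp: G.longest_def)
  have T: "subnormal_series H ?T"
    using subnormal_series_iso[OF G.group_axioms H.group_axioms assms(3)] G.series_subnormal xs by blast
  obtain ys where ys: "H.full ys" "set ?T \<subseteq> set (H.series ys)" using H.length_le_series T by blast
  have le: "length (H.series zs) \<le> length ?T" if "H.full zs" for zs
  proof -
    let ?\<psi> = "inv_into (carrier G) \<phi>"
    have "?\<psi> \<in> iso H G" using G.iso_set_sym assms(3) by blast
    then have "subnormal_series G (map ((`) ?\<psi>) (H.series zs))"
      using subnormal_series_iso[OF H.group_axioms G.group_axioms] H.series_subnormal that by blast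
    then obtain ws where "G.full ws" "length (map ((`) ?\<psi>) (H.series zs)) \<le> length (G.series ws)"
      using G.length_le_series by blast
    then show ?thesis using xs(2)[of ws] by simp
  qed
  have "H.series ys = ?T"
    using H.subnormal_subset_eq[OF T H.series_subnormal[OF ys(1)] ys(2) le[OF ys(1)]] .
  moreover from this have "H.longest ys" using ys(1) le by (simp add: H.longest_def)
  ultimately show ?thesis by blast
qed

section \<open>Computing the series of a generator sequence\<close>

abbreviation "nonzero e \<equiv> Neg (Equal e (Const 0))"
abbreviation "var x \<equiv> Cell x []"

text \<open>Row d of \<open>''K''\<close> is to hold the subgroup generated by the first d stack
  entries, and all rows are computed at once. The identity, which the table does not name, is
  recognised as a left unit.\<close>

definition init_fm :: "vname \<Rightarrow> fm" where
  "init_fm tab = FOr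
     (FAll ''a'' (FAtom (Equal (Cell tab [ivar, var ''a'']) (var ''a''))))
     (FEx ''b'' (FAtom (Conj (Less (var ''b'') dvar) (Equal (Cell ''X'' [var ''b'']) ivar))))"

definition close_fm :: "vname \<Rightarrow> fm" where
  "close_fm tab = FEx ''a'' (FEx ''b'' (FAtom
     (Conj (nonzero (Cell ''K'' [dvar, var ''a'']))
     (Conj (nonzero (Cell ''K'' [dvar, var ''b'']))
       (Equal (Cell tab [var ''a'', var ''b'']) ivar)))))"

text \<open>\<open>compr\<close> fills two-dimensional arrays, whereas marks form a set of single
  positions; they are read off the diagonal of \<open>''M''\<close>.\<close>

definition top_fm :: fm where
  "top_fm = FAtom (Equal dvar (var ''top''))"

definition normal_fm :: "vname \<Rightarrow> fm" where
  "normal_fm tab = FAll ''a'' (FAll ''b'' (FOr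
     (FAtom (Neg (Conj (nonzero (Cell ''K'' [var ''c'', var ''a''])) (nonzero (Cell ''K'' [dvar, var ''b''])))))
     (FEx ''z'' (FAtom (Conj (nonzero (Cell ''K'' [dvar, var ''z'']))
       (Equal (Cell tab [var ''z'', var ''a'']) (Cell tab [var ''a'', var ''b''])))))))"

definition mark_fm :: "vname \<Rightarrow> fm" where
  "mark_fm tab = FOr (FAtom (nonzero (Cell ''M'' [dvar, dvar])))
     (FEx ''c'' (FAnd (FAtom (Conj (nonzero (Cell ''M'' [var ''c'', var ''c''])) (Less dvar (var ''c'')))) (normal_fm tab)))"

text \<open>A query reads the rows 0, ..., l - 1 of its array, so the marked rows have to be moved
  together.\<close>

definition list_marked :: prog where
  "list_marked = PSeq (PAssign ''l'' [] (Const 0)) (PFor ''d'' (PIf (nonzero (Cell ''M'' [dvar, dvar]))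
     (PSeq (PFor ''i'' (PAssign ''S'' [var ''l'', ivar] (Cell ''K'' [dvar, ivar])))
       (PAssign ''l'' [] (Succ (var ''l''))))
     PSkip))"

definition chain :: "vname \<Rightarrow> prog" where
  "chain tab =
     PSeq (compr ''K'' (init_fm tab))
    (PSeq (PFor ''q'' (compr ''K'' (close_fm tab)))
    (PSeq (compr ''M'' top_fm)
    (PSeq (PFor ''q'' (compr ''M'' (mark_fm tab)))
      list_marked)))"

lemmas fm_defs = init_fm_def close_fm_def top_fm_def normal_fm_def mark_fm_def

lemma compr_ok_fms:
  assumes "tab \<in> {''G'', ''H''}"
  shows "compr_ok (init_fm tab)" "compr_ok (close_fm tab)" "compr_ok top_fm" "compr_ok (mark_fm tab)"
  using assms by (auto simp: fm_defs compr_ok_def junk_def)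

text \<open>The stack occupies the cells of \<open>''X''\<close> below \<open>top\<close>. The cell
  at \<open>top\<close> is left open: it holds the next candidate generator.\<close>

definition represents :: "nat \<Rightarrow> vname \<Rightarrow> (nat \<Rightarrow> nat \<Rightarrow> nat) \<Rightarrow> nat list \<Rightarrow> state \<Rightarrow> bool" where
  "represents n tab m xs s \<longleftrightarrow> s ''n'' [] = n \<and> (\<forall>i<n. \<forall>j<n. s tab [i, j] = m i j) \<and>
     s ''top'' [] = length xs \<and> (\<forall>j<length xs. s ''X'' [j] = xs ! j)"

lemma fval_normal_fm:
  assumes "tab \<in> {''G'', ''H''}"
  shows "fval (normal_fm tab) s \<longleftrightarrow> (\<forall>a<s ''n'' []. \<forall>b<s ''n'' [].
    s ''K'' [s ''c'' [], a] \<noteq> 0 \<and> s ''K'' [s ''d'' [], b] \<noteq> 0 \<longrightarrow>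
    (\<exists>z<s ''n'' []. s ''K'' [s ''d'' [], z] \<noteq> 0 \<and> s tab [z, a] = s tab [a, b]))"
proof -
  have "tab \<notin> {''a'', ''b'', ''z''}" using assms by auto
  then show ?thesis
    unfolding normal_fm_def
    by (simp add: store_apply imp_conjL disj_imp del: neq0_conv)
qed

lemma fval_mark_fm:
  assumes "tab \<in> {''G'', ''H''}"
  shows "fval (mark_fm tab) s \<longleftrightarrow> s ''M'' [s ''d'' [], s ''d'' []] \<noteq> 0 \<or>
    (\<exists>c<s ''n'' []. s ''M'' [c, c] \<noteq> 0 \<and> s ''d'' [] < c \<and>
      (\<forall>a<s ''n'' []. \<forall>b<s ''n'' []. s ''K'' [c, a] \<noteq> 0 \<and> s ''K'' [s ''d'' [], b] \<noteq> 0 \<longrightarrow>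
        (\<exists>z<s ''n'' []. s ''K'' [s ''d'' [], z] \<noteq> 0 \<and> s tab [z, a] = s tab [a, b])))"
proof -
  have t: "tab \<noteq> ''c''" using assms by auto
  have s: "store s ''c'' [] c ''c'' [] = c" "store s ''c'' [] c tab = s tab" "store s ''c'' [] c ''n'' = s ''n''"
    "store s ''c'' [] c ''d'' = s ''d''" "store s ''c'' [] c ''K'' = s ''K''" "store s ''c'' [] c ''M'' = s ''M''" for c
    using t by (simp_all add: store_def)
  have "fval (mark_fm tab) s \<longleftrightarrow> s ''M'' [s ''d'' [], s ''d'' []] \<noteq> 0 \<or>
    (\<exists>c<s ''n'' []. (s ''M'' [c, c] \<noteq> 0 \<and> s ''d'' [] < c) \<and> fval (normal_fm tab) (store s ''c'' [] c))"
    unfolding mark_fm_def by (simp add: s del: neq0_conv) blast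
  then show ?thesis unfolding fval_normal_fm[OF assms] s conj_assoc .
qed

context nat_group begin

abbreviation rep :: "vname \<Rightarrow> nat list \<Rightarrow> state \<Rightarrow> bool" where
  "rep tab xs s \<equiv> represents n tab (\<otimes>) xs s"

lemma rep_cong:
  assumes "rep tab xs s" "s' ''n'' = s ''n''" "s' tab = s tab" "s' ''top'' = s ''top''" "s' ''X'' = s ''X''"
  shows "rep tab xs s'"
  using assms by (simp add: represents_def)

text \<open>Rows beyond the length of the stack are computed from stale cells of
  \<open>''X''\<close>, so nothing is claimed about them.\<close>

definition gens_stored :: "(nat \<Rightarrow> nat set) \<Rightarrow> nat list \<Rightarrow> state \<Rightarrow> bool" where
  "gens_stored K xs s \<longleftrightarrow> (\<forall>d\<le>length xs. \<forall>i<n. s ''K'' [d, i] \<noteq> 0 \<longleftrightarrow> i \<in> K d)"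

definition marks_stored :: "nat set \<Rightarrow> state \<Rightarrow> bool" where
  "marks_stored M s \<longleftrightarrow> (\<forall>d<n. s ''M'' [d, d] \<noteq> 0 \<longleftrightarrow> d \<in> M)"

lemma identity_iff: "i < n \<Longrightarrow> (\<forall>a<n. i \<otimes> a = a) \<longleftrightarrow> i = \<one>"
  using carrier_eq by (metis l_one lessThan_iff one_closed r_one)

lemma sem_init:
  assumes rep: "rep tab xs s" and path: "path xs" and tab: "tab \<in> {''G'', ''H''}"
  shows "gens_stored (\<lambda>d. insert \<one> (set (take d xs))) xs (sem orc (compr ''K'' (init_fm tab)) s)"
  unfolding gens_stored_def
proof (intro allI impI)
  fix d i assume d: "d \<le> length xs" and i: "i < n"
  have len: "length xs < n" using length_path path .
  have n: "s ''n'' [] = n" and t: "\<And>a b. a < n \<Longrightarrow> b < n \<Longrightarrow> s tab [a, b] = a \<otimes> b"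
    and X: "\<And>j. j < length xs \<Longrightarrow> s ''X'' [j] = xs ! j"
    using rep by (auto simp: represents_def)
  have "sem orc (compr ''K'' (init_fm tab)) s ''K'' [d, i] \<noteq> 0 \<longleftrightarrow>
      fval (init_fm tab) (store (store s ''d'' [] d) ''i'' [] i)"
    using sem_compr[OF compr_ok_fms(1)[OF tab], of "''K''" d s i orc] d i n len by simp
  also have "\<dots> \<longleftrightarrow> (\<forall>a<n. s tab [i, a] = a) \<or> (\<exists>j<n. j < d \<and> s ''X'' [j] = i)"
    using tab n by (auto simp: init_fm_def store_apply)
  also have "\<dots> \<longleftrightarrow> i = \<one> \<or> i \<in> set (take d xs)"
  proof -
    have "(\<forall>a<n. s tab [i, a] = a) \<longleftrightarrow> i = \<one>" using identity_iff[OF i] t[OF i] by simp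
    moreover have "(\<exists>j<n. j < d \<and> s ''X'' [j] = i) \<longleftrightarrow> i \<in> set (take d xs)"
    proof -
      have e: "set (take d xs) = (\<lambda>j. s ''X'' [j]) ` {0..<d}"
        unfolding nth_image[OF d, symmetric] using X d by (intro image_cong) auto
      have lt: "j < n" if "j < d" for j using that d len by simp
      show ?thesis
      proof
        assume "\<exists>j<n. j < d \<and> s ''X'' [j] = i"
        then obtain j where "j < d" "s ''X'' [j] = i" by auto
        then show "i \<in> set (take d xs)" unfolding e by (intro image_eqI[of _ _ j]) simp_all
      next
        assume "i \<in> set (take d xs)"
        then obtain j where "j < d" "i = s ''X'' [j]" unfolding e by auto
        then show "\<exists>j<n. j < d \<and> s ''X'' [j] = i" using lt by (intro exI[of _ j]) simp
      qed
    qed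
    ultimately show ?thesis by simp
  qed
  finally show "(sem orc (compr ''K'' (init_fm tab)) s ''K'' [d, i] \<noteq> 0) = (i \<in> insert \<one> (set (take d xs)))"
    by simp
qed

lemma sem_close_step:
  assumes rep: "rep tab xs s" and path: "path xs" and tab: "tab \<in> {''G'', ''H''}"
    and K: "gens_stored K xs s" "\<And>d. K d \<subseteq> carrier G"
  shows "gens_stored (\<lambda>d. products G (K d)) xs (sem orc (compr ''K'' (close_fm tab)) s)"
  unfolding gens_stored_def
proof (intro allI impI)
  fix d i assume d: "d \<le> length xs" and i: "i < n"
  have len: "length xs < n" using length_path path .
  have n: "s ''n'' [] = n" and t: "\<And>a b. a < n \<Longrightarrow> b < n \<Longrightarrow> s tab [a, b] = a \<otimes> b"
    using rep by (auto simp: represents_def)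
  have "sem orc (compr ''K'' (close_fm tab)) s ''K'' [d, i] \<noteq> 0 \<longleftrightarrow>
      fval (close_fm tab) (store (store s ''d'' [] d) ''i'' [] i)"
    using sem_compr[OF compr_ok_fms(2)[OF tab], of "''K''" d s i orc] d i n len by simp
  also have "\<dots> \<longleftrightarrow> (\<exists>a<n. \<exists>b<n. s ''K'' [d, a] \<noteq> 0 \<and> s ''K'' [d, b] \<noteq> 0 \<and> s tab [a, b] = i)"
    using tab n by (auto simp: close_fm_def store_apply)
  also have "\<dots> \<longleftrightarrow> (\<exists>a<n. \<exists>b<n. a \<in> K d \<and> b \<in> K d \<and> a \<otimes> b = i)"
  proof -
    have "s ''K'' [d, a] \<noteq> 0 \<longleftrightarrow> a \<in> K d" if "a < n" for a
      using K(1) d that unfolding gens_stored_def by blast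
    then show ?thesis using t by (simp cong: conj_cong del: neq0_conv)
  qed
  also have "\<dots> \<longleftrightarrow> i \<in> products G (K d)"
    using K(2)[of d] carrier_eq by (auto simp: products_def)
  finally show "(sem orc (compr ''K'' (close_fm tab)) s ''K'' [d, i] \<noteq> 0) = (i \<in> products G (K d))" .
qed

lemma funpow_products_carrier: "X \<subseteq> carrier G \<Longrightarrow> (products G ^^ k) X \<subseteq> carrier G"
proof (induction k)
  case (Suc k)
  then show ?case using products_subsetI[of "(products G ^^ k) X" G "carrier G"] by auto
qed simp

lemma sem_close:
  assumes rep: "rep tab xs s" and path: "path xs" and tab: "tab \<in> {''G'', ''H''}"
    and K: "gens_stored (\<lambda>d. insert \<one> (set (take d xs))) xs s"
  shows "gens_stored (\<lambda>d. gen (take d xs)) xs (sem orc (PFor ''q'' (compr ''K'' (close_fm tab))) s)"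
proof -
  define P where "P k s' \<longleftrightarrow> rep tab xs s' \<and>
    gens_stored (\<lambda>d. (products G ^^ k) (insert \<one> (set (take d xs)))) xs s'" for k s'
  have nw: "a \<notin> writes (compr ''K'' (close_fm tab))" if "a \<in> {''n'', ''top'', ''X'', ''G'', ''H''}" for a
    using that by (auto simp: writes_compr close_fm_def)
  have sub: "insert \<one> (set (take d xs)) \<subseteq> carrier G" for d
    using path_set[OF path] set_take_subset[of d xs] by auto
  show ?thesis
  proof (rule sem_For_induct[where P = P])
    show "P 0 s" using rep K by (simp add: P_def)
    show "''n'' \<notin> writes (compr ''K'' (close_fm tab))" using nw by simp
    show "gens_stored (\<lambda>d. gen (take d xs)) xs (store s' ''q'' [] (s ''n'' []))"
      if "P (s ''n'' []) s'" for s'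
    proof -
      have "(products G ^^ n) (insert \<one> (set (take d xs))) = gen (take d xs)" for d
        unfolding gen_def using sub[of d] finite_carrier
        by (intro funpow_products_eq_generate) (auto simp: carrier_eq)
      then show ?thesis using that rep by (simp add: P_def gens_stored_def store_other represents_def)
    qed
    fix k s' assume "P k s'"
    let ?u = "store s' ''q'' [] k"
    have u: "rep tab xs ?u" "gens_stored (\<lambda>d. (products G ^^ k) (insert \<one> (set (take d xs)))) xs ?u"
      using \<open>P k s'\<close> tab by (auto simp: P_def gens_stored_def represents_def store_apply)
    have "rep tab xs (sem orc (compr ''K'' (close_fm tab)) ?u)"
      by (rule rep_cong[OF u(1)]) (use nw tab in \<open>auto intro!: sem_frame\<close>)
    moreover have "gens_stored (\<lambda>d. products G ((products G ^^ k) (insert \<one> (set (take d xs))))) xs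
        (sem orc (compr ''K'' (close_fm tab)) ?u)"
      using sub by (intro sem_close_step u path tab funpow_products_carrier)
    ultimately show "P (Suc k) (sem orc (compr ''K'' (close_fm tab)) ?u)" by (simp add: P_def)
  qed simp
qed

lemma sem_top:
  assumes rep: "rep tab xs s"
  shows "marks_stored {length xs} (sem orc (compr ''M'' top_fm) s)"
  unfolding marks_stored_def
proof (intro allI impI)
  fix d assume d: "d < n"
  have n: "s ''n'' [] = n" "s ''top'' [] = length xs" using rep by (auto simp: represents_def)
  have "compr_ok top_fm" using compr_ok_fms(3)[of "''G''"] by simp
  then have "sem orc (compr ''M'' top_fm) s ''M'' [d, d] = of_bool (fval top_fm (store (store s ''d'' [] d) ''i'' [] d))"
    using sem_compr[of top_fm "''M''" d s d orc] d n by simp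
  then show "(sem orc (compr ''M'' top_fm) s ''M'' [d, d] \<noteq> 0) = (d \<in> {length xs})"
    using n by (simp add: top_fm_def store_apply)
qed

lemma sem_mark_step:
  assumes rep: "rep tab xs s" and path: "path xs" and tab: "tab \<in> {''G'', ''H''}"
    and K: "gens_stored (\<lambda>d. gen (take d xs)) xs s"
    and M: "marks_stored M s" "M \<subseteq> {..length xs}"
  shows "marks_stored (mark_step xs M) (sem orc (compr ''M'' (mark_fm tab)) s)"
  unfolding marks_stored_def
proof (intro allI impI)
  fix d assume d: "d < n"
  have len: "length xs < n" using length_path path .
  have n: "s ''n'' [] = n" and t: "\<And>a b. a < n \<Longrightarrow> b < n \<Longrightarrow> s tab [a, b] = a \<otimes> b"
    using rep by (auto simp: represents_def)
  have Md: "s ''M'' [c, c] \<noteq> 0 \<longleftrightarrow> c \<in> M" if "c < n" for c using M(1) that by (simp add: marks_stored_def)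
  have Kd: "s ''K'' [c, i] \<noteq> 0 \<longleftrightarrow> i \<in> gen (take c xs)" if "c \<le> length xs" "i < n" for c i
    using K that by (simp add: gens_stored_def)
  have sub: "gen (take c xs) \<subseteq> {..<n}" for c using gen_carrier path_take[OF path] carrier_eq by blast
  have "sem orc (compr ''M'' (mark_fm tab)) s ''M'' [d, d] \<noteq> 0 \<longleftrightarrow>
      fval (mark_fm tab) (store (store s ''d'' [] d) ''i'' [] d)"
    using sem_compr[OF compr_ok_fms(4)[OF tab], of "''M''" d s d orc] d n by simp
  also have "\<dots> \<longleftrightarrow> s ''M'' [d, d] \<noteq> 0 \<or> (\<exists>c<n. s ''M'' [c, c] \<noteq> 0 \<and> d < c \<and>
      (\<forall>a<n. \<forall>b<n. s ''K'' [c, a] \<noteq> 0 \<and> s ''K'' [d, b] \<noteq> 0 \<longrightarrow>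
        (\<exists>z<n. s ''K'' [d, z] \<noteq> 0 \<and> s tab [z, a] = s tab [a, b])))"
  proof -
    let ?u = "store (store s ''d'' [] d) ''i'' [] d"
    have t: "tab \<noteq> ''d''" "tab \<noteq> ''i''" using tab by auto
    have u: "?u ''d'' [] = d" "?u ''n'' [] = n" "?u ''M'' = s ''M''" "?u ''K'' = s ''K''" "?u tab = s tab"
      using n t by (simp_all add: store_def)
    show ?thesis unfolding fval_mark_fm[OF tab] u ..
  qed
  also have "\<dots> \<longleftrightarrow> d \<in> M \<or> (\<exists>c<n. c \<in> M \<and> normal_step xs d c)"
  proof -
    have "(s ''M'' [c, c] \<noteq> 0 \<and> d < c \<and>
      (\<forall>a<n. \<forall>b<n. s ''K'' [c, a] \<noteq> 0 \<and> s ''K'' [d, b] \<noteq> 0 \<longrightarrow>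
        (\<exists>z<n. s ''K'' [d, z] \<noteq> 0 \<and> s tab [z, a] = s tab [a, b]))) \<longleftrightarrow> c \<in> M \<and> normal_step xs d c" if "c < n" for c
    proof (cases "c \<in> M \<and> d < c")
      case True
      \<comment> \<open>Membership in M bounds c, and d < c then bounds d, so both rows of
        \<open>''K''\<close> that are compared hold genuine subgroups.\<close>
      then have c: "c \<le> length xs" "d \<le> length xs" using M(2) by auto
      have "(\<forall>a<n. \<forall>b<n. s ''K'' [c, a] \<noteq> 0 \<and> s ''K'' [d, b] \<noteq> 0 \<longrightarrow>
        (\<exists>z<n. s ''K'' [d, z] \<noteq> 0 \<and> s tab [z, a] = s tab [a, b])) \<longleftrightarrow>
        (\<forall>a<n. \<forall>b<n. a \<in> gen (take c xs) \<and> b \<in> gen (take d xs) \<longrightarrow>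
        (\<exists>z<n. z \<in> gen (take d xs) \<and> z \<otimes> a = a \<otimes> b))"
        using Kd[OF c(1)] Kd[OF c(2)] t by (simp cong: conj_cong del: neq0_conv)
      also have "\<dots> \<longleftrightarrow> closed_under_conj G (gen (take d xs)) (gen (take c xs))"
        unfolding closed_under_conj_def using sub[of c] sub[of d] by (meson lessThan_iff subsetD)
      finally show ?thesis using True Md[OF that] by (simp add: normal_step_def)
    next
      case False
      then show ?thesis using Md[OF that] by (auto simp: normal_step_def)
    qed
    then show ?thesis using Md[OF d] by blast
  qed
  also have "\<dots> \<longleftrightarrow> d \<in> mark_step xs M"
    using M(2) len by (force simp: mem_mark_step)
  finally show "(sem orc (compr ''M'' (mark_fm tab)) s ''M'' [d, d] \<noteq> 0) = (d \<in> mark_step xs M)" .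
qed

lemma funpow_mark_step_subset: "(mark_step xs ^^ k) {length xs} \<subseteq> {..length xs}"
proof (induction k)
  case (Suc k)
  then show ?case by (force simp: mem_mark_step normal_step_def)
qed simp

lemma sem_mark:
  assumes rep: "rep tab xs s" and path: "path xs" and tab: "tab \<in> {''G'', ''H''}"
    and K: "gens_stored (\<lambda>d. gen (take d xs)) xs s" and M: "marks_stored {length xs} s"
  shows "marks_stored (marks xs) (sem orc (PFor ''q'' (compr ''M'' (mark_fm tab))) s)"
proof -
  define P where "P k s' \<longleftrightarrow> rep tab xs s' \<and> gens_stored (\<lambda>d. gen (take d xs)) xs s' \<and>
    marks_stored ((mark_step xs ^^ k) {length xs}) s'" for k s'
  let ?p = "compr ''M'' (mark_fm tab)"
  have nw: "a \<notin> writes ?p" if "a \<in> {''n'', ''top'', ''X'', ''G'', ''H'', ''K''}" for a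
    using that by (auto simp: writes_compr mark_fm_def normal_fm_def)
  show ?thesis
  proof (rule sem_For_induct[where P = P])
    show "P 0 s" using rep K M by (simp add: P_def)
    show "''n'' \<notin> writes ?p" using nw by simp
    show "marks_stored (marks xs) (store s' ''q'' [] (s ''n'' []))" if "P (s ''n'' []) s'" for s'
      using that rep by (simp add: P_def marks_stored_def store_other represents_def marks_def)
    fix k s' assume "P k s'"
    let ?u = "store s' ''q'' [] k"
    have u: "rep tab xs ?u" "gens_stored (\<lambda>d. gen (take d xs)) xs ?u"
      "marks_stored ((mark_step xs ^^ k) {length xs}) ?u"
      using \<open>P k s'\<close> tab by (auto simp: P_def gens_stored_def marks_stored_def represents_def store_apply)
    have "rep tab xs (sem orc ?p ?u)"
      by (rule rep_cong[OF u(1)]) (use nw tab in \<open>auto intro!: sem_frame\<close>)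
    moreover have "sem orc ?p ?u ''K'' = ?u ''K''" using nw by (intro sem_frame) simp
    then have "gens_stored (\<lambda>d. gen (take d xs)) xs (sem orc ?p ?u)" using u(2) by (simp add: gens_stored_def)
    moreover have "marks_stored (mark_step xs ((mark_step xs ^^ k) {length xs})) (sem orc ?p ?u)"
      by (intro sem_mark_step u path tab funpow_mark_step_subset)
    ultimately show "P (Suc k) (sem orc ?p ?u)" by (simp add: P_def)
  qed simp
qed

end

section \<open>Collecting the marked subgroups for a query\<close>

lemma sem_store_row:
  fixes u :: state
  defines "p \<equiv> PFor ''i'' (PAssign ''S'' [var ''l'', ivar] (Cell ''K'' [dvar, ivar]))"
  shows "sem orc p u ''S'' [j, i] =
    (if j = u ''l'' [] \<and> i < u ''n'' [] then u ''K'' [u ''d'' [], i] else u ''S'' [j, i])"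
proof -
  define P where "P k s' \<longleftrightarrow> s' ''l'' = u ''l'' \<and> s' ''d'' = u ''d'' \<and> s' ''K'' = u ''K'' \<and>
    (\<forall>j i. s' ''S'' [j, i] = (if j = u ''l'' [] \<and> i < k then u ''K'' [u ''d'' [], i] else u ''S'' [j, i]))"
    for k :: nat and s' :: state
  define Q where "Q s' \<longleftrightarrow> (\<forall>j i. s' ''S'' [j, i] =
    (if j = u ''l'' [] \<and> i < u ''n'' [] then u ''K'' [u ''d'' [], i] else u ''S'' [j, i]))" for s' :: state
  have "Q (sem orc p u)"
    unfolding p_def
    by (rule sem_For_induct[where P = P]) (auto simp: P_def Q_def store_def)
  then show ?thesis by (simp add: Q_def)
qed

lemma sem_list_marked:
  fixes s :: state and orc :: oracle_fun
  defines "F \<equiv> \<lambda>k. filter (\<lambda>d. s ''M'' [d, d] \<noteq> 0) [0..<k]"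
  defines "s' \<equiv> sem orc list_marked s" and "n \<equiv> s ''n'' []"
  shows "s' ''l'' [] = length (F n)" and "j < length (F n) \<Longrightarrow> i < n \<Longrightarrow> s' ''S'' [j, i] = s ''K'' [F n ! j, i]"
proof -
  define P where "P k t \<longleftrightarrow> t ''M'' = s ''M'' \<and> t ''K'' = s ''K'' \<and> t ''n'' = s ''n'' \<and> t ''l'' [] = length (F k) \<and>
    (\<forall>j<length (F k). \<forall>i<n. t ''S'' [j, i] = s ''K'' [F k ! j, i])" for k :: nat and t :: state
  define Q where "Q t \<longleftrightarrow> t ''l'' [] = length (F n) \<and>
    (\<forall>j<length (F n). \<forall>i<n. t ''S'' [j, i] = s ''K'' [F n ! j, i])" for t :: state
  let ?row = "PFor ''i'' (PAssign ''S'' [var ''l'', ivar] (Cell ''K'' [dvar, ivar]))"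
  let ?p = "PIf (nonzero (Cell ''M'' [dvar, dvar])) (PSeq ?row (PAssign ''l'' [] (Succ (var ''l'')))) PSkip"
  let ?s = "store s ''l'' [] 0"
  have "Q (sem orc (PFor ''d'' ?p) ?s)"
  proof (rule sem_For_induct[where P = P])
    show "P 0 ?s" by (simp add: P_def F_def store_def)
    show "''n'' \<notin> writes ?p" "''d'' \<noteq> ''n''" by simp_all
    show "Q (store t ''d'' [] (?s ''n'' []))" if "P (?s ''n'' []) t" for t
      using that by (simp add: P_def Q_def n_def store_def)
    fix k t assume k: "k < ?s ''n'' []" and P: "P k t"
    let ?u = "store t ''d'' [] k"
    have u: "?u ''d'' [] = k" "?u ''M'' = s ''M''" "?u ''K'' = s ''K''" "?u ''n'' = s ''n''"
      "?u ''l'' [] = length (F k)" "?u ''S'' = t ''S''"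
      using P by (simp_all add: P_def store_def)
    show "P (Suc k) (sem orc ?p ?u)"
    proof (cases "s ''M'' [k, k] \<noteq> 0")
      case False
      then have "sem orc ?p ?u = ?u" using u by simp
      moreover have "F (Suc k) = F k" using False by (simp add: F_def)
      ultimately show ?thesis using P u by (simp add: P_def)
    next
      case True
      have F: "F (Suc k) = F k @ [k]" using True by (simp add: F_def)
      let ?v = "sem orc ?row ?u"
      have v: "?v ''M'' = s ''M''" "?v ''K'' = s ''K''" "?v ''n'' = s ''n''" "?v ''l'' [] = length (F k)"
        using u by (simp_all add: sem_frame)
      have vS: "?v ''S'' [j, i] = (if j = length (F k) then s ''K'' [k, i] else t ''S'' [j, i])" if "i < n" for j i
        using sem_store_row[of orc ?u j i] u that by (simp add: n_def)
      have "sem orc ?p ?u = store ?v ''l'' [] (Suc (length (F k)))" using True u v by simp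
      moreover have "store ?v ''l'' [] (Suc (length (F k))) ''S'' [j, i] = s ''K'' [F (Suc k) ! j, i]"
        if "j < length (F (Suc k))" "i < n" for j i
        using P that vS[OF that(2), of j] by (auto simp: F P_def store_other nth_append less_Suc_eq)
      ultimately show ?thesis using v F by (simp add: P_def store_def)
    qed
  qed
  moreover have "s' = sem orc (PFor ''d'' ?p) ?s" by (simp add: s'_def list_marked_def)
  ultimately have "Q s'" by simp
  then show "s' ''l'' [] = length (F n)" "j < length (F n) \<Longrightarrow> i < n \<Longrightarrow> s' ''S'' [j, i] = s ''K'' [F n ! j, i]"
    by (auto simp: Q_def)
qed

lemma writes_chain: "writes (chain tab) =
  {''K'', ''M'', ''S'', ''T'', ''a'', ''b'', ''c'', ''d'', ''i'', ''l'', ''q'', ''r'', ''z''}"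
  by (auto simp: chain_def list_marked_def writes_compr fm_defs)

context nat_group begin

lemma series_stored:
  assumes path: "path xs" and n: "s ''n'' [] = n"
    and K: "gens_stored (\<lambda>d. gen (take d xs)) xs s" and M: "marks_stored (marks xs) s"
  shows "read_subsets (sem orc list_marked s) ''S'' n (sem orc list_marked s ''l'' []) = series xs"
proof -
  let ?s = "sem orc list_marked s"
  define ds where "ds = filter (\<lambda>d. d \<in> marks xs) [0..<Suc (length xs)]"
  have len: "length xs < n" using length_path path .
  \<comment> \<open>The program scans all positions below n, while \<open>series\<close> stops at
    the top of the chain; no mark lies beyond it.\<close>
  have "[0..<n] = [0..<Suc (length xs)] @ [Suc (length xs)..<n]" using len
    by (metis Suc_leI le0 upt_add_eq_append le_add_diff_inverse)
  moreover have "filter (\<lambda>d. d \<in> marks xs) [Suc (length xs)..<n] = []"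
    using marks_props(1)[OF path] by (auto simp: filter_empty_conv)
  moreover have "filter (\<lambda>d. s ''M'' [d, d] \<noteq> 0) [0..<n] = filter (\<lambda>d. d \<in> marks xs) [0..<n]"
    using M by (intro filter_cong) (auto simp: marks_stored_def)
  ultimately have ds: "filter (\<lambda>d. s ''M'' [d, d] \<noteq> 0) [0..<s ''n'' []] = ds"
    unfolding ds_def n by (simp only: filter_append append_Nil2)
  have S: "series xs = map (\<lambda>d. gen (take d xs)) ds" by (simp add: series_def ds_def)
  have l: "?s ''l'' [] = length ds" using sem_list_marked(1)[of orc s] ds by simp
  show ?thesis
  proof (rule nth_equalityI)
    show "length (read_subsets ?s ''S'' n (?s ''l'' [])) = length (series xs)"
      using l by (simp add: read_subsets_def S)
    fix j assume "j < length (read_subsets ?s ''S'' n (?s ''l'' []))"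
    then have j: "j < length ds" using l by (simp add: read_subsets_def)
    have "ds ! j \<in> set ds" using j by simp
    then have dj: "ds ! j \<le> length xs" unfolding ds_def by (auto simp del: upt_Suc)
    have "{i. i < n \<and> ?s ''S'' [j, i] \<noteq> 0} = gen (take (ds ! j) xs)"
    proof -
      have "?s ''S'' [j, i] \<noteq> 0 \<longleftrightarrow> i \<in> gen (take (ds ! j) xs)" if "i < n" for i
      proof -
        have "?s ''S'' [j, i] = s ''K'' [ds ! j, i]"
          using sem_list_marked(2)[of j s i orc] ds j n that by simp
        then show ?thesis using K dj that by (simp add: gens_stored_def)
      qed
      moreover have "gen (take (ds ! j) xs) \<subseteq> {..<n}"
        using gen_carrier[OF path_take[OF path]] carrier_eq by simp
      ultimately show ?thesis by blast
    qed
    then show "read_subsets ?s ''S'' n (?s ''l'' []) ! j = series xs ! j"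
      using j l by (simp add: read_subsets_def S)
  qed
qed

lemma sem_chain:
  fixes s :: state and orc :: oracle_fun
  assumes rep: "rep tab xs s" and path: "path xs" and tab: "tab \<in> {''G'', ''H''}"
  defines "s' \<equiv> sem orc (chain tab) s"
  shows "gens_stored (\<lambda>d. gen (take d xs)) xs s'" and "read_subsets s' ''S'' n (s' ''l'' []) = series xs"
    and "rep tab xs s'"
proof -
  define s1 where "s1 = sem orc (compr ''K'' (init_fm tab)) s"
  define s2 where "s2 = sem orc (PFor ''q'' (compr ''K'' (close_fm tab))) s1"
  define s3 where "s3 = sem orc (compr ''M'' top_fm) s2"
  define s4 where "s4 = sem orc (PFor ''q'' (compr ''M'' (mark_fm tab))) s3"
  have s': "s' = sem orc list_marked s4"
    by (simp add: s'_def s1_def s2_def s3_def s4_def chain_def)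
  note nw = writes_compr fm_defs
  have r1: "rep tab xs s1" unfolding s1_def
    by (rule rep_cong[OF rep]; rule sem_frame) (use tab in \<open>auto simp: nw\<close>)
  have r2: "rep tab xs s2" unfolding s2_def
    by (rule rep_cong[OF r1]; rule sem_frame) (use tab in \<open>auto simp: nw\<close>)
  have r3: "rep tab xs s3" unfolding s3_def
    by (rule rep_cong[OF r2]; rule sem_frame) (use tab in \<open>auto simp: nw\<close>)
  have r4: "rep tab xs s4" unfolding s4_def
    by (rule rep_cong[OF r3]; rule sem_frame) (use tab in \<open>auto simp: nw\<close>)
  have "gens_stored (\<lambda>d. insert \<one> (set (take d xs))) xs s1"
    unfolding s1_def by (rule sem_init[OF rep path tab])
  then have K2: "gens_stored (\<lambda>d. gen (take d xs)) xs s2"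
    unfolding s2_def by (rule sem_close[OF r1 path tab])
  have "s3 ''K'' = s2 ''K''" unfolding s3_def by (rule sem_frame) (simp add: nw)
  then have K3: "gens_stored (\<lambda>d. gen (take d xs)) xs s3" using K2 by (simp add: gens_stored_def)
  have M3: "marks_stored {length xs} s3" unfolding s3_def by (rule sem_top[OF r2])
  have "s4 ''K'' = s3 ''K''" unfolding s4_def by (rule sem_frame) (simp add: nw)
  then have K4: "gens_stored (\<lambda>d. gen (take d xs)) xs s4" using K3 by (simp add: gens_stored_def)
  have M4: "marks_stored (marks xs) s4" unfolding s4_def by (rule sem_mark[OF r3 path tab K3 M3])
  have "s' ''K'' = s4 ''K''" unfolding s' by (rule sem_frame) (simp add: list_marked_def)
  then show "gens_stored (\<lambda>d. gen (take d xs)) xs s'" using K4 by (simp add: gens_stored_def)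
  have "s4 ''n'' [] = n" using r4 by (simp add: represents_def)
  then show "read_subsets s' ''S'' n (s' ''l'' []) = series xs"
    unfolding s' by (rule series_stored[OF path _ K4 M4])
  show "rep tab xs s'" unfolding s'
    by (rule rep_cong[OF r4]; rule sem_frame) (use tab in \<open>auto simp: list_marked_def\<close>)
qed

end

section \<open>Depth-first search\<close>

text \<open>Links the count of search steps with the while loop: m rounds whose test succeeds each
  time. Nothing is said about the test at the end, so that runs can be concatenated.\<close>

definition iterates :: "('s \<Rightarrow> 's) \<Rightarrow> ('s \<Rightarrow> bool) \<Rightarrow> nat \<Rightarrow> 's \<Rightarrow> 's \<Rightarrow> bool" where
  "iterates f b m s s' \<longleftrightarrow> s' = (f ^^ m) s \<and> (\<forall>i<m. b ((f ^^ i) s))"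

lemma iterates_0: "iterates f b 0 s s"
  by (simp add: iterates_def)

lemma iterates_Suc: "b s \<Longrightarrow> iterates f b m (f s) s' \<Longrightarrow> iterates f b (Suc m) s s'"
  unfolding iterates_def by (auto simp: funpow_swap1 less_Suc_eq_0_disj)

lemma iterates_trans: "iterates f b m s s' \<Longrightarrow> iterates f b k s' s'' \<Longrightarrow> iterates f b (m + k) s s''"
proof (induction m arbitrary: s)
  case 0
  then show ?case by (simp add: iterates_def)
next
  case (Suc m)
  then have "b s" "iterates f b m (f s) s'"
    unfolding iterates_def by (auto simp: funpow_swap1)
  then show ?case using Suc by (auto intro: iterates_Suc)
qed

lemma exec_While_iterates:
  assumes "iterates f (\<lambda>s. bval s b) m s s'" "\<not> bval s' b"
    and "\<And>s. P s \<Longrightarrow> \<exists>t \<le> T. exec orc c s t (f s) \<and> P (f s)" "P s"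
  shows "\<exists>t \<le> m * (T + 1) + 1. exec orc (While b c) s t s' \<and> P s'"
  using assms(1,4)
proof (induction m arbitrary: s)
  case 0
  then show ?case using assms(2) by (auto simp: iterates_def intro!: exI[of _ 1] exec.WhileFalse)
next
  case (Suc m)
  have b: "bval s b" and it: "iterates f (\<lambda>s. bval s b) m (f s) s'"
    using Suc.prems unfolding iterates_def by (auto simp: funpow_swap1)
  obtain t where t: "t \<le> T" "exec orc c s t (f s)" "P (f s)" using assms(3) Suc.prems by blast
  obtain u where u: "u \<le> m * (T + 1) + 1" "exec orc (While b c) (f s) u s'" "P s'"
    using Suc.IH[OF it t(3)] by blast
  have "exec orc (While b c) s (1 + t + u) s'" by (rule exec.WhileTrue[OF b t(2) u(2)])
  moreover have "1 + t + u \<le> Suc m * (T + 1) + 1" using t(1) u(1) by simp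
  ultimately show ?case using u(3) by blast
qed

section \<open>Counting the rounds of the search on an abstract state\<close>

context nat_group begin

definition extensions :: "nat list \<Rightarrow> nat list set" where
  "extensions xs = {ys. path ys \<and> (\<exists>zs. ys = xs @ zs)}"

lemma extensions_eq:
  assumes "path xs"
  shows "extensions xs = insert xs (\<Union>x \<in> {x. valid xs x}. extensions (xs @ [x]))"
proof (intro equalityI subsetI)
  fix ys assume "ys \<in> extensions xs"
  then obtain zs where zs: "path ys" "ys = xs @ zs" by (auto simp: extensions_def)
  show "ys \<in> insert xs (\<Union>x \<in> {x. valid xs x}. extensions (xs @ [x]))"
  proof (cases zs)
    case Nil
    then show ?thesis using zs by simp
  next
    case (Cons x us)
    then have ys: "ys = (xs @ [x]) @ us" using zs by simp
    then have "path (xs @ [x])" using zs path_append by metis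
    then have "valid xs x" by (simp add: path_snoc_iff)
    then show ?thesis using zs(1) ys by (auto simp: extensions_def)
  qed
qed (use assms in \<open>auto simp: extensions_def\<close>)

lemma valid_less: "valid xs x \<Longrightarrow> x < n"
  by (simp add: valid_def)

lemma n_pos: "0 < n"
  using one_closed carrier_eq by (metis lessThan_iff gr_zeroI not_less0)

text \<open>\<open>R xs x V s\<close> reads: the search stands at node xs with next candidate x,
  having visited V. The weight is a potential with w at least n + 2 plus the weights of the
  children: n for the candidates tried at the node, and 2 for the round that enters it and the round
  that leaves it.\<close>

lemma depth_first_search:
  fixes f :: "'s \<Rightarrow> 's" and R :: "nat list \<Rightarrow> nat \<Rightarrow> nat list set \<Rightarrow> 's \<Rightarrow> bool" and w :: "nat list \<Rightarrow> real"
  assumes push: "\<And>xs x V s. R xs x V s \<Longrightarrow> path xs \<Longrightarrow> valid xs x \<Longrightarrow> R (xs @ [x]) 0 (insert xs V) (f s)"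
    and skip: "\<And>xs x V s. R xs x V s \<Longrightarrow> path xs \<Longrightarrow> x < n \<Longrightarrow> \<not> valid xs x \<Longrightarrow> R xs (Suc x) (insert xs V) (f s)"
    and pop: "\<And>xs x V s. R (xs @ [x]) n V s \<Longrightarrow> path (xs @ [x]) \<Longrightarrow> R xs (Suc x) (insert (xs @ [x]) V) (f s)"
    and b: "\<And>xs x V s. R xs x V s \<Longrightarrow> path xs \<Longrightarrow> x \<le> n \<Longrightarrow> b s \<longleftrightarrow> \<not> (xs = [] \<and> x = n)"
    and w: "\<And>xs. path xs \<Longrightarrow> real n + 2 + (\<Sum>x | valid xs x. w (xs @ [x])) \<le> w xs"
    and start: "path xs" "R xs 0 V s"
  shows "\<exists>m s'. real m + 2 \<le> w xs \<and> iterates f b m s s' \<and> R xs n (V \<union> extensions xs) s'"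
  using start
proof (induction "n - length xs" arbitrary: xs V s rule: less_induct)
  case less
  note path = \<open>path xs\<close>
  \<comment> \<open>Price of candidate y. For a child, the slack 2 in the induction hypothesis pays
    for its push and its pop.\<close>
  define c where "c y = (if valid xs y then w (xs @ [y]) else 1)" for y
  define E where "E y = (if valid xs y then extensions (xs @ [y]) else {})" for y
  \<comment> \<open>Nodes visited from candidate x on. At x = n no round remains at this node, the
    pop being charged to its parent; hence the case distinction.\<close>
  define D where "D x = (if x < n then {xs} else {}) \<union> (\<Union>y\<in>{x..<n}. E y)" for x
  have inner: "\<exists>m s'. real m \<le> (\<Sum>y\<in>{x..<n}. c y) \<and> iterates f b m s s' \<and> R xs n (V \<union> D x) s'"
    if "x \<le> n" "R xs x V s" for x V s
    using that
  proof (induction "n - x" arbitrary: x V s)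
    case 0
    then have x: "x = n" by simp
    show ?case
      by (rule exI[of _ 0], rule exI[of _ s]) (use 0 x in \<open>simp add: iterates_0 D_def\<close>)
  next
    case (Suc k)
    then have xn: "x < n" "k = n - Suc x" "Suc x \<le> n" by simp_all
    have bs: "b s" using b[OF Suc.prems(2) path Suc.prems(1)] xn by simp
    have split: "{x..<n} = insert x {Suc x..<n}" using xn by auto
    have sum: "(\<Sum>y\<in>{x..<n}. c y) = c x + (\<Sum>y\<in>{Suc x..<n}. c y)" unfolding split by simp
    have D: "D x = insert xs (E x \<union> D (Suc x))" using xn unfolding D_def split by auto
    note IH = Suc.hyps(1)[OF xn(2,3)]
    show ?case
    proof (cases "valid xs x")
      case False
      have R': "R xs (Suc x) (insert xs V) (f s)" using skip[OF Suc.prems(2) path xn(1) False] .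
      obtain m s' where m: "real m \<le> (\<Sum>y\<in>{Suc x..<n}. c y)" "iterates f b m (f s) s'"
        "R xs n (insert xs V \<union> D (Suc x)) s'"
        using IH[OF R'] by blast
      have "insert xs V \<union> D (Suc x) = V \<union> D x" unfolding D using False by (simp add: E_def)
      moreover have "real (Suc m) \<le> (\<Sum>y\<in>{x..<n}. c y)" using m(1) sum False by (simp add: c_def)
      ultimately show ?thesis using m iterates_Suc[of b s f, OF bs m(2)] by metis
    next
      case True
      have path': "path (xs @ [x])" using path True by (simp add: path_snoc_iff)
      have smaller: "n - length (xs @ [x]) < n - length xs" using length_path[OF path'] by simp
      obtain m1 s1 where m1: "real m1 + 2 \<le> w (xs @ [x])" "iterates f b m1 (f s) s1"
        "R (xs @ [x]) n (insert xs V \<union> extensions (xs @ [x])) s1"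
        using less.hyps[OF smaller path' push[OF Suc.prems(2) path True]] by blast
      let ?V = "insert (xs @ [x]) (insert xs V \<union> extensions (xs @ [x]))"
      have R': "R xs (Suc x) ?V (f s1)" by (rule pop[OF m1(3) path'])
      \<comment> \<open>Exhausted candidates stop the loop only at the root, and here the stack is
        nonempty.\<close>
      have bs1: "b s1" using b[OF m1(3) path'] by simp
      obtain m2 s2 where m2: "real m2 \<le> (\<Sum>y\<in>{Suc x..<n}. c y)" "iterates f b m2 (f s1) s2"
        "R xs n (?V \<union> D (Suc x)) s2"
        using IH[OF R'] by blast
      have "xs @ [x] \<in> extensions (xs @ [x])" using path' by (simp add: extensions_def)
      then have "?V \<union> D (Suc x) = V \<union> D x" unfolding D using True by (auto simp: E_def)
      moreover have "iterates f b (Suc m1 + Suc m2) s s2"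
        by (rule iterates_trans[OF iterates_Suc[OF bs m1(2)] iterates_Suc[OF bs1 m2(2)]])
      moreover have "real (Suc m1 + Suc m2) \<le> (\<Sum>y\<in>{x..<n}. c y)"
        using m1(1) m2(1) sum True by (simp add: c_def)
      ultimately show ?thesis using m2(3) by metis
    qed
  qed
  obtain m s' where m: "real m \<le> (\<Sum>y\<in>{0..<n}. c y)" "iterates f b m s s'" "R xs n (V \<union> D 0) s'"
    using inner[of 0 V s] less.prems by auto
  have V: "{x. valid xs x} \<subseteq> {0..<n}" using valid_less by auto
  have "D 0 = insert xs (\<Union>y\<in>{0..<n}. E y)" using n_pos by (simp add: D_def)
  also have "(\<Union>y\<in>{0..<n}. E y) = (\<Union>x \<in> {x. valid xs x}. extensions (xs @ [x]))"
    using valid_less by (fastforce simp: E_def split: if_splits)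
  also have "insert xs \<dots> = extensions xs" using extensions_eq[OF path] by simp
  finally have D0: "D 0 = extensions xs" .
  have "(\<Sum>y\<in>{0..<n}. c y) \<le> (\<Sum>y\<in>{0..<n}. 1 + (if valid xs y then w (xs @ [y]) else 0))"
    by (rule sum_mono) (auto simp: c_def)
  also have "\<dots> = real n + (\<Sum>y | valid xs y. w (xs @ [y]))"
    unfolding sum.distrib using V by (simp add: sum.If_cases Int_absorb1 Int_def) (meson valid_less)
  finally have "real m + 2 \<le> w xs" using m(1) w[OF path] by simp
  then show ?case using m D0 by metis
qed

end

section \<open>The potential bounding the search tree\<close>

context nat_group begin

text \<open>
  With \<open>u = log\<^sub>p (n / |K|)\<close> there are at most \<open>p\<^sup>u\<close> children, each with \<open>u\<close> smaller by at least 1, and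
  \<open>p\<^sup>u \<cdot> p\<^bsup>(u-1)\<^sup>2/2 + 3(u-1)/2\<^esup> = p\<^bsup>u\<^sup>2/2 + 3u/2\<^esup> / p\<close>; the exponent is chosen to make this work.
\<close>

definition weight :: "real \<Rightarrow> nat list \<Rightarrow> real" where
  "weight p xs = (let u = log p (real n / real (card (gen xs)))
     in 2 * (real n + 2) * p powr (u ^ 2 / 2 + 3 * u / 2))"

lemma card_gen_bounds:
  assumes "path xs" shows "0 < card (gen xs)" "card (gen xs) \<le> n"
proof -
  have "\<one> \<in> gen xs" using subgroup_gen[OF assms] subgroup.one_closed by blast
  then show "0 < card (gen xs)" using finite_gen[OF assms] by (auto simp: card_gt_0_iff)
  have "card (gen xs) \<le> card (carrier G)" using assms by (intro card_mono finite_carrier gen_carrier)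
  then show "card (gen xs) \<le> n" by (simp add: carrier_eq)
qed

text \<open>The exponent f(u) = u^2/2 + 3u/2 satisfies f(u) - f(u-1) = u + 1. The u pays for the at
  most p^u children. The 1 yields a factor 1/p <= 1/2, so that the children use only half of the
  weight; the other half pays for n + 2.\<close>

lemma weight_step:
  assumes p: "2 \<le> p" "\<And>m. 1 < m \<Longrightarrow> m dvd n \<Longrightarrow> p \<le> real m" and path: "path xs"
  shows "real n + 2 + (\<Sum>x | valid xs x. weight p (xs @ [x])) \<le> weight p xs"
proof -
  define q where "q = card (gen xs)"
  define y where "y = real n / real q"
  define u where "u = log p y"
  define B where "B = p powr (u ^ 2 / 2 + 3 * u / 2)"
  have q: "0 < q" "q \<le> n" using card_gen_bounds[OF path] by (simp_all add: q_def)
  have y: "1 \<le> y" using q by (simp add: y_def)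
  have u: "0 \<le> u" using p y by (simp add: u_def)
  have B: "1 \<le> B" unfolding B_def using p u by (intro ge_one_powr_ge_zero) auto
  have W: "weight p xs = 2 * (real n + 2) * B"
    by (simp add: weight_def B_def u_def y_def q_def Let_def)
  have child: "weight p (xs @ [x]) \<le> (real n + 2) * (B / y)" if "valid xs x" for x
  proof -
    have path': "path (xs @ [x])" using that path by (simp add: path_snoc_iff)
    obtain m where m: "card (gen (xs @ [x])) = q * m" "1 < m" "m dvd n"
      using card_gen_dvd[OF path'] unfolding q_def by blast
    have pm: "p \<le> real m" using p m by blast
    define v where "v = log p (real n / real (card (gen (xs @ [x]))))"
    have qm: "q * m \<le> n" using card_gen_bounds(2)[OF path'] m by simp
    have v: "v = u - log p m"
      unfolding v_def u_def y_def m(1) using p q m by (simp add: log_divide log_mult)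
    have "1 \<le> log p m" using p pm by (simp add: le_log_iff)
    then have vu: "v \<le> u - 1" using v by simp
    \<comment> \<open>Nonnegativity of v is needed to square the inequality v <= u - 1.\<close>
    have "1 \<le> real n / real (q * m)" using qm q m by (simp flip: of_nat_mult)
    then have v0: "0 \<le> v" unfolding v_def m(1) using p by simp
    have "v ^ 2 / 2 + 3 * v / 2 \<le> (u - 1) ^ 2 / 2 + 3 * (u - 1) / 2"
    proof (rule add_mono)
      show "v ^ 2 / 2 \<le> (u - 1) ^ 2 / 2" by (rule divide_right_mono[OF power_mono[OF vu v0]]) simp
      show "3 * v / 2 \<le> 3 * (u - 1) / 2" by (intro divide_right_mono mult_left_mono vu) simp_all
    qed
    also have "\<dots> = (u ^ 2 / 2 + 3 * u / 2) - u - 1" by (simp add: power2_eq_square field_simps)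
    finally have "p powr (v ^ 2 / 2 + 3 * v / 2) \<le> p powr ((u ^ 2 / 2 + 3 * u / 2) - u - 1)"
      using p by simp
    also have "\<dots> = B / y / p"
    proof -
      have "p powr u = y" "p powr 1 = p" using p y by (simp_all add: u_def)
      then show ?thesis unfolding B_def powr_diff by simp
    qed
    also have "\<dots> \<le> B / y / 2" using p y B by (intro divide_left_mono) auto
    finally have "2 * (real n + 2) * p powr (v ^ 2 / 2 + 3 * v / 2) \<le> 2 * (real n + 2) * (B / y / 2)"
      by (intro mult_left_mono) auto
    also have "\<dots> = (real n + 2) * (B / y)"
    proof -
      have "2 * c * (a / 2) = c * a" for c a :: real by simp
      then show ?thesis .
    qed
    finally show ?thesis unfolding weight_def v_def Let_def .
  qed
  have "real (card {x. valid xs x}) * real q \<le> real n"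
    using card_valid[OF path] unfolding q_def by (simp flip: of_nat_mult)
  then have V: "real (card {x. valid xs x}) \<le> y" using q by (simp add: y_def field_simps)
  have "(\<Sum>x | valid xs x. weight p (xs @ [x])) \<le> real (card {x. valid xs x}) * ((real n + 2) * (B / y))"
    by (rule sum_bounded_above) (use child in auto)
  also have "\<dots> \<le> y * ((real n + 2) * (B / y))" using V y B by (intro mult_right_mono) auto
  also have "\<dots> = (real n + 2) * B" using y by simp
  finally have "real n + 2 + (\<Sum>x | valid xs x. weight p (xs @ [x])) \<le> (real n + 2) * 1 + (real n + 2) * B"
    by simp
  also have "\<dots> \<le> (real n + 2) * B + (real n + 2) * B"
    using B by (intro add_mono mult_left_mono) auto
  finally show ?thesis unfolding W by (simp add: algebra_simps)
qed

lemma weight_Nil: "weight p [] = 2 * (real n + 2) * p powr ((log p n) ^ 2 / 2 + 3 * log p n / 2)"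
  by (simp add: weight_def gen_Nil Let_def)

end

section \<open>The search program and its leaf action\<close>

abbreviation "cand \<equiv> Cell ''X'' [var ''top'']"

definition full_fm :: fm where
  "full_fm = FAll ''a'' (FAtom (nonzero (Cell ''K'' [var ''top'', var ''a''])))"

definition valid_fm :: "vname \<Rightarrow> fm" where
  "valid_fm tab = FAnd (FAtom (Equal (Cell ''K'' [var ''top'', cand]) (Const 0)))
     (FAll ''a'' (FAtom (Neg (Conj (nonzero (Cell ''K'' [var ''top'', var ''a'']))
       (Less (Cell tab [cand, var ''a'']) cand)))))"

definition incr_cand :: prog where
  "incr_cand = PAssign ''X'' [var ''top''] (Succ cand)"

text \<open>Generators and candidates share one array: pushing turns the candidate into a stack
  entry, and after a pop the entry is the candidate again, so incrementing it resumes the search at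
  the parent. The loop test excludes a pop from the empty stack.\<close>

definition move :: "vname \<Rightarrow> prog" where
  "move tab = PIf (Equal cand (var ''n''))
     (PSeq (PAssign ''top'' [] (Pred (var ''top''))) incr_cand)
     (PSeq (test (valid_fm tab) 0) (PIf (Equal (result 0) (Const 0)) incr_cand
       (PSeq (PAssign ''top'' [] (Succ (var ''top''))) (PAssign ''X'' [var ''top''] (Const 0)))))"

definition body :: "vname \<Rightarrow> prog \<Rightarrow> prog" where
  "body tab leaf = PSeq (chain tab) (PSeq (test full_fm 0)
     (PSeq (PIf (Equal (result 0) (Const 0)) PSkip leaf) (move tab)))"

definition loop_cond :: bexp where
  "loop_cond = Neg (Conj (Equal (var ''top'') (Const 0)) (Equal cand (var ''n'')))"

definition enumerate :: "vname \<Rightarrow> prog \<Rightarrow> com" where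
  "enumerate tab leaf = Seq (Assign ''top'' [] (Const 0)) (Seq (Assign ''X'' [Const 0] (Const 0))
     (While loop_cond (compile (body tab leaf))))"

lemma writes_move: "writes (move tab) = {''X'', ''a'', ''r'', ''top''}"
  by (auto simp: move_def incr_cand_def writes_test valid_fm_def)

definition work_names :: "vname set" where
  "work_names = {''K'', ''M'', ''S'', ''T'', ''X'', ''a'', ''b'', ''c'', ''d'', ''i'', ''l'', ''q'', ''r'', ''top'', ''z''}"

context nat_group begin

lemma sem_full_test:
  assumes "rep tab xs s" "path xs" "gens_stored (\<lambda>d. gen (take d xs)) xs s"
  shows "sem orc (test full_fm 0) s ''r'' [0] = of_bool (full xs)"
proof -
  have n: "s ''n'' [] = n" "s ''top'' [] = length xs" using assms by (auto simp: represents_def)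
  have "fm_ok full_fm" by (simp add: full_fm_def junk_def)
  then have "sem orc (test full_fm 0) s ''r'' [0] = of_bool (fval full_fm s)" using sem_test by blast
  moreover have "fval full_fm s \<longleftrightarrow> (\<forall>a<n. s ''K'' [length xs, a] \<noteq> 0)"
    using n by (simp add: full_fm_def store_apply)
  moreover have "\<dots> \<longleftrightarrow> (\<forall>a<n. a \<in> gen xs)" using assms(3) by (simp add: gens_stored_def)
  moreover have "\<dots> \<longleftrightarrow> full xs" using gen_carrier[OF assms(2)] assms(2) unfolding full_def carrier_eq by auto
  ultimately show ?thesis by simp
qed

lemma sem_valid_test:
  assumes "rep tab xs s" "path xs" "gens_stored (\<lambda>d. gen (take d xs)) xs s" "s ''X'' [length xs] = x" "x < n"
    and tab: "tab \<in> {''G'', ''H''}"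
  shows "sem orc (test (valid_fm tab) 0) s ''r'' [0] = of_bool (valid xs x)"
proof -
  have n: "s ''n'' [] = n" "s ''top'' [] = length xs" and t: "\<And>a. a < n \<Longrightarrow> s tab [x, a] = x \<otimes> a"
    using assms by (auto simp: represents_def)
  have K: "s ''K'' [length xs, a] \<noteq> 0 \<longleftrightarrow> a \<in> gen xs" if "a < n" for a
    using assms(3) that by (simp add: gens_stored_def)
  have ta: "tab \<noteq> ''a''" using tab by auto
  have "fm_ok (valid_fm tab)" using tab by (auto simp: valid_fm_def junk_def)
  then have "sem orc (test (valid_fm tab) 0) s ''r'' [0] = of_bool (fval (valid_fm tab) s)" using sem_test by blast
  moreover have "fval (valid_fm tab) s \<longleftrightarrow> s ''K'' [length xs, x] = 0 \<and>
      (\<forall>a<n. \<not> (s ''K'' [length xs, a] \<noteq> 0 \<and> s tab [x, a] < x))"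
    using n ta assms(4) by (simp add: valid_fm_def store_apply)
  moreover have "\<dots> \<longleftrightarrow> x \<notin> gen xs \<and> (\<forall>a<n. \<not> (a \<in> gen xs \<and> x \<otimes> a < x))"
    using K[OF \<open>x < n\<close>, symmetric] K t by (simp del: neq0_conv not_less)
  moreover have "\<dots> \<longleftrightarrow> valid xs x"
  proof -
    have "gen xs \<subseteq> {..<n}" using gen_carrier[OF assms(2)] carrier_eq by simp
    then have "(\<forall>a<n. \<not> (a \<in> gen xs \<and> x \<otimes> a < x)) \<longleftrightarrow> (\<forall>a\<in>gen xs. x \<le> x \<otimes> a)"
      by (meson lessThan_iff not_less subsetD)
    then show ?thesis using \<open>x < n\<close> by (simp add: valid_def)
  qed
  ultimately show ?thesis by simp
qed

end

text \<open>The search is run twice with different leaf actions. \<open>I V s\<close> states what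
  the action has recorded about the visited sequences V; V exists in the proof only. The leaf is
  executed in every round spent at a full sequence, so \<open>at_full\<close> has to hold for
  repeated visits too.\<close>

locale leaf_invariant = nat_group G n for G :: "nat monoid" (structure) and n +
  fixes orc :: oracle_fun and tab :: vname and leaf :: prog
    and I :: "nat list set \<Rightarrow> state \<Rightarrow> bool"
  assumes tab: "tab \<in> {''G'', ''H''}"
    and leaf_writes: "writes leaf \<inter> {''n'', ''G'', ''H'', ''K'', ''X'', ''top''} = {}"
    and leaf_ok: "loops_ok leaf"
    and frame: "\<And>V s s'. I V s \<Longrightarrow> (\<And>a. a \<notin> work_names \<Longrightarrow> s' a = s a) \<Longrightarrow> I V s'"
    and not_full: "\<And>V s xs. I V s \<Longrightarrow> \<not> full xs \<Longrightarrow> I (insert xs V) s"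
    and at_full: "\<And>V s xs. I V s \<Longrightarrow> full xs \<Longrightarrow> rep tab xs s \<Longrightarrow>
      read_subsets s ''S'' n (s ''l'' []) = series xs \<Longrightarrow> I (insert xs V) (sem orc leaf s)"
begin

definition R :: "nat list \<Rightarrow> nat \<Rightarrow> nat list set \<Rightarrow> state \<Rightarrow> bool" where
  "R xs x V s \<longleftrightarrow> rep tab xs s \<and> s ''X'' [length xs] = x \<and> I V s"

lemma before_move:
  assumes "R xs x V s" and path: "path xs"
  obtains s' where "sem orc (body tab leaf) s = sem orc (move tab) s'"
    "R xs x (insert xs V) s'" "gens_stored (\<lambda>d. gen (take d xs)) xs s'"
proof -
  have rep: "rep tab xs s" and x: "s ''X'' [length xs] = x" and I: "I V s" using assms by (auto simp: R_def)
  define s1 where "s1 = sem orc (chain tab) s"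
  define s2 where "s2 = sem orc (test full_fm 0) s1"
  define s3 where "s3 = sem orc (PIf (Equal (result 0) (Const 0)) PSkip leaf) s2"
  note c = sem_chain[OF rep path tab, of orc, folded s1_def]
  have w2: "s2 a = s1 a" if "a \<noteq> ''a''" "a \<noteq> ''r''" for a
    unfolding s2_def using that by (intro sem_frame) (simp add: writes_test full_fm_def)
  have "I V s1" unfolding s1_def
    by (rule frame[OF I], rule sem_frame) (auto simp: writes_chain work_names_def)
  then have I2: "I V s2" by (rule frame) (rule w2, auto simp: work_names_def)
  have X2: "s2 ''X'' = s ''X''" using w2[of "''X''"] unfolding s1_def by (simp add: sem_frame writes_chain)
  have rep2: "rep tab xs s2" by (rule rep_cong[OF c(3)]; rule w2) (use tab in auto)
  have gens2: "gens_stored (\<lambda>d. gen (take d xs)) xs s2" using c(1) w2[of "''K''"] by (simp add: gens_stored_def)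
  have S2: "read_subsets s2 ''S'' n (s2 ''l'' []) = series xs"
    using c(2) w2[of "''S''"] w2[of "''l''"] by (simp add: read_subsets_def)
  have r: "s2 ''r'' [0] = of_bool (full xs)" unfolding s2_def by (rule sem_full_test[OF c(3) path c(1)])
  have I3: "I (insert xs V) s3"
  proof (cases "full xs")
    case True
    then have "s3 = sem orc leaf s2" using r by (simp add: s3_def)
    then show ?thesis using at_full[OF I2 True rep2 S2] by simp
  next
    case False
    then have "s3 = s2" using r by (simp add: s3_def)
    then show ?thesis using not_full[OF I2 False] by simp
  qed
  have w3: "s3 a = s2 a" if "a \<in> {''n'', ''G'', ''H'', ''K'', ''X'', ''top''}" for a
    unfolding s3_def using that leaf_writes by (intro sem_frame) auto
  have "rep tab xs s3" by (rule rep_cong[OF rep2]; rule w3) (use tab in auto)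
  moreover have "s3 ''X'' [length xs] = x" using w3[of "''X''"] X2 x by simp
  moreover have "gens_stored (\<lambda>d. gen (take d xs)) xs s3" using gens2 w3[of "''K''"] by (simp add: gens_stored_def)
  moreover have "sem orc (body tab leaf) s = sem orc (move tab) s3"
    by (simp add: body_def s1_def s2_def s3_def)
  ultimately show ?thesis using that I3 by (simp add: R_def)
qed

lemma I_move: "I V s \<Longrightarrow> I V (sem orc (move tab) s)"
  by (erule frame, rule sem_frame) (auto simp: writes_move work_names_def)

lemma body_pop:
  assumes "R (xs @ [x]) n V s" "path (xs @ [x])"
  shows "R xs (Suc x) (insert (xs @ [x]) V) (sem orc (body tab leaf) s)"
proof -
  obtain s' where s': "sem orc (body tab leaf) s = sem orc (move tab) s'" "R (xs @ [x]) n (insert (xs @ [x]) V) s'"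
    using before_move[OF assms] by blast
  have f: "s' ''n'' [] = n" "s' ''top'' [] = Suc (length xs)" "s' ''X'' [Suc (length xs)] = n"
    "s' ''X'' [length xs] = x" "\<And>j. j < length xs \<Longrightarrow> s' ''X'' [j] = xs ! j"
    "\<And>i j. i < n \<Longrightarrow> j < n \<Longrightarrow> s' tab [i, j] = i \<otimes> j"
  proof -
    have *: "rep tab (xs @ [x]) s'" "s' ''X'' [length (xs @ [x])] = n" using s'(2) by (auto simp: R_def)
    then have X: "s' ''X'' [j] = (xs @ [x]) ! j" if "j < Suc (length xs)" for j
      using that by (simp add: represents_def)
    show "s' ''n'' [] = n" "s' ''top'' [] = Suc (length xs)" "s' ''X'' [Suc (length xs)] = n"
      "\<And>i j. i < n \<Longrightarrow> j < n \<Longrightarrow> s' tab [i, j] = i \<otimes> j"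
      using * by (simp_all add: represents_def)
    show "s' ''X'' [length xs] = x" using X[of "length xs"] by simp
    show "s' ''X'' [j] = xs ! j" if "j < length xs" for j using X[of j] that by (simp add: nth_append)
  qed
  have e: "sem orc (move tab) s' = store (store s' ''top'' [] (length xs)) ''X'' [length xs] (Suc x)"
    using f by (simp add: move_def incr_cand_def store_def)
  have "tab \<noteq> ''top''" "tab \<noteq> ''X''" using tab by auto
  then have "rep tab xs (sem orc (move tab) s')" "sem orc (move tab) s' ''X'' [length xs] = Suc x"
    unfolding e using f by (auto simp: represents_def store_def)
  moreover have "I (insert (xs @ [x]) V) (sem orc (move tab) s')" using s'(2) by (intro I_move) (simp add: R_def)
  ultimately show ?thesis unfolding s'(1) R_def by blast
qed

lemma body_not_pop:
  assumes R: "R xs x V s" and path: "path xs" and x: "x < n"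
  shows "if valid xs x then R (xs @ [x]) 0 (insert xs V) (sem orc (body tab leaf) s)
    else R xs (Suc x) (insert xs V) (sem orc (body tab leaf) s)"
proof -
  obtain s' where s': "sem orc (body tab leaf) s = sem orc (move tab) s'" "R xs x (insert xs V) s'"
    "gens_stored (\<lambda>d. gen (take d xs)) xs s'"
    using before_move[OF R path] by blast
  define t where "t = sem orc (test (valid_fm tab) 0) s'"
  have r: "t ''r'' [0] = of_bool (valid xs x)"
    unfolding t_def by (rule sem_valid_test[OF _ path s'(3) _ x tab]) (use s'(2) in \<open>auto simp: R_def\<close>)
  have w: "t a = s' a" if "a \<noteq> ''a''" "a \<noteq> ''r''" for a
    unfolding t_def using that by (intro sem_frame) (simp add: writes_test valid_fm_def)
  have tn: "tab \<noteq> ''top''" "tab \<noteq> ''X''" "tab \<noteq> ''a''" "tab \<noteq> ''r''" using tab by auto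
  have f: "t ''n'' [] = n" "t ''top'' [] = length xs" "t ''X'' [length xs] = x"
    "\<And>j. j < length xs \<Longrightarrow> t ''X'' [j] = xs ! j"
    "\<And>i j. i < n \<Longrightarrow> j < n \<Longrightarrow> t tab [i, j] = i \<otimes> j"
    using s'(2) w[of "''n''"] w[of "''top''"] w[of "''X''"] w[OF tn(3,4)] by (simp_all add: R_def represents_def)
  have f': "s' ''n'' [] = n" "s' ''top'' [] = length xs" "s' ''X'' [length xs] = x"
    using s'(2) unfolding R_def represents_def by auto
  have I: "I (insert xs V) (sem orc (move tab) s')" using s'(2) by (intro I_move) (simp add: R_def)
  have e: "sem orc (move tab) s' = (if valid xs x then store (store t ''top'' [] (Suc (length xs))) ''X'' [Suc (length xs)] 0
      else store t ''X'' [length xs] (Suc x))"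
    using f f' x r by (simp add: move_def incr_cand_def store_apply flip: t_def)
  show ?thesis
  proof (cases "valid xs x")
    case True
    then have "rep tab (xs @ [x]) (sem orc (move tab) s')" "sem orc (move tab) s' ''X'' [Suc (length xs)] = 0"
      unfolding e using f tn by (auto simp: represents_def store_def nth_append less_Suc_eq)
    then show ?thesis using True I unfolding s'(1) R_def by simp
  next
    case False
    then have "rep tab xs (sem orc (move tab) s')" "sem orc (move tab) s' ''X'' [length xs] = Suc x"
      unfolding e using f tn by (auto simp: represents_def store_def)
    then show ?thesis using False I unfolding s'(1) R_def by simp
  qed
qed

text \<open>The number of rounds is bounded by the weight of the root and the time of each by the
  syntactic cost of the body; the 3 covers the two initial assignments and the final test.\<close>

lemma enumerate_exec:
  assumes p: "2 \<le> p" "\<And>m. 1 < m \<Longrightarrow> m dvd n \<Longrightarrow> p \<le> real m"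
    and s: "s ''n'' [] = n" "\<And>i j. i < n \<Longrightarrow> j < n \<Longrightarrow> s tab [i, j] = i \<otimes> j" "I {} s"
  shows "\<exists>t s'. exec orc (enumerate tab leaf) s t s' \<and> I {xs. path xs} s' \<and> s' ''n'' = s ''n'' \<and>
    s' ''G'' = s ''G'' \<and> s' ''H'' = s ''H'' \<and>
    real t \<le> weight p [] * ((real n + 2) ^ cost (body tab leaf) + 1) + 3"
proof -
  let ?f = "sem orc (body tab leaf)" and ?N = "n + 2"
  let ?s = "store (store s ''top'' [] 0) ''X'' [0] 0"
  have tn: "tab \<noteq> ''top''" "tab \<noteq> ''X''" using tab by auto
  have "I {} ?s" by (rule frame[OF s(3)]) (auto simp: work_names_def store_def)
  then have R0: "R [] 0 {} ?s" using s tn by (simp add: R_def represents_def store_def)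
  have ext: "extensions [] = {xs. path xs}" by (auto simp: extensions_def)
  have "\<exists>m s'. real m + 2 \<le> weight p [] \<and> iterates ?f (\<lambda>s. bval s loop_cond) m ?s s' \<and> R [] n ({} \<union> extensions []) s'"
  proof (rule depth_first_search[where R = R, OF _ _ _ _ _ path.Nil R0])
    show "R (xs @ [x]) 0 (insert xs V) (?f s)" if "R xs x V s" "path xs" "valid xs x" for xs x V s
      using body_not_pop[OF that(1,2)] that(3) valid_less by auto
    show "R xs (Suc x) (insert xs V) (?f s)" if "R xs x V s" "path xs" "x < n" "\<not> valid xs x" for xs x V s
      using body_not_pop[OF that(1,2,3)] that(4) by auto
    show "R xs (Suc x) (insert (xs @ [x]) V) (?f s)" if "R (xs @ [x]) n V s" "path (xs @ [x])" for xs x V s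
      using body_pop that by blast
    show "bval s loop_cond \<longleftrightarrow> \<not> (xs = [] \<and> x = n)" if "R xs x V s" for xs x V s
      using that by (auto simp: R_def represents_def loop_cond_def)
    show "real n + 2 + (\<Sum>x | valid xs x. weight p (xs @ [x])) \<le> weight p xs" if "path xs" for xs
      by (rule weight_step[OF p that])
  qed
  then obtain m s' where m: "real m + 2 \<le> weight p []" "iterates ?f (\<lambda>s. bval s loop_cond) m ?s s'"
    "R [] n {xs. path xs} s'" unfolding ext by auto
  have fin: "\<not> bval s' loop_cond" using m(3) by (auto simp: R_def represents_def loop_cond_def)
  define P where "P t \<longleftrightarrow> t ''n'' = s ''n'' \<and> t ''G'' = s ''G'' \<and> t ''H'' = s ''H''" for t :: state
  have nw: "a \<notin> writes (body tab leaf)" if "a \<in> {''n'', ''G'', ''H''}" for a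
    using that leaf_writes by (auto simp: body_def writes_chain writes_move writes_test full_fm_def)
  have "loops_ok (body tab leaf)"
  proof -
    have "loops_ok (chain tab)" using compr_ok_fms[OF tab] tab
      by (auto simp: chain_def list_marked_def loops_ok_compr writes_compr fm_defs)
    moreover have "loops_ok (test full_fm 0)" "loops_ok (test (valid_fm tab) 0)"
      using tab by (auto intro!: loops_ok_test simp: full_fm_def valid_fm_def junk_def)
    ultimately show ?thesis using leaf_ok by (simp add: body_def move_def incr_cand_def)
  qed
  then have step: "\<exists>t' \<le> ?N ^ cost (body tab leaf). exec orc (compile (body tab leaf)) t t' (?f t) \<and> P (?f t)"
    if "P t" for t
    using compile_exec[of "body tab leaf" t ?N orc] nw that s(1) by (simp add: P_def sem_frame)
  have "P ?s" by (simp add: P_def store_def)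
  then obtain t where t: "t \<le> m * (?N ^ cost (body tab leaf) + 1) + 1"
    "exec orc (While loop_cond (compile (body tab leaf))) ?s t s'" "P s'"
    using exec_While_iterates[OF m(2) fin, of P "?N ^ cost (body tab leaf)" orc "compile (body tab leaf)"] step by blast
  have e: "exec orc (enumerate tab leaf) s (1 + (1 + t)) s'"
    unfolding enumerate_def
  proof (rule exec.Seq)
    show "exec orc (Assign ''top'' [] (Const 0)) s 1 (store s ''top'' [] 0)"
      using exec.Assign[of orc "''top''" "[]" "Const 0" s] by simp
    show "exec orc (Seq (Assign ''X'' [Const 0] (Const 0)) (While loop_cond (compile (body tab leaf))))
        (store s ''top'' [] 0) (1 + t) s'"
      using exec.Seq[OF exec.Assign[of orc "''X''" "[Const 0]" "Const 0" "store s ''top'' [] 0"]] t(2) by simp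
  qed
  have "real (1 + (1 + t)) \<le> real (m * (?N ^ cost (body tab leaf) + 1) + 3)"
    using t(1) by (intro of_nat_mono) simp
  also have "\<dots> = real m * ((real n + 2) ^ cost (body tab leaf) + 1) + 3" by (simp add: algebra_simps)
  also have "\<dots> \<le> weight p [] * ((real n + 2) ^ cost (body tab leaf) + 1) + 3"
    using m(1) by (intro add_right_mono mult_right_mono) auto
  finally show ?thesis using e t(3) m(3) unfolding P_def R_def by blast
qed

end

section \<open>The reduction\<close>

definition keep_longest :: prog where
  "keep_longest = PIf (Less (var ''best'') (var ''l''))
     (PSeq (PAssign ''best'' [] (var ''l'')) (copy ''SG'' ''S'')) PSkip"

text \<open>A longer series invalidates all earlier answers, so \<open>out\<close> is reset first.
  After this update, equality of \<open>bestH\<close> and \<open>l\<close> means that the present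
  series is at least as long as all before.\<close>

definition query_longest :: prog where
  "query_longest = PSeq
     (PIf (Less (var ''bestH'') (var ''l''))
       (PSeq (PAssign ''bestH'' [] (var ''l'')) (PAssign ''out'' [] (Const 0))) PSkip)
     (PIf (Equal (var ''bestH'') (var ''l''))
       (PSeq
         (PQuery ''ans'' (Query_Arg (var ''n'') ''G'' (var ''best'') ''SG'') (Query_Arg (var ''n'') ''H'' (var ''l'') ''S''))
         (PIf (Equal (var ''ans'') (Const 0)) PSkip (PAssign ''out'' [] (Const 1))))
       PSkip)"

definition reduction :: com where
  "reduction = Seq (enumerate ''G'' keep_longest) (enumerate ''H'' query_longest)"

lemma length_read_subsets: "length (read_subsets s a n l) = l"
  by (simp add: read_subsets_def)

context nat_group begin

text \<open>Positivity lets the initial value 0 of \<open>best\<close> and \<open>bestH\<close>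
  stand for "nothing found yet". The upper bound ensures that \<open>copy\<close>, which transfers n
  rows, saves a whole series.\<close>

lemma series_length_bounds:
  assumes "full xs" shows "0 < length (series xs)" "length (series xs) \<le> n"
proof -
  show "0 < length (series xs)" using series_subnormal[OF assms] by (auto simp: subnormal_series_def)
  have "length (series xs) \<le> length [0..<Suc (length xs)]" unfolding series_def length_map by (rule length_filter_le)
  then show "length (series xs) \<le> n" using length_path[of xs] assms by (simp add: full_def)
qed

text \<open>\<open>bestH\<close> and \<open>out\<close> are carried along because the second search
  relies on their initial value 0.\<close>

definition longest_kept :: "nat list set \<Rightarrow> state \<Rightarrow> bool" where
  "longest_kept V s \<longleftrightarrow> s ''n'' [] = n \<and>
     s ''bestH'' [] = 0 \<and> s ''out'' [] = 0 \<and>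
     (\<forall>xs\<in>V. full xs \<longrightarrow> length (series xs) \<le> s ''best'' []) \<and>
     (s ''best'' [] = 0 \<or> (\<exists>xs\<in>V. full xs \<and> read_subsets s ''SG'' n (s ''best'' []) = series xs))"

lemma leaf_invariant_keep_longest: "leaf_invariant G n orc ''G'' keep_longest longest_kept"
proof (unfold_locales, goal_cases)
  case 1
  then show ?case by simp
next
  case 2
  then show ?case by (simp add: keep_longest_def copy_def)
next
  case 3
  then show ?case by (simp add: keep_longest_def copy_def)
next
  case (4 V s s')
  have "s' a = s a" if "a \<in> {''n'', ''best'', ''SG'', ''bestH'', ''out''}" for a
    using 4(2)[of a] that by (auto simp: work_names_def)
  then show ?case using 4(1) by (simp add: longest_kept_def read_subsets_def)
next
  case (5 V s xs)
  then show ?case by (auto simp: longest_kept_def)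
next
  case (6 V s xs)
  define l where "l = s ''l'' []"
  have l: "l = length (series xs)" using 6(4) by (metis l_def length_read_subsets)
  have n: "s ''n'' [] = n" using 6(1) by (simp add: longest_kept_def)
  show ?case
  proof (cases "s ''best'' [] < l")
    case False
    then have "sem orc keep_longest s = s" by (simp add: keep_longest_def l_def)
    moreover have "0 < s ''best'' []" using False l series_length_bounds(1)[OF 6(2)] by (metis gr_zeroI)
    ultimately show ?thesis using 6(1) False l by (auto simp: longest_kept_def)
  next
    case True
    let ?s = "store s ''best'' [] l"
    let ?t = "sem orc (copy ''SG'' ''S'') ?s"
    have e: "sem orc keep_longest s = ?t" using True by (simp add: keep_longest_def l_def)
    have t: "?t ''best'' [] = l" "?t ''n'' [] = n" "?t ''bestH'' [] = 0" "?t ''out'' [] = 0"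
      using 6(1) unfolding longest_kept_def by (simp_all add: sem_frame copy_def store_def)
    have "?t ''SG'' [d, i] = s ''S'' [d, i]" if "d < n" "i < n" for d i
      using sem_copy[of "''SG''" "''S''" d ?s i orc] that n by (simp add: store_def)
    moreover have "l \<le> n" using l series_length_bounds(2)[OF 6(2)] by simp
    ultimately have "read_subsets ?t ''SG'' n l = read_subsets s ''S'' n l"
      unfolding read_subsets_def by (intro map_cong) auto
    then have "read_subsets ?t ''SG'' n l = series xs" using 6(4) by (simp add: l_def)
    moreover have "length (series ys) \<le> l" if "ys \<in> insert xs V" "full ys" for ys
    proof (cases "ys = xs")
      case False
      then have "length (series ys) \<le> s ''best'' []" using that 6(1) by (simp add: longest_kept_def)
      then show ?thesis using True by simp
    qed (simp add: l)
    ultimately show ?thesis unfolding e longest_kept_def t using 6(2) by auto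
  qed
qed

text \<open>The oracle is arbitrary here: \<open>out\<close> records its answers on the series of
  greatest length so far. Only after the search are these known to be composition series.\<close>

definition queries_done :: "oracle_fun \<Rightarrow> instance_half \<Rightarrow> table \<Rightarrow> nat list set \<Rightarrow> state \<Rightarrow> bool" where
  "queries_done orc g B V s \<longleftrightarrow> s ''n'' [] = n \<and>
     (read_table s ''G'' n, read_subsets s ''SG'' n (s ''best'' [])) = g \<and> read_table s ''H'' n = B \<and>
     (\<forall>xs\<in>V. full xs \<longrightarrow> length (series xs) \<le> s ''bestH'' []) \<and>
     (s ''bestH'' [] = 0 \<or> (\<exists>xs\<in>V. full xs \<and> length (series xs) = s ''bestH'' [])) \<and>
     s ''out'' [] = of_bool (\<exists>xs\<in>V. full xs \<and> length (series xs) = s ''bestH'' [] \<and> orc g (B, series xs))"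

lemma leaf_invariant_query_longest: "leaf_invariant G n orc ''H'' query_longest (queries_done orc g B)"
proof (unfold_locales, goal_cases)
  case 1
  then show ?case by simp
next
  case 2
  then show ?case by (simp add: query_longest_def)
next
  case 3
  then show ?case by (simp add: query_longest_def)
next
  case (4 V s s')
  have "s' a = s a" if "a \<in> {''n'', ''G'', ''H'', ''best'', ''SG'', ''bestH'', ''out''}" for a
    using 4(2)[of a] that by (auto simp: work_names_def)
  then show ?case using 4(1) by (simp add: queries_done_def read_subsets_def read_table_def)
next
  case (5 V s xs)
  have e1: "(\<exists>ys\<in>insert xs V. full ys \<and> P ys) \<longleftrightarrow> (\<exists>ys\<in>V. full ys \<and> P ys)" for P using 5(2) by blast
  have e2: "(\<forall>ys\<in>insert xs V. full ys \<longrightarrow> P ys) \<longleftrightarrow> (\<forall>ys\<in>V. full ys \<longrightarrow> P ys)" for P using 5(2) by blast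
  show ?case using 5(1) unfolding queries_done_def e1 e2 .
next
  case (6 V s xs)
  define l where "l = length (series xs)"
  define h where "h = s ''bestH'' []"
  define yes where "yes \<longleftrightarrow> orc g (B, series xs)"
  have l: "s ''l'' [] = l" using 6(4) by (metis l_def length_read_subsets)
  have n: "s ''n'' [] = n" and g: "(read_table s ''G'' n, read_subsets s ''SG'' n (s ''best'' [])) = g"
    and B: "read_table s ''H'' n = B"
    and le: "\<And>ys. ys \<in> V \<Longrightarrow> full ys \<Longrightarrow> length (series ys) \<le> h"
    and ex: "h = 0 \<or> (\<exists>ys\<in>V. full ys \<and> length (series ys) = h)"
    and out: "s ''out'' [] = of_bool (\<exists>ys\<in>V. full ys \<and> length (series ys) = h \<and> orc g (B, series ys))"
    using 6(1) by (auto simp: queries_done_def h_def)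
  define t where "t = (if h < l then store (store s ''bestH'' [] l) ''out'' [] 0 else s)"
  define u where "u = store t ''ans'' [] (of_bool yes)"
  have t: "t ''n'' = s ''n''" "t ''G'' = s ''G''" "t ''H'' = s ''H''" "t ''SG'' = s ''SG''" "t ''best'' = s ''best''"
    "t ''S'' = s ''S''" "t ''l'' = s ''l''" "t ''bestH'' [] = max h l" "t ''out'' [] = (if h < l then 0 else s ''out'' [])"
    by (simp_all add: t_def store_def h_def)
  have args: "read_arg t (Query_Arg (var ''n'') ''G'' (var ''best'') ''SG'') = g"
    "read_arg t (Query_Arg (var ''n'') ''H'' (var ''l'') ''S'') = (B, series xs)"
    using t n g B 6(4) by (simp_all add: read_table_def read_subsets_def)
  have first: "sem orc (PIf (Less (var ''bestH'') (var ''l''))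
       (PSeq (PAssign ''bestH'' [] (var ''l'')) (PAssign ''out'' [] (Const 0))) PSkip) s = t"
    using l by (simp add: t_def h_def)
  have e: "sem orc query_longest s = (if max h l = l then if yes then store u ''out'' [] 1 else u else t)"
    using first args t l unfolding query_longest_def
    by (simp add: u_def yes_def store_apply del: read_arg.simps)
  have l0: "0 < l" using series_length_bounds(1)[OF 6(2)] by (simp add: l_def)
  let ?f = "sem orc query_longest s"
  have f: "?f ''n'' = s ''n''" "?f ''G'' = s ''G''" "?f ''H'' = s ''H''" "?f ''SG'' = s ''SG''" "?f ''best'' = s ''best''"
    "?f ''bestH'' [] = max h l"
    "?f ''out'' [] = (if max h l = l \<and> yes then 1 else t ''out'' [])"
    unfolding e u_def using t by (simp_all add: store_def)
  have lens: "length (series ys) \<le> max h l" if "ys \<in> insert xs V" "full ys" for ys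
    using le[of ys] that by (auto simp: l_def)
  have att: "\<exists>ys\<in>insert xs V. full ys \<and> length (series ys) = max h l"
  proof (cases "h < l")
    case True
    then show ?thesis using 6(2) by (intro bexI[of _ xs]) (auto simp: l_def)
  next
    case False
    \<comment> \<open>\<open>h\<close> is nonzero because h >= l > 0, so some earlier series attains
      it.\<close>
    then obtain ys where "ys \<in> V" "full ys" "length (series ys) = h" using ex l0 by auto
    then show ?thesis using False by (intro bexI[of _ ys]) auto
  qed
  have o: "(if max h l = l \<and> yes then 1 else t ''out'' []) =
      of_bool (\<exists>ys\<in>insert xs V. full ys \<and> length (series ys) = max h l \<and> orc g (B, series ys))"
  proof (cases "h < l")
    case True
    \<comment> \<open>All earlier series have length at most h < l and drop out, which justifies
      resetting \<open>out\<close>.\<close>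
    then have "(\<exists>ys\<in>insert xs V. full ys \<and> length (series ys) = max h l \<and> orc g (B, series ys)) \<longleftrightarrow> yes"
      using le 6(2) unfolding yes_def l_def by fastforce
    then show ?thesis using True t by simp
  next
    case False
    have "(\<exists>ys\<in>insert xs V. full ys \<and> length (series ys) = h \<and> orc g (B, series ys)) \<longleftrightarrow>
      (h = l \<and> yes) \<or> (\<exists>ys\<in>V. full ys \<and> length (series ys) = h \<and> orc g (B, series ys))"
      using 6(2) by (auto simp: yes_def l_def)
    moreover have "max h l = h" using False by simp
    ultimately show ?thesis using False t out by auto
  qed
  have "read_table ?f ''G'' n = read_table s ''G'' n" "read_table ?f ''H'' n = read_table s ''H'' n"
    "read_subsets ?f ''SG'' n (?f ''best'' []) = read_subsets s ''SG'' n (s ''best'' [])"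
    using f by (simp_all add: read_table_def read_subsets_def)
  then show ?case
    unfolding queries_done_def using n g B lens att o f by auto
qed

end

section \<open>Input tables, estimates and the final assembly\<close>

lemma nat_group_table:
  assumes "group_table A" "length A = n" shows "nat_group (table_group A) n"
proof -
  interpret group "table_group A" using assms by (simp add: group_table_def)
  show ?thesis by unfold_locales (use assms in \<open>simp add: table_group_def\<close>)
qed

lemma table_cell_mult:
  assumes "group_table A" "length A = n" "i < n" "j < n"
  shows "table_cell A [i, j] = i \<otimes>\<^bsub>table_group A\<^esub> j"
  using assms by (simp add: group_table_def table_group_def)

lemma read_table_eq:
  assumes "group_table A" "length A = n" "s a = table_cell A"
  shows "read_table s a n = A"
proof (rule nth_equalityI)
  show "length (read_table s a n) = length A" using assms by (simp add: read_table_def)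
  fix i assume "i < length (read_table s a n)"
  then have i: "i < n" by (simp add: read_table_def)
  then have "length (A ! i) = n" using assms by (simp add: group_table_def)
  then show "read_table s a n ! i = A ! i"
    using i assms by (intro nth_equalityI) (auto simp: read_table_def)
qed

text \<open>For n >= 2, the factor 2(n + 2) is at most n^3 and (n + 2)^a + 1 is at most n^(2a + 1).
  Absorbing the final 3 costs another n^2, which gives the exponent 2a + 6.\<close>

lemma time_bound:
  fixes n a :: nat and L :: real
  defines "E \<equiv> real n powr (L / 2 + 3 / 2)"
  assumes n: "2 \<le> n" and L: "0 \<le> L"
  shows "2 * (real n + 2) * E * ((real n + 2) ^ a + 1) + 3 \<le> E * real n ^ (2 * a + 6)"
proof -
  have r: "2 \<le> real n" using n by simp
  have E: "1 \<le> E" unfolding E_def using r L by (intro ge_one_powr_ge_zero) auto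
  have "2 * real n \<le> real n * real n" by (rule mult_right_mono[OF r]) simp
  then have n2: "real n + 2 \<le> real n ^ 2" unfolding power2_eq_square using r by linarith
  have n4: "4 \<le> real n ^ 2" using power_mono[OF r, of 2] by simp
  have "2 * (real n + 2) \<le> real n * real n ^ 2" using r n2 by (intro mult_mono) auto
  then have A: "2 * (real n + 2) \<le> real n ^ 3" by (simp add: power2_eq_square power3_eq_cube)
  have "(real n + 2) ^ a \<le> (real n ^ 2) ^ a" using n2 by (intro power_mono) auto
  then have b: "(real n + 2) ^ a \<le> real n ^ (2 * a)" by (simp add: power_mult)
  have one: "1 \<le> real n ^ (2 * a)" using r by (intro one_le_power) auto
  have "(real n + 2) ^ a + 1 \<le> 2 * real n ^ (2 * a)" using b one by simp
  also have "\<dots> \<le> real n * real n ^ (2 * a)" using r by (intro mult_right_mono) auto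
  finally have B: "(real n + 2) ^ a + 1 \<le> real n * real n ^ (2 * a)" .
  have "2 * (real n + 2) * ((real n + 2) ^ a + 1) \<le> real n ^ 3 * (real n * real n ^ (2 * a))"
    using A B by (intro mult_mono) auto
  then have C: "2 * (real n + 2) * ((real n + 2) ^ a + 1) \<le> real n ^ (2 * a + 4)"
    by (simp add: power_add power3_eq_cube power4_eq_xxxx mult_ac)
  define X where "X = E * real n ^ (2 * a + 4)"
  have "1 * 1 \<le> X" unfolding X_def using E r by (intro mult_mono one_le_power) auto
  then have X: "1 \<le> X" by simp
  have "2 * (real n + 2) * E * ((real n + 2) ^ a + 1) = E * (2 * (real n + 2) * ((real n + 2) ^ a + 1))"
    by (simp add: mult_ac)
  also have "\<dots> \<le> X" unfolding X_def using C E by (intro mult_left_mono) auto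
  finally have "2 * (real n + 2) * E * ((real n + 2) ^ a + 1) + 3 \<le> X * 4" using X by simp
  also have "\<dots> \<le> X * real n ^ 2" using n4 X by (intro mult_left_mono) auto
  also have "\<dots> = E * real n ^ (2 * a + 4 + 2)" unfolding X_def power_add[of _ "2 * a + 4" 2] by (simp only: mult.assoc)
  also have "2 * a + 4 + 2 = 2 * a + 6" by simp
  finally show ?thesis .
qed

text \<open>A divisor m > 1 has a prime factor, which also divides n and is at most m.\<close>

lemma smallest_prime_divisor_props:
  assumes "2 \<le> n"
  shows "2 \<le> smallest_prime_divisor n" "\<And>m. 1 < m \<Longrightarrow> m dvd n \<Longrightarrow> smallest_prime_divisor n \<le> m"
proof -
  have "n \<noteq> 1" using assms by simp
  then obtain q where "prime q" "q dvd n" using prime_factor_nat by blast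
  then have "prime (smallest_prime_divisor n)"
    unfolding smallest_prime_divisor_def using LeastI[of "\<lambda>p. prime p \<and> p dvd n" q] by simp
  then show "2 \<le> smallest_prime_divisor n" by (rule prime_ge_2_nat)
  fix m :: nat assume m: "1 < m" "m dvd n"
  then obtain q where q: "prime q" "q dvd m" using prime_factor_nat[of m] by auto
  then have "smallest_prime_divisor n \<le> q"
    unfolding smallest_prime_divisor_def using m by (intro Least_le) (auto intro: dvd_trans)
  also have "q \<le> m" using q m by (intro dvd_imp_le) auto
  finally show "smallest_prime_divisor n \<le> m" .
qed

lemma reduction_exec:
  assumes orc: "solves_composition_series_iso orc"
    and A: "group_table A" "length A = n" and B: "group_table B" "length B = n"
    and p: "2 \<le> p" "\<And>m. 1 < m \<Longrightarrow> m dvd n \<Longrightarrow> p \<le> real m"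
  defines "W \<equiv> 2 * (real n + 2) * p powr ((log p n) ^ 2 / 2 + 3 * log p n / 2)"
  shows "\<exists>t s. exec orc reduction (input_state A B) t s \<and>
    output_of s = (if table_group A \<cong> table_group B then 1 else 0) \<and>
    real t \<le> (W * ((real n + 2) ^ cost (body ''G'' keep_longest) + 1) + 3) +
      (W * ((real n + 2) ^ cost (body ''H'' query_longest) + 1) + 3)"
proof -
  let ?G = "table_group A" and ?H = "table_group B"
  interpret G: nat_group ?G n using nat_group_table A .
  interpret H: nat_group ?H n using nat_group_table B .
  let ?s = "input_state A B"
  have s: "?s ''n'' [] = n" "?s ''G'' = table_cell A" "?s ''H'' = table_cell B" "?s ''best'' [] = 0"
    "?s ''bestH'' [] = 0" "?s ''out'' [] = 0"
    using A by (simp_all add: input_state_def)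
  interpret LG: leaf_invariant ?G n orc "''G''" keep_longest G.longest_kept
    by (rule G.leaf_invariant_keep_longest)
  have "G.longest_kept {} ?s" using s by (simp add: G.longest_kept_def)
  then obtain t1 s1 where 1: "exec orc (enumerate ''G'' keep_longest) ?s t1 s1" "G.longest_kept {xs. G.path xs} s1"
    "s1 ''n'' = ?s ''n''" "s1 ''G'' = ?s ''G''" "s1 ''H'' = ?s ''H''"
    "real t1 \<le> W * ((real n + 2) ^ cost (body ''G'' keep_longest) + 1) + 3"
    using LG.enumerate_exec[OF p, of ?s] s table_cell_mult[OF A] unfolding W_def G.weight_Nil by auto
  obtain xs0 where xs0: "G.full xs0" using G.ex_full by blast
  then have "length (G.series xs0) \<le> s1 ''best'' []"
    using 1(2) by (simp add: G.longest_kept_def G.full_def)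
  \<comment> \<open>The whole group is generated by some path and every series is nonempty, so the
    initial 0 has been replaced by a stored series.\<close>
  then have "s1 ''best'' [] \<noteq> 0" using G.series_length_bounds(1)[OF xs0] by linarith
  then obtain xs where xs: "G.full xs" "read_subsets s1 ''SG'' n (s1 ''best'' []) = G.series xs"
    using 1(2) by (auto simp: G.longest_kept_def)
  then have "length (G.series xs) = s1 ''best'' []" by (metis length_read_subsets)
  then have longest: "G.longest xs"
    using 1(2) xs(1) by (auto simp: G.longest_kept_def G.longest_def G.full_def)
  define g where "g = (A, G.series xs)"
  interpret LH: leaf_invariant ?H n orc "''H''" query_longest "H.queries_done orc g B"
    by (rule H.leaf_invariant_query_longest)
  have "read_table s1 ''G'' n = A" "read_table s1 ''H'' n = B"
    using read_table_eq[OF A] read_table_eq[OF B] 1(4,5) s by simp_all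
  then have "H.queries_done orc g B {} s1"
    using 1(2) xs(2) by (simp add: H.queries_done_def G.longest_kept_def g_def)
  then obtain t2 s2 where 2: "exec orc (enumerate ''H'' query_longest) s1 t2 s2"
    "H.queries_done orc g B {xs. H.path xs} s2"
    "real t2 \<le> W * ((real n + 2) ^ cost (body ''H'' query_longest) + 1) + 3"
    using LH.enumerate_exec[OF p, of s1] 1(3,5) s table_cell_mult[OF B] unfolding W_def H.weight_Nil by auto
  have le: "length (H.series ys) \<le> s2 ''bestH'' []" if "H.full ys" for ys
    using 2(2) that by (simp add: H.queries_done_def H.full_def)
  obtain ys0 where ys0: "H.full ys0" using H.ex_full by blast
  then have "s2 ''bestH'' [] \<noteq> 0" using le[OF ys0] H.series_length_bounds(1)[OF ys0] by linarith
  then obtain zs where zs: "H.full zs" "length (H.series zs) = s2 ''bestH'' []"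
    using 2(2) by (auto simp: H.queries_done_def)
  have longest_iff: "H.longest ys \<longleftrightarrow> H.full ys \<and> length (H.series ys) = s2 ''bestH'' []" for ys
    using le zs unfolding H.longest_def by (metis order_antisym)
  have orc_iff: "orc g (B, H.series ys) \<longleftrightarrow> series_isomorphic ?G (G.series xs) ?H (H.series ys)" if "H.longest ys" for ys
    using orc A(1) B(1) G.longest_composition_series[OF longest] H.longest_composition_series[OF that]
    unfolding solves_composition_series_iso_def g_def by blast
  have "(\<exists>ys. H.longest ys \<and> orc g (B, H.series ys)) \<longleftrightarrow> ?G \<cong> ?H"
  proof
    assume "\<exists>ys. H.longest ys \<and> orc g (B, H.series ys)"
    then obtain ys where "H.longest ys" "orc g (B, H.series ys)" by blast
    then have "series_isomorphic ?G (G.series xs) ?H (H.series ys)" using orc_iff by simp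
    then show "?G \<cong> ?H" unfolding series_isomorphic_def is_iso_def by blast
  next
    assume "?G \<cong> ?H"
    then obtain \<phi> where \<phi>: "\<phi> \<in> iso ?G ?H" by (auto simp: is_iso_def)
    obtain ys where ys: "H.longest ys" "H.series ys = map ((`) \<phi>) (G.series xs)"
      using longest_series_iso[OF G.nat_group_axioms H.nat_group_axioms \<phi> longest] by blast
    have "series_isomorphic ?G (G.series xs) ?H (H.series ys)"
      unfolding series_isomorphic_def ys(2) using \<phi> by auto
    then show "\<exists>ys. H.longest ys \<and> orc g (B, H.series ys)" using ys(1) orc_iff by blast
  qed
  moreover have "s2 ''out'' [] = of_bool (\<exists>ys. H.longest ys \<and> orc g (B, H.series ys))"
  proof -
    have "(\<exists>ys\<in>{xs. H.path xs}. H.full ys \<and> length (H.series ys) = s2 ''bestH'' [] \<and> orc g (B, H.series ys)) \<longleftrightarrow>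
      (\<exists>ys. H.longest ys \<and> orc g (B, H.series ys))"
      unfolding longest_iff H.full_def by auto
    then show ?thesis using 2(2) unfolding H.queries_done_def by simp
  qed
  ultimately have "output_of s2 = (if ?G \<cong> ?H then 1 else 0)" by (simp add: output_of_def)
  moreover have "exec orc reduction ?s (t1 + t2) s2" unfolding reduction_def by (rule exec.Seq[OF 1(1) 2(1)])
  ultimately show ?thesis using 1(6) 2(3) by (intro exI[of _ "t1 + t2"] exI[of _ s2]) simp
qed

theorem theorem2:
  shows "\<exists>(c :: com) (k :: real).
    \<forall>orc. solves_composition_series_iso orc \<longrightarrow>
      (\<forall>(A :: table) (B :: table) (n :: nat).
         group_table A \<and> group_table B \<and> length A = n \<and> length B = n \<longrightarrow>
         (\<exists>t s. exec orc c (input_state A B) t s \<and>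
            output_of s = (if table_group A \<cong> table_group B then 1 else 0) \<and>
            (n \<ge> 2 \<longrightarrow>
               real t \<le> real n powr
                 ((1/2) * log (real (smallest_prime_divisor n)) (real n) + k))))"
proof -
  define a where "a = cost (body ''G'' keep_longest)"
  define b where "b = cost (body ''H'' query_longest)"
  \<comment> \<open>The two searches run one after the other; since x + y <= x * y for x, y >= 2,
    their exponents may be added.\<close>
  define e where "e = (2 * a + 6) + (2 * b + 6)"
  show ?thesis
  proof (rule exI[of _ reduction], rule exI[of _ "3 / 2 + real e"], intro allI impI, elim conjE)
    fix orc :: oracle_fun and A B :: table and n :: nat
    assume *: "solves_composition_series_iso orc" "group_table A" "group_table B" "length A = n" "length B = n"
    \<comment> \<open>For n < 2 only the correct answer is claimed, not the time bound; the value 2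
      then satisfies the conditions on p.\<close>
    define p where "p = (if 2 \<le> n then real (smallest_prime_divisor n) else 2)"
    have p: "2 \<le> p" using smallest_prime_divisor_props(1) by (auto simp: p_def)
    have pm: "p \<le> real m" if "1 < m" "m dvd n" for m
      using that smallest_prime_divisor_props(2)[of n m] by (simp add: p_def)
    obtain t s where ts: "exec orc reduction (input_state A B) t s"
      "output_of s = (if table_group A \<cong> table_group B then 1 else 0)"
      "real t \<le> (2 * (real n + 2) * p powr ((log p n) ^ 2 / 2 + 3 * log p n / 2) * ((real n + 2) ^ a + 1) + 3) +
        (2 * (real n + 2) * p powr ((log p n) ^ 2 / 2 + 3 * log p n / 2) * ((real n + 2) ^ b + 1) + 3)"
      using reduction_exec[OF *(1,2,4,3,5) p pm] unfolding a_def b_def by blast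
    have "real t \<le> real n powr ((1/2) * log (real (smallest_prime_divisor n)) (real n) + (3 / 2 + real e))"
      if n: "2 \<le> n"
    proof -
      define L where "L = log p n"
      define E where "E = real n powr (L / 2 + 3 / 2)"
      have r: "2 \<le> real n" using n by simp
      have L: "0 \<le> L" using p r by (simp add: L_def)
      have pL: "p powr L = n" using p r by (simp add: L_def)
      \<comment> \<open>Since p^L = n, this is n^(L/2 + 3/2): the quadratic exponent over p becomes
        the linear one over n, and the 3/2 goes into the constant k.\<close>
      have "p powr (L ^ 2 / 2 + 3 * L / 2) = p powr (L * (L / 2 + 3 / 2))"
        by (simp add: power2_eq_square algebra_simps)
      also have "\<dots> = E" unfolding E_def powr_powr[symmetric] pL ..
      finally have "real t \<le> (2 * (real n + 2) * E * ((real n + 2) ^ a + 1) + 3) + (2 * (real n + 2) * E * ((real n + 2) ^ b + 1) + 3)"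
        using ts(3) unfolding L_def by simp
      also have "\<dots> \<le> E * real n ^ (2 * a + 6) + E * real n ^ (2 * b + 6)"
        unfolding E_def by (intro add_mono time_bound n L)
      also have "\<dots> = E * (real n ^ (2 * a + 6) + real n ^ (2 * b + 6))" by (simp only: distrib_left)
      also have "\<dots> \<le> E * real n ^ e"
      proof (intro mult_left_mono)
        have "real n \<le> real n ^ (2 * c + 6)" for c using r by (intro self_le_power) auto
        then have big: "2 \<le> real n ^ (2 * c + 6)" for c using r by (meson order_trans)
        have "x + y \<le> x * y" if "2 \<le> x" "2 \<le> y" for x y :: real
          using mult_left_mono[of 2 y x] mult_right_mono[of 2 x y] that by linarith
        then show "real n ^ (2 * a + 6) + real n ^ (2 * b + 6) \<le> real n ^ e"
          unfolding e_def power_add[of _ "2 * a + 6"] using big by blast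
      qed (simp add: E_def)
      also have "\<dots> = real n powr (L / 2 + 3 / 2 + real e)"
        using r by (simp add: E_def powr_add powr_realpow)
      also have "L / 2 + 3 / 2 + real e = (1/2) * log (real (smallest_prime_divisor n)) (real n) + (3 / 2 + real e)"
        using n by (simp add: L_def p_def)
      finally show ?thesis .
    qed
    then show "\<exists>t s. exec orc reduction (input_state A B) t s \<and>
        output_of s = (if table_group A \<cong> table_group B then 1 else 0) \<and>
        (2 \<le> n \<longrightarrow> real t \<le> real n powr ((1/2) * log (real (smallest_prime_divisor n)) (real n) + (3 / 2 + real e)))"
      using ts(1,2) by blast
  qed
qed

end
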